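(* Let $\Omega\subsetneq \mathbb{C}$ be a simply connected domain such that the principal part of every prime end of $\Omega$ is a point. Then every hyperbolic $f\in \mathrm{Hol}_d(\Omega,\Omega)$ has a Denjoy-Wolff point.
   Context: $\mathbb{C}_\infty$ is the Riemann sphere and $\partial\Omega$ is the boundary of $\Omega$ in $\mathbb{C}_\infty$. $\mathrm{Hol}_d(\Omega,\Omega)$ is the set of holomorphic maps $f:\Omega\to\Omega$ without fixed points in $\Omega$. Such an $f$ has a Denjoy-Wolff point if there is $\tau\in\partial\Omega$ such that the iterates $f^{\circ n}$ converge to $\tau$ uniformly on compacta of $\Omega$ (as maps into $\mathbb{C}_\infty$). Let $k_\Omega$ be the hyperbolic distance of $\Omega$. The divergence rate of a holomorphic $f:\Omega\to\Omega$ is $c(f)=\lim_{n\to\infty} k_\Omega(f^{\circ n}(z_0),z_0)/n$ (the limit exists, is finite, and does not depend on $z_0\in\Omega$). A map $f\in \mathrm{Hol}_d(\Omega,\Omega)$ is hyperbolic if $c(f)>0$. Prime ends are the Carathéodory prime ends of $\Omega$. The principal part $\Pi(\underline{\xi})$ of a prime end $\underline{\xi}$ is the set of all $p\in\mathbb{C}_\infty$ for which there exist a null-chain $(C_n)$ representing $\underline{\xi}$ and points $z_n\in C_n$ such that $z_n\to p$ in $\mathbb{C}_\infty$. *)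

theory Defs
  imports "HOL-Complex_Analysis.Complex_Analysis"
begin

section \<open>The Riemann sphere\<close>

datatype riemann_sphere = Fin complex | Infty

text \<open>
  Inverse stereographic projection onto the unit sphere of the Euclidean space
  \<^typ>\<open>complex \<times> real\<close>; the sphere carries the metric induced by this embedding, that is,
  the chordal metric (see \<open>dist_Fin_Fin\<close> and \<open>dist_Fin_Infty\<close> below).
\<close>

fun stereo :: "riemann_sphere \<Rightarrow> complex \<times> real" where
  "stereo (Fin z) =
     ((2 / (1 + (cmod z)\<^sup>2)) *\<^sub>R z, ((cmod z)\<^sup>2 - 1) / ((cmod z)\<^sup>2 + 1))"
| "stereo Infty = (0, 1)"

lemma inj_stereo: "inj stereo"
proof -
  have pos: "1 + (cmod z)\<^sup>2 > 0" for z
    by (simp add: add_pos_nonneg)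
  have ne1: "((cmod z)\<^sup>2 - 1) / ((cmod z)\<^sup>2 + 1) \<noteq> 1" for z
    using pos[of z] by (simp add: divide_eq_eq)
  have eq: "z = w" if "stereo (Fin z) = stereo (Fin w)" for z w
  proof -
    have "((cmod z)\<^sup>2 - 1) / ((cmod z)\<^sup>2 + 1) = ((cmod w)\<^sup>2 - 1) / ((cmod w)\<^sup>2 + 1)"
      using that by simp
    then have "((cmod z)\<^sup>2 - 1) * ((cmod w)\<^sup>2 + 1) = ((cmod w)\<^sup>2 - 1) * ((cmod z)\<^sup>2 + 1)"
      using pos[of z] pos[of w] by (simp add: frac_eq_eq)
    then have n: "(cmod z)\<^sup>2 = (cmod w)\<^sup>2"
      by (simp add: algebra_simps)
    have "(2 / (1 + (cmod z)\<^sup>2)) *\<^sub>R z = (2 / (1 + (cmod w)\<^sup>2)) *\<^sub>R w"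
      using that by simp
    then show "z = w"
      using pos[of w] unfolding n by simp
  qed
  show ?thesis
  proof (rule injI)
    fix x y assume "stereo x = stereo y"
    then show "x = y"
    proof (cases x; cases y)
      fix z w assume "stereo x = stereo y" "x = Fin z" "y = Fin w"
      then show "x = y" using eq by blast
    next
      fix z assume "stereo x = stereo y" "x = Fin z" "y = Infty"
      then show "x = y" using ne1[of z] by simp
    next
      fix w assume "stereo x = stereo y" "x = Infty" "y = Fin w"
      then show "x = y" using ne1[of w] by (metis stereo.simps snd_conv)
    qed simp
  qed
qed

instantiation riemann_sphere :: metric_space
begin

definition dist_riemann_sphere :: "riemann_sphere \<Rightarrow> riemann_sphere \<Rightarrow> real" where
  "dist_riemann_sphere x y = dist (stereo x) (stereo y)"

definition uniformity_riemann_sphere :: "(riemann_sphere \<times> riemann_sphere) filter" where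
  "uniformity_riemann_sphere = (INF e\<in>{0<..}. principal {(x, y). dist x y < e})"

definition open_riemann_sphere :: "riemann_sphere set \<Rightarrow> bool" where
  "open_riemann_sphere U \<longleftrightarrow>
     (\<forall>x\<in>U. eventually (\<lambda>(x', y). x' = x \<longrightarrow> y \<in> U) uniformity)"

instance
proof
  fix x y z :: riemann_sphere
  show "dist x y = 0 \<longleftrightarrow> x = y"
    using inj_stereo by (auto simp: dist_riemann_sphere_def dest: injD)
  show "dist x y \<le> dist x z + dist y z"
    unfolding dist_riemann_sphere_def by (rule dist_triangle2)
qed (fact uniformity_riemann_sphere_def open_riemann_sphere_def)+

end

lemma dist_Fin_Fin:
  "dist (Fin z) (Fin w) =
     2 * cmod (z - w) / (sqrt (1 + (cmod z)\<^sup>2) * sqrt (1 + (cmod w)\<^sup>2))"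
proof -
  define p where "p = 1 + (cmod z)\<^sup>2"
  define q where "q = 1 + (cmod w)\<^sup>2"
  have pq: "p > 0" "q > 0"
    unfolding p_def q_def by (simp_all add: add_pos_nonneg)
  have norm_diff: "(cmod (a - b))\<^sup>2 = (cmod a)\<^sup>2 + (cmod b)\<^sup>2 - 2 * (a \<bullet> b)" for a b :: complex
    by (simp add: power2_norm_eq_inner inner_diff inner_commute)
  have frac: "((cmod z)\<^sup>2 - 1) / ((cmod z)\<^sup>2 + 1) - ((cmod w)\<^sup>2 - 1) / ((cmod w)\<^sup>2 + 1)
      = 2 / q - 2 / p"
    using pq unfolding p_def q_def by (simp add: field_simps)
  have "(dist (Fin z) (Fin w))\<^sup>2 = (cmod ((2 / p) *\<^sub>R z - (2 / q) *\<^sub>R w))\<^sup>2 + (2 / q - 2 / p)\<^sup>2"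
    unfolding dist_riemann_sphere_def stereo.simps dist_Pair_Pair
    unfolding dist_norm real_norm_def frac
    by (simp add: p_def q_def)
  also have "\<dots> = (4 / p\<^sup>2) * (p - 1) + (4 / q\<^sup>2) * (q - 1) - 8 / (p * q) * (z \<bullet> w)
      + (2 / q - 2 / p)\<^sup>2"
    unfolding norm_diff by (simp add: p_def q_def power_mult_distrib power_divide)
  also have "\<dots> = 4 * ((p - 1) + (q - 1) - 2 * (z \<bullet> w)) / (p * q)"
    using pq by (simp add: field_simps power2_eq_square)
  also have "\<dots> = 4 * (cmod (z - w))\<^sup>2 / (p * q)"
    unfolding norm_diff by (simp add: p_def q_def)
  also have "\<dots> = (2 * cmod (z - w) / (sqrt p * sqrt q))\<^sup>2"
    using pq by (simp add: power_divide power_mult_distrib)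
  finally show ?thesis
    unfolding p_def q_def by (rule power2_eq_imp_eq) (simp_all add: add_nonneg_nonneg)
qed

lemma dist_Fin_Infty: "dist (Fin z) Infty = 2 / sqrt (1 + (cmod z)\<^sup>2)"
proof -
  define p where "p = 1 + (cmod z)\<^sup>2"
  have p: "p > 0"
    unfolding p_def by (simp add: add_pos_nonneg)
  have frac: "((cmod z)\<^sup>2 - 1) / ((cmod z)\<^sup>2 + 1) - 1 = - 2 / p"
    using p unfolding p_def by (simp add: field_simps)
  have "(dist (Fin z) Infty)\<^sup>2 = (cmod ((2 / p) *\<^sub>R z))\<^sup>2 + (- 2 / p)\<^sup>2"
    unfolding dist_riemann_sphere_def stereo.simps dist_Pair_Pair
    unfolding dist_norm real_norm_def frac
    by (simp add: p_def)
  also have "\<dots> = (4 / p\<^sup>2) * (p - 1) + 4 / p\<^sup>2"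
    by (simp add: p_def power_mult_distrib power_divide)
  also have "\<dots> = (2 / sqrt p)\<^sup>2"
    using p by (simp add: field_simps power2_eq_square)
  finally show ?thesis
    unfolding p_def by (rule power2_eq_imp_eq) (simp_all add: add_nonneg_nonneg)
qed

definition boundary_sphere :: "complex set \<Rightarrow> riemann_sphere set" where
  "boundary_sphere \<Omega> = frontier (Fin ` \<Omega>)"


section \<open>Hyperbolic distance\<close>

definition poincare_dist :: "complex \<Rightarrow> complex \<Rightarrow> real" where
  "poincare_dist z w = artanh (cmod (Moebius_function 0 w z))"

definition riemann_map :: "complex set \<Rightarrow> (complex \<Rightarrow> complex) \<Rightarrow> bool" where
  "riemann_map \<Omega> \<phi> \<longleftrightarrow> \<phi> holomorphic_on \<Omega> \<and> bij_betw \<phi> \<Omega> (ball 0 1)"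

text \<open>
  The hyperbolic distance of a simply connected domain \<open>\<Omega> \<noteq> \<complex>\<close> is the pull-back of the
  Poincare distance under any Riemann map. By \<open>hyperbolic_dist_eq\<close> below, the choice of the
  Riemann map does not matter.
\<close>

definition hyperbolic_dist :: "complex set \<Rightarrow> complex \<Rightarrow> complex \<Rightarrow> real" where
  "hyperbolic_dist \<Omega> z w =
     (let \<phi> = (SOME \<phi>. riemann_map \<Omega> \<phi>) in poincare_dist (\<phi> z) (\<phi> w))"

lemma riemann_map_exists:
  assumes "open \<Omega>" "simply_connected \<Omega>" "\<Omega> \<noteq> {}" "\<Omega> \<noteq> UNIV"
  shows "\<exists>\<phi>. riemann_map \<Omega> \<phi>"
proof -
  obtain f g where f: "f holomorphic_on \<Omega>"
    and fg: "\<forall>z\<in>\<Omega>. f z \<in> ball 0 1 \<and> g (f z) = z" "\<forall>z\<in>ball 0 1. g z \<in> \<Omega> \<and> f (g z) = z"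
    using Riemann_mapping_theorem[of \<Omega>] assms by blast
  have "bij_betw f \<Omega> (ball 0 1)"
    by (rule bij_betw_byWitness[where f' = g]) (use fg in blast)+
  with f show ?thesis
    unfolding riemann_map_def by blast
qed

lemma Schwarz_Pick:
  assumes T: "T holomorphic_on ball 0 1" "T ` ball 0 1 \<subseteq> ball 0 1"
    and z: "z \<in> ball 0 1" and w: "w \<in> ball 0 1"
  shows "cmod (Moebius_function 0 (T w) (T z)) \<le> cmod (Moebius_function 0 w z)"
proof -
  define g where "g = (\<lambda>x. Moebius_function 0 (T w) (T (Moebius_function 0 (-w) x)))"
  have w1: "cmod w < 1" "cmod z < 1"
    using z w by auto
  have Tw: "cmod (T w) < 1"
    using T(2) w by (metis image_subset_iff mem_ball_0)
  have h1: "Moebius_function 0 (-w) holomorphic_on ball 0 1"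
    using w1 by (intro Moebius_function_holomorphic) simp
  have m1: "Moebius_function 0 (-w) ` ball 0 1 \<subseteq> ball 0 1"
    using Moebius_function_norm_lt_1 w1 by auto
  have h2: "Moebius_function 0 (T w) holomorphic_on ball 0 1"
    using Tw by (intro Moebius_function_holomorphic) simp
  have "(T \<circ> Moebius_function 0 (-w)) holomorphic_on ball 0 1"
    using holomorphic_on_compose_gen[OF h1 T(1)] m1 by blast
  moreover have "(T \<circ> Moebius_function 0 (-w)) ` ball 0 1 \<subseteq> ball 0 1"
    using m1 T(2) by fastforce
  ultimately have "(Moebius_function 0 (T w) \<circ> (T \<circ> Moebius_function 0 (-w))) holomorphic_on ball 0 1"
    using holomorphic_on_compose_gen[OF _ h2] by blast
  then have hg: "g holomorphic_on ball 0 1"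
    unfolding g_def o_def .
  have g0: "g 0 = 0"
    unfolding g_def by (simp add: Moebius_function_of_zero Moebius_function_eq_zero)
  have gn: "cmod (g x) < 1" if "cmod x < 1" for x
  proof -
    have "T (Moebius_function 0 (-w) x) \<in> ball 0 1"
      using that m1 T(2) by (metis image_subset_iff mem_ball_0)
    then show ?thesis
      unfolding g_def using Tw Moebius_function_norm_lt_1 by simp
  qed
  have x: "cmod (Moebius_function 0 w z) < 1"
    using w1 Moebius_function_norm_lt_1 by blast
  have "cmod (g (Moebius_function 0 w z)) \<le> cmod (Moebius_function 0 w z)"
    by (rule Schwarz_Lemma(1)[OF hg g0 gn x])
  moreover have "Moebius_function 0 (-w) (Moebius_function 0 w z) = z"
    using Moebius_function_compose[of "-w" w z] w1 by simp
  ultimately show ?thesis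
    unfolding g_def by simp
qed

lemma hyperbolic_dist_eq:
  assumes \<phi>: "riemann_map \<Omega> \<phi>" and \<Omega>: "open \<Omega>" and z: "z \<in> \<Omega>" and w: "w \<in> \<Omega>"
  shows "hyperbolic_dist \<Omega> z w = poincare_dist (\<phi> z) (\<phi> w)"
proof -
  have le: "cmod (Moebius_function 0 (\<rho> w) (\<rho> z)) \<le> cmod (Moebius_function 0 (\<psi> w) (\<psi> z))"
    if \<psi>: "riemann_map \<Omega> \<psi>" and \<rho>: "riemann_map \<Omega> \<rho>" for \<psi> \<rho>
  proof -
    have b: "inj_on \<psi> \<Omega>" "\<psi> ` \<Omega> = ball 0 1" "\<rho> ` \<Omega> = ball 0 1"
      and h: "\<psi> holomorphic_on \<Omega>" "\<rho> holomorphic_on \<Omega>"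
      using \<psi> \<rho> by (auto simp: riemann_map_def bij_betw_def)
    obtain g where g: "g holomorphic_on ball 0 1" "\<And>z. z \<in> \<Omega> \<Longrightarrow> g (\<psi> z) = z"
      using holomorphic_has_inverse[OF h(1) \<Omega> b(1)] b(2) by metis
    have gi: "g ` ball 0 1 = \<Omega>"
      unfolding b(2)[symmetric] using g(2) by force
    have "(\<rho> \<circ> g) holomorphic_on ball 0 1"
      using holomorphic_on_compose_gen[OF g(1) h(2)] gi by blast
    moreover have "(\<rho> \<circ> g) ` ball 0 1 \<subseteq> ball 0 1"
      unfolding image_comp[symmetric] gi b(3) by (rule order_refl)
    moreover have "\<psi> z \<in> ball 0 1" "\<psi> w \<in> ball 0 1"
      using z w b(2) by auto
    ultimately show ?thesis
      using Schwarz_Pick[of "\<rho> \<circ> g" "\<psi> z" "\<psi> w"] g(2) z w by simp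
  qed
  define \<psi> where "\<psi> = (SOME \<phi>. riemann_map \<Omega> \<phi>)"
  have \<psi>: "riemann_map \<Omega> \<psi>"
    unfolding \<psi>_def by (rule someI[of "riemann_map \<Omega>", OF \<phi>])
  have "hyperbolic_dist \<Omega> z w = poincare_dist (\<psi> z) (\<psi> w)"
    unfolding hyperbolic_dist_def Let_def \<psi>_def by (rule refl)
  also have "\<dots> = poincare_dist (\<phi> z) (\<phi> w)"
    unfolding poincare_dist_def using order_antisym[OF le[OF \<phi> \<psi>] le[OF \<psi> \<phi>]] by simp
  finally show ?thesis .
qed


section \<open>Fixed-point free self-maps\<close>

definition Hol_d :: "complex set \<Rightarrow> (complex \<Rightarrow> complex) set" where
  "Hol_d \<Omega> = {f. f holomorphic_on \<Omega> \<and> f ` \<Omega> \<subseteq> \<Omega> \<and> (\<forall>z\<in>\<Omega>. f z \<noteq> z)}"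

text \<open>The limit exists, and it is the same for all base points in \<open>\<Omega>\<close>.\<close>

definition divergence_rate :: "complex set \<Rightarrow> (complex \<Rightarrow> complex) \<Rightarrow> real" where
  "divergence_rate \<Omega> f =
     (THE c. \<forall>z0\<in>\<Omega>. (\<lambda>n. hyperbolic_dist \<Omega> ((f ^^ n) z0) z0 / real n) \<longlonglongrightarrow> c)"

definition hyperbolic :: "complex set \<Rightarrow> (complex \<Rightarrow> complex) \<Rightarrow> bool" where
  "hyperbolic \<Omega> f \<longleftrightarrow> f \<in> Hol_d \<Omega> \<and> divergence_rate \<Omega> f > 0"

definition has_Denjoy_Wolff_point :: "complex set \<Rightarrow> (complex \<Rightarrow> complex) \<Rightarrow> bool" where
  "has_Denjoy_Wolff_point \<Omega> f \<longleftrightarrow>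
     (\<exists>\<tau>\<in>boundary_sphere \<Omega>. \<forall>K. compact K \<and> K \<subseteq> \<Omega> \<longrightarrow>
        uniform_limit K (\<lambda>n z. Fin ((f ^^ n) z)) (\<lambda>_. \<tau>) sequentially)"


section \<open>Prime ends\<close>

text \<open>
  A crosscut is an open Jordan arc in \<open>\<Omega>\<close> whose two ends converge, on the Riemann sphere, to
  boundary points of \<open>\<Omega>\<close>. The two end points may coincide, and this is why
  \<^const>\<open>simple_path\<close> is used rather than \<^const>\<open>arc\<close>.
\<close>

definition crosscut :: "complex set \<Rightarrow> complex set \<Rightarrow> bool" where
  "crosscut \<Omega> C \<longleftrightarrow> C \<subseteq> \<Omega> \<and>
     (\<exists>\<gamma> :: real \<Rightarrow> riemann_sphere. simple_path \<gamma> \<and> Fin ` C = \<gamma> ` {0<..<1} \<and>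
        pathstart \<gamma> \<in> boundary_sphere \<Omega> \<and> pathfinish \<gamma> \<in> boundary_sphere \<Omega>)"

definition separates :: "complex set \<Rightarrow> complex set \<Rightarrow> complex set \<Rightarrow> complex set \<Rightarrow> bool" where
  "separates \<Omega> C A B \<longleftrightarrow>
     (\<exists>U\<in>components (\<Omega> - C). \<exists>V\<in>components (\<Omega> - C). U \<noteq> V \<and> A \<subseteq> U \<and> B \<subseteq> V)"

definition null_chain :: "complex set \<Rightarrow> (nat \<Rightarrow> complex set) \<Rightarrow> bool" where
  "null_chain \<Omega> C \<longleftrightarrow>
     (\<forall>n. crosscut \<Omega> (C n)) \<and>
     (\<forall>n. closure (Fin ` C n) \<inter> closure (Fin ` C (Suc n)) = {}) \<and>
     (\<forall>n\<ge>1. separates \<Omega> (C n) (C 0) (C (Suc n))) \<and>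
     (\<lambda>n. diameter (Fin ` C n)) \<longlonglongrightarrow> 0"

text \<open>
  A crosscut cuts \<open>\<Omega>\<close> into exactly two components; the interior part of \<open>C n\<close>, for \<open>n \<ge> 1\<close>,
  is the one that does not contain \<open>C 0\<close>.
\<close>

definition interior_part :: "complex set \<Rightarrow> (nat \<Rightarrow> complex set) \<Rightarrow> nat \<Rightarrow> complex set" where
  "interior_part \<Omega> C n = (THE V. V \<in> components (\<Omega> - C n) \<and> \<not> C 0 \<subseteq> V)"

definition null_chain_equiv ::
    "complex set \<Rightarrow> ((nat \<Rightarrow> complex set) \<times> (nat \<Rightarrow> complex set)) set" where
  "null_chain_equiv \<Omega> = {(C, D). null_chain \<Omega> C \<and> null_chain \<Omega> D \<and>
     (\<forall>n\<ge>1. \<exists>m\<ge>1. interior_part \<Omega> D m \<subseteq> interior_part \<Omega> C n) \<and>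
     (\<forall>n\<ge>1. \<exists>m\<ge>1. interior_part \<Omega> C m \<subseteq> interior_part \<Omega> D n)}"

lemma equiv_null_chain_equiv: "equiv {C. null_chain \<Omega> C} (null_chain_equiv \<Omega>)"
proof (rule equivI)
  show "null_chain_equiv \<Omega> \<subseteq> {C. null_chain \<Omega> C} \<times> {C. null_chain \<Omega> C}"
    by (auto simp: null_chain_equiv_def)
  show "refl_on {C. null_chain \<Omega> C} (null_chain_equiv \<Omega>)"
    by (auto simp: refl_on_def null_chain_equiv_def)
  show "sym (null_chain_equiv \<Omega>)"
    by (auto simp: sym_def null_chain_equiv_def)
  show "trans (null_chain_equiv \<Omega>)"
    unfolding trans_def null_chain_equiv_def by simp (meson order_trans)
qed

definition prime_ends :: "complex set \<Rightarrow> (nat \<Rightarrow> complex set) set set" where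
  "prime_ends \<Omega> = {C. null_chain \<Omega> C} // null_chain_equiv \<Omega>"

definition principal_part :: "(nat \<Rightarrow> complex set) set \<Rightarrow> riemann_sphere set" where
  "principal_part \<xi> =
     {p. \<exists>C\<in>\<xi>. \<exists>z :: nat \<Rightarrow> complex. (\<forall>n. z n \<in> C n) \<and> (\<lambda>n. Fin (z n)) \<longlonglongrightarrow> p}"

end

theory Submission
  imports Defs
begin

text \<open>
  Transport \<open>f\<close> to a self-map \<open>F\<close> of the right half-plane so that the point at infinity is the boundary
  point given by Wolff's lemma; then \<open>Re (F w) \<ge> Re w\<close>. If no \<open>\<mu> > 1\<close> satisfies \<open>Re (F w) \<ge> \<mu> * Re w\<close>,
  orbits grow subexponentially and the divergence rate vanishes. Otherwise orbits tend to infinity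
  geometrically and, as their hyperbolic steps are bounded, stay in a Stolz angle. So it suffices
  that the Riemann map \<open>G\<close>, now on the strip \<open>\<bar>Im z\<bar> < \<pi>/2\<close>, has an angular limit on the sphere at
  the end \<open>Re z \<rightarrow> \<infinity>\<close>.

  A length-area argument yields in every interval \<open>(a, a + 1)\<close> with \<open>a\<close> large some \<open>t\<close> such that the image
  of the segment \<open>Re z = t\<close> is a short crosscut. Sequences of such crosscuts are null-chains of one
  and the same prime end. In a Stolz angle \<open>G\<close> varies little between \<open>Re z = t\<close> and nearby points, so
  every angular cluster value lies in the principal part of that prime end, which is a point.
\<close>

section \<open>Area and length\<close>

text \<open>\<Omega> may be unbounded and of infinite area, so Euclidean length-area estimates
  cannot be made for \<open>G\<close> itself. A point \<open>c\<close> outside \<Omega> gives a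
  square root of \<open>G - c\<close> whose image omits a disc. Inversion in that disc factors
  \<open>G\<close> through a bounded univalent \<open>h\<close>, followed by a continuous map
  \<open>R\<close> into the sphere with finite fibres. Areas, lengths and derivatives are estimated
  for \<open>h\<close> only; uniform continuity of \<open>R\<close> carries smallness over to the
  chordal metric.

  A second obstacle is that consecutive crosscuts of a null-chain must have disjoint closures, while
  the images of different segments might end at the same point. Since a point has capacity zero,
  some function of finite energy blows up there; on almost every segment this function stays
  bounded, so the image of that segment does not end at the point.

  The strip is convenient because its vertical segments all have length \<open>pi\<close>, because
  Stolz angles become narrower substrips, and because geometric escape of orbits becomes a linear
  drift of the real part.\<close>

definition vec2_complex :: "real^2 \<Rightarrow> complex" where
  "vec2_complex v = Complex (v $ 1) (v $ 2)"

definition complex_vec2 :: "complex \<Rightarrow> real^2" where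
  "complex_vec2 z = vector [Re z, Im z]"

lemma vec2_complex_inverse [simp]:
  "complex_vec2 (vec2_complex v) = v" "vec2_complex (complex_vec2 z) = z"
  by (simp_all add: vec2_complex_def complex_vec2_def vec_eq_iff forall_2)

lemma bounded_linear_vec2_complex: "bounded_linear vec2_complex"
  by (rule linear_linear[THEN iffD2], rule linearI)
     (auto simp: vec2_complex_def complex_eq_iff)

lemma bounded_linear_complex_vec2: "bounded_linear complex_vec2"
  by (rule linear_linear[THEN iffD2], rule linearI)
     (auto simp: complex_vec2_def vec_eq_iff forall_2)

lemma measurable_vec2_complex [measurable]: "vec2_complex \<in> borel_measurable borel"
  by (intro borel_measurable_continuous_onI linear_continuous_on bounded_linear_vec2_complex)

text \<open>The change of variables theorem in determinant form is applied on \<open>real^2\<close>;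
  this identity carries the resulting integrals over to \<open>complex\<close>.\<close>

lemma lborel_distr_vec2_complex: "distr lborel borel vec2_complex = lborel"
proof (rule lborel_eqI[symmetric])
  fix l u :: complex
  assume le: "\<And>b. b \<in> Basis \<Longrightarrow> l \<bullet> b \<le> u \<bullet> b"
  have le': "Re l \<le> Re u" "Im l \<le> Im u"
    using le[of 1] le[of \<i>] by (auto simp: Basis_complex_def)
  have "vec2_complex -` box l u = box (complex_vec2 l) (complex_vec2 u)"
    by (auto simp: vec2_complex_def complex_vec2_def box_def Basis_complex_def mem_box_cart forall_2
        Basis_vec_def inner_axis)
  moreover have "emeasure lborel (box (complex_vec2 l) (complex_vec2 u)) = (\<Prod>b\<in>Basis. (u - l) \<bullet> b)"
  proof -
    have "complex_vec2 l \<bullet> b \<le> complex_vec2 u \<bullet> b" if "b \<in> Basis" for b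
      using that le' by (auto simp: Basis_vec_def inner_axis complex_vec2_def UNIV_2)
    moreover have "(\<Prod>b\<in>Basis. (complex_vec2 u - complex_vec2 l) \<bullet> b) = (\<Prod>b\<in>Basis. (u - l) \<bullet> b)"
    proof -
      have B: "(Basis :: (real^2) set) = {axis 1 1, axis 2 1}"
        by (auto simp: Basis_vec_def UNIV_2)
      have ne: "axis 1 1 \<noteq> (axis 2 1 :: real^2)"
        by (auto simp: axis_eq_axis)
      have "(\<Prod>b\<in>Basis. (complex_vec2 u - complex_vec2 l) \<bullet> b)
          = (complex_vec2 u - complex_vec2 l) \<bullet> axis 1 1 * ((complex_vec2 u - complex_vec2 l) \<bullet> axis 2 1)"
        unfolding B using ne by (subst prod.insert) auto
      then show ?thesis
        by (simp add: Basis_complex_def inner_diff_left inner_axis complex_vec2_def vector_2)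
    qed
    ultimately show ?thesis
      by (simp add: emeasure_lborel_box)
  qed
  ultimately show "emeasure (distr lborel borel vec2_complex) (box l u) = (\<Prod>b\<in>Basis. (u - l) \<bullet> b)"
    by (simp add: emeasure_distr)
qed simp

text \<open>With \<open>c = deriv h z\<close> this is the real Jacobian of a holomorphic map; being
  nonnegative, it absorbs the absolute value in the area formula.\<close>

lemma det_matrix_complex_mult:
  "det (matrix (\<lambda>v. complex_vec2 (c * vec2_complex v))) = (cmod c)\<^sup>2"
  unfolding cmod_power2
  by (simp add: det_2 matrix_def complex_vec2_def vec2_complex_def axis_def power2_eq_square
      vector_2)

lemma borel_measurable_indicator_open_times:
  fixes g :: "'a::euclidean_space \<Rightarrow> real"
  assumes "open U" "continuous_on U g"
  shows "(\<lambda>x. indicator U x * g x) \<in> borel_measurable borel"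
  using borel_measurable_continuous_on_indicator[of U g] assms by (simp add: borel_open)

text \<open>Injectivity makes the area formula count every image point once. The set
  \<open>A\<close> is left free: \<open>UNIV\<close> gives the area of a whole image, and annuli
  around an omitted value serve the energy estimate for the double logarithm.\<close>

lemma nn_integral_norm_deriv_squared:
  assumes U: "open U" and h: "h holomorphic_on U" "inj_on h U" and A: "A \<in> sets borel"
    and fin: "emeasure lborel (h ` U \<inter> A) < \<infinity>"
  shows "(\<integral>\<^sup>+z. ennreal (indicator {z\<in>U. h z \<in> A} z * (cmod (deriv h z))\<^sup>2) \<partial>lborel)
           = emeasure lborel (h ` U \<inter> A)"
proof -
  define E where "E = {z\<in>U. h z \<in> A}"
  define S where "S = vec2_complex -` E"
  define f where "f = complex_vec2 \<circ> h \<circ> vec2_complex"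
  define f' where "f' = (\<lambda>x v. complex_vec2 (deriv h (vec2_complex x) * vec2_complex v))"
  have conth: "continuous_on U h"
    by (rule holomorphic_on_imp_continuous_on[OF h(1)])
  have conth': "continuous_on U (deriv h)"
    by (rule holomorphic_on_imp_continuous_on[OF holomorphic_deriv[OF h(1) U]])
  have oi: "open (h ` U)"
    using h U by (intro open_mapping_thm3)
  have E: "E \<in> sets borel"
  proof -
    have "h -` A \<inter> space (restrict_space borel U) \<in> sets (restrict_space borel U)"
      by (rule measurable_sets[OF borel_measurable_continuous_on_restrict[OF conth] A])
    moreover have "h -` A \<inter> space (restrict_space borel U) = E"
      by (auto simp: E_def space_restrict_space)
    ultimately show ?thesis
      using U by (simp add: sets_restrict_space_iff borel_open)
  qed
  have hE: "h ` E = h ` U \<inter> A"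
    by (auto simp: E_def)
  have hEb: "h ` U \<inter> A \<in> sets borel"
    using oi A by (simp add: borel_open sets.Int)
  have Sb: "S \<in> sets borel"
    using measurable_sets[OF measurable_vec2_complex E] by (simp add: S_def)
  have fS: "f ` S = vec2_complex -` (h ` U \<inter> A)"
  proof -
    have "f ` S = complex_vec2 ` (h ` E)"
    proof -
      have "vec2_complex ` S = E"
        by (metis S_def UNIV_I surj_def surj_image_vimage_eq vec2_complex_inverse(2))
      then show ?thesis
        unfolding f_def image_comp[symmetric] by simp
    qed
    also have "\<dots> = vec2_complex -` (h ` U \<inter> A)"
      unfolding hE by (force intro: image_eqI[where x="vec2_complex _"])
    finally show ?thesis .
  qed
  have fSb: "f ` S \<in> sets borel"
    unfolding fS using measurable_sets[OF measurable_vec2_complex hEb] by simp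
  have em: "emeasure lborel (f ` S) = emeasure lborel (h ` U \<inter> A)"
    unfolding fS using emeasure_distr[OF _ hEb, of vec2_complex lborel]
    by (simp add: lborel_distr_vec2_complex)
  have lm: "f ` S \<in> lmeasurable"
    using fSb em fin by (intro fmeasurableI) (auto simp: emeasure_completion)
  have der: "(f has_derivative f' x) (at x within S)" if "x \<in> S" for x
  proof -
    have "vec2_complex x \<in> U"
      using that by (auto simp: S_def E_def)
    then have "(h has_derivative (*) (deriv h (vec2_complex x))) (at (vec2_complex x))"
      using holomorphic_derivI[OF h(1) U] by (auto simp: has_field_derivative_def)
    then have "((\<lambda>x. h (vec2_complex x)) has_derivative
        (\<lambda>v. deriv h (vec2_complex x) * vec2_complex v)) (at x within S)"
      using bounded_linear.has_derivative[OF bounded_linear_vec2_complex has_derivative_ident]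
      by (rule has_derivative_compose[rotated])
    then have "((\<lambda>x. complex_vec2 (h (vec2_complex x))) has_derivative f' x) (at x within S)"
      unfolding f'_def by (rule bounded_linear.has_derivative[OF bounded_linear_complex_vec2])
    then show ?thesis
      by (simp add: f_def o_def)
  qed
  have inj: "inj_on f S"
  proof (rule inj_onI)
    fix x y assume "x \<in> S" "y \<in> S" "f x = f y"
    then have "h (vec2_complex x) = h (vec2_complex y)" "vec2_complex x \<in> U" "vec2_complex y \<in> U"
      by (auto simp: f_def S_def E_def dest: arg_cong[where f = vec2_complex])
    then show "x = y"
      by (metis h(2) inj_onD vec2_complex_inverse(1))
  qed
  define J where "J = (\<lambda>z. indicator E z * (cmod (deriv h z))\<^sup>2)"
  have Jm: "J \<in> borel_measurable borel"
  proof -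
    have "(\<lambda>z. indicator U z * (cmod (deriv h z))\<^sup>2) \<in> borel_measurable borel"
      by (intro borel_measurable_indicator_open_times U continuous_intros conth')
    then have "(\<lambda>z. indicator E z * (indicator U z * (cmod (deriv h z))\<^sup>2)) \<in> borel_measurable borel"
      using E by measurable
    also have "(\<lambda>z. indicator E z * (indicator U z * (cmod (deriv h z))\<^sup>2)) = J"
      by (auto simp: J_def E_def fun_eq_iff indicator_def)
    finally show ?thesis .
  qed
  have "((\<lambda>x. \<bar>det (matrix (f' x))\<bar>) has_integral measure lebesgue (f ` S)) S"
    by (rule has_measure_differentiable_image[THEN iffD1]) (use Sb der inj lm in auto)
  then have "((\<lambda>x. (cmod (deriv h (vec2_complex x)))\<^sup>2) has_integral measure lebesgue (f ` S)) S"
    unfolding f'_def det_matrix_complex_mult by simp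
  then have "((\<lambda>x. if x \<in> S then (cmod (deriv h (vec2_complex x)))\<^sup>2 else 0)
      has_integral measure lebesgue (f ` S)) UNIV"
    by (simp add: has_integral_restrict_UNIV)
  also have "(\<lambda>x. if x \<in> S then (cmod (deriv h (vec2_complex x)))\<^sup>2 else 0) = J \<circ> vec2_complex"
    by (auto simp: J_def S_def fun_eq_iff)
  finally have "(\<integral>\<^sup>+x. ennreal ((J \<circ> vec2_complex) x) \<partial>lborel) = measure lebesgue (f ` S)"
    using Jm by (intro nn_integral_has_integral_lborel) (auto simp: J_def o_def)
  also have "\<dots> = emeasure lborel (h ` U \<inter> A)"
    using em lm fin fSb by (simp add: measure_def ennreal_enn2real emeasure_completion)
  also have "(\<integral>\<^sup>+x. ennreal ((J \<circ> vec2_complex) x) \<partial>lborel)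
      = (\<integral>\<^sup>+z. ennreal (J z) \<partial>distr lborel borel vec2_complex)"
    using Jm by (subst nn_integral_distr) (auto simp: o_def)
  finally show ?thesis
    unfolding lborel_distr_vec2_complex J_def E_def .
qed

section \<open>Fubini on the plane; energies over the strip and over its vertical segments\<close>

lemma measurable_Complex_pair: "(\<lambda>(x, y). Complex x y) \<in> borel_measurable borel"
  unfolding case_prod_beta Complex_eq
  by (intro borel_measurable_continuous_onI continuous_intros)

lemma lborel_distr_Complex: "distr lborel borel (\<lambda>(x, y). Complex x y) = lborel"
proof (rule lborel_eqI[symmetric])
  fix l u :: complex
  assume le: "\<And>b. b \<in> Basis \<Longrightarrow> l \<bullet> b \<le> u \<bullet> b"
  have le': "Re l \<le> Re u" "Im l \<le> Im u"
    using le[of 1] le[of \<i>] by (auto simp: Basis_complex_def)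
  have "(\<lambda>(x, y). Complex x y) -` box l u = {Re l<..<Re u} \<times> {Im l<..<Im u}"
    by (auto simp: box_def Basis_complex_def)
  then have "emeasure (distr lborel borel (\<lambda>(x, y). Complex x y)) (box l u)
      = emeasure (lborel \<Otimes>\<^sub>M lborel) ({Re l<..<Re u} \<times> {Im l<..<Im u})"
    using measurable_Complex_pair by (simp add: emeasure_distr lborel_prod)
  also have "\<dots> = (\<Prod>b\<in>Basis. (u - l) \<bullet> b)"
    using le' by (simp add: Basis_complex_def lborel.emeasure_pair_measure_Times ennreal_mult')
  finally show "emeasure (distr lborel borel (\<lambda>(x, y). Complex x y)) (box l u)
      = (\<Prod>b\<in>Basis. (u - l) \<bullet> b)" .
qed simp

lemma nn_integral_lborel_complex:
  fixes f :: "complex \<Rightarrow> ennreal"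
  assumes f: "f \<in> borel_measurable borel"
  shows "(\<integral>\<^sup>+z. f z \<partial>lborel) = (\<integral>\<^sup>+x. \<integral>\<^sup>+y. f (Complex x y) \<partial>lborel \<partial>lborel)"
    and "(\<lambda>x. \<integral>\<^sup>+y. f (Complex x y) \<partial>lborel) \<in> borel_measurable borel"
proof -
  have m: "(\<lambda>p. f (Complex (fst p) (snd p))) \<in> borel_measurable (lborel \<Otimes>\<^sub>M lborel)"
    using measurable_compose[OF measurable_Complex_pair f]
    by (simp add: case_prod_beta lborel_prod)
  have "(\<integral>\<^sup>+z. f z \<partial>lborel) = (\<integral>\<^sup>+p. f (Complex (fst p) (snd p)) \<partial>(lborel \<Otimes>\<^sub>M lborel))"
    using f measurable_Complex_pair unfolding lborel_prod
    by (subst lborel_distr_Complex[symmetric], subst nn_integral_distr)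
       (simp_all add: case_prod_beta)
  also have "\<dots> = (\<integral>\<^sup>+x. \<integral>\<^sup>+y. f (Complex x y) \<partial>lborel \<partial>lborel)"
    using lborel.nn_integral_fst[OF m] by simp
  finally show "(\<integral>\<^sup>+z. f z \<partial>lborel) = (\<integral>\<^sup>+x. \<integral>\<^sup>+y. f (Complex x y) \<partial>lborel \<partial>lborel)" .
  show "(\<lambda>x. \<integral>\<^sup>+y. f (Complex x y) \<partial>lborel) \<in> borel_measurable borel"
    using lborel.borel_measurable_nn_integral_fst[OF m] by simp
qed

definition strip :: "complex set" where
  "strip = {z. \<bar>Im z\<bar> < pi / 2}"

lemma open_strip: "open strip"
  unfolding strip_def by (intro open_Collect_less continuous_intros)

lemma convex_strip: "convex strip"
proof -
  have "strip = {z. Im z < pi/2} \<inter> {z. Im z > - (pi/2)}"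
    by (auto simp: strip_def)
  moreover have "convex ({z. Im z < pi/2} \<inter> {z. Im z > - (pi/2)})"
    by (intro convex_Int convex_halfspace_Im_lt convex_halfspace_Im_gt)
  ultimately show ?thesis
    by simp
qed

lemma Complex_in_strip [simp]: "Complex t y \<in> strip \<longleftrightarrow> -(pi/2) < y \<and> y < pi/2"
  by (auto simp: strip_def)

text \<open>Dirichlet integral over a part of the strip, with values in \<open>ennreal\<close> since
  it may be infinite.\<close>

definition strip_energy :: "(complex \<Rightarrow> complex) \<Rightarrow> complex set \<Rightarrow> ennreal" where
  "strip_energy H A = (\<integral>\<^sup>+z. ennreal (indicator (strip \<inter> A) z * (cmod (deriv H z))\<^sup>2) \<partial>lborel)"

definition line_energy :: "(complex \<Rightarrow> complex) \<Rightarrow> real \<Rightarrow> ennreal" where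
  "line_energy H t =
     (\<integral>\<^sup>+y. ennreal (indicator {-(pi/2)<..<pi/2} y * (cmod (deriv H (Complex t y)))\<^sup>2) \<partial>lborel)"

lemma strip_energy_mono: "A \<subseteq> B \<Longrightarrow> strip_energy H A \<le> strip_energy H B"
  unfolding strip_energy_def
  by (intro nn_integral_mono ennreal_leI mult_right_mono) (auto simp: indicator_def)

lemma
  assumes H: "H holomorphic_on strip"
  shows strip_energy_eq_line_energy:
      "strip_energy H {z. a < Re z \<and> Re z < b}
         = (\<integral>\<^sup>+t. indicator {a<..<b} t * line_energy H t \<partial>lborel)" (is ?A)
    and measurable_line_energy: "line_energy H \<in> borel_measurable borel" (is ?B)
proof -
  have c: "continuous_on (strip \<inter> X) (\<lambda>z. (cmod (deriv H z))\<^sup>2)" for X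
    by (intro continuous_intros holomorphic_on_imp_continuous_on
        holomorphic_on_subset[OF holomorphic_deriv[OF H open_strip]]) auto
  have m: "(\<lambda>z. ennreal (indicator (strip \<inter> X) z * (cmod (deriv H z))\<^sup>2)) \<in> borel_measurable borel"
    if "open X" for X
    using borel_measurable_indicator_open_times[OF _ c] open_strip that by auto
  have "open {z. a < Re z \<and> Re z < b}"
    by (intro open_Collect_conj open_Collect_less continuous_intros)
  then have "strip_energy H {z. a < Re z \<and> Re z < b} = (\<integral>\<^sup>+t. \<integral>\<^sup>+y. ennreal (indicator
      (strip \<inter> {z. a < Re z \<and> Re z < b}) (Complex t y) * (cmod (deriv H (Complex t y)))\<^sup>2) \<partial>lborel \<partial>lborel)"
    unfolding strip_energy_def by (rule nn_integral_lborel_complex(1)[OF m])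
  also have "\<dots> = (\<integral>\<^sup>+t. indicator {a<..<b} t * line_energy H t \<partial>lborel)"
    unfolding line_energy_def
    by (intro nn_integral_cong) (auto simp: indicator_def intro!: nn_integral_cong)
  finally show ?A .
  have "line_energy H = (\<lambda>t. \<integral>\<^sup>+y. ennreal (indicator (strip \<inter> UNIV) (Complex t y)
      * (cmod (deriv H (Complex t y)))\<^sup>2) \<partial>lborel)"
    unfolding line_energy_def
    by (intro ext nn_integral_cong) (auto simp: indicator_def)
  then show ?B
    using nn_integral_lborel_complex(2)[OF m[OF open_UNIV]] by simp
qed

text \<open>Averaging over an interval of length 1: if almost every line had energy above
  \<open>2 * \<alpha>\<close>, the total would exceed \<open>\<alpha>\<close>. The finite family
  \<open>F\<close> excludes only a null set of \<open>t\<close>, because a finite total energy is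
  finite on almost every line. Later this is what keeps end points apart.\<close>

lemma exists_good_line:
  assumes h: "h holomorphic_on strip"
    and \<alpha>: "0 < \<alpha>" "strip_energy h {z. a < Re z \<and> Re z < a + 1} \<le> ennreal \<alpha>"
    and F: "finite F" "\<And>H. H \<in> F \<Longrightarrow> H holomorphic_on strip"
      "\<And>H. H \<in> F \<Longrightarrow> strip_energy H UNIV < \<infinity>"
  obtains t where "a < t" "t < a + 1" "line_energy h t \<le> ennreal (2 * \<alpha>)"
    "\<And>H. H \<in> F \<Longrightarrow> line_energy H t < \<infinity>"
proof -
  have AEfin: "AE t in lborel. \<forall>H\<in>F. t \<in> {a<..<a+1} \<longrightarrow> line_energy H t \<noteq> \<infinity>"
  proof (rule AE_finite_allI[OF F(1)])
    fix H assume H: "H \<in> F"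
    have "(\<integral>\<^sup>+t. indicator {a<..<a+1} t * line_energy H t \<partial>lborel) \<noteq> \<infinity>"
      using strip_energy_mono[of "{z. a < Re z \<and> Re z < a + 1}" UNIV H] F(3)[OF H]
      by (auto simp: strip_energy_eq_line_energy[OF F(2)[OF H], symmetric] less_top top_unique)
    then have "AE t in lborel. indicator {a<..<a+1} t * line_energy H t \<noteq> \<infinity>"
      using measurable_line_energy[OF F(2)[OF H]]
      by (intro nn_integral_PInf_AE) auto
    then show "AE t in lborel. t \<in> {a<..<a+1} \<longrightarrow> line_energy H t \<noteq> \<infinity>"
      by eventually_elim (auto simp: indicator_def)
  qed
  have "\<exists>t\<in>{a<..<a+1}. line_energy h t \<le> ennreal (2 * \<alpha>) \<and> (\<forall>H\<in>F. line_energy H t \<noteq> \<infinity>)"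
  proof (rule ccontr)
    assume "\<not> ?thesis"
    then have n: "ennreal (2 * \<alpha>) \<le> line_energy h t"
      if "t \<in> {a<..<a+1}" "\<forall>H\<in>F. t \<in> {a<..<a+1} \<longrightarrow> line_energy H t \<noteq> \<infinity>" for t
      using that by (meson linear)
    have "AE t in lborel. indicator {a<..<a+1} t * ennreal (2 * \<alpha>)
        \<le> indicator {a<..<a+1} t * line_energy h t"
      using AEfin by eventually_elim (use n in \<open>auto simp: indicator_def\<close>)
    then have "(\<integral>\<^sup>+t. indicator {a<..<a+1} t * ennreal (2 * \<alpha>) \<partial>lborel)
        \<le> (\<integral>\<^sup>+t. indicator {a<..<a+1} t * line_energy h t \<partial>lborel)"
      by (rule nn_integral_mono_AE)
    also have "\<dots> \<le> ennreal \<alpha>"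
      using \<alpha>(2) strip_energy_eq_line_energy[OF h] by simp
    finally have "ennreal (2 * \<alpha>) \<le> ennreal \<alpha>"
      by (simp add: nn_integral_multc)
    with \<alpha>(1) show False
      by simp
  qed
  then show ?thesis
    using that by (auto simp: less_top)
qed

lemma has_vector_derivative_vertical:
  assumes "H holomorphic_on strip" "-(pi/2) < y" "y < pi/2"
  shows "((\<lambda>y. H (Complex t y)) has_vector_derivative \<i> * deriv H (Complex t y)) (at y within X)"
proof -
  have "(H has_field_derivative deriv H (Complex t y)) (at (Complex t y))"
    using holomorphic_derivI[OF assms(1) open_strip] assms(2,3) by simp
  moreover have "((\<lambda>y. Complex t y) has_vector_derivative \<i>) (at y within X)"
    unfolding Complex_eq by (auto intro!: derivative_eq_intros)
  ultimately show ?thesis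
    using field_vector_diff_chain_within[of "Complex t" \<i> y X H]
    by (auto simp: o_def intro: has_field_derivative_at_within)
qed

text \<open>The increment is the integral of the derivative along the segment, and Cauchy-Schwarz
  bounds its square by energy times length.\<close>

lemma line_energy_Hoelder:
  assumes H: "H holomorphic_on strip" and E: "0 \<le> E" "line_energy H t \<le> ennreal E"
    and y: "-(pi/2) < y1" "y1 \<le> y2" "y2 < pi/2"
  shows "(cmod (H (Complex t y2) - H (Complex t y1)))\<^sup>2 \<le> E * (y2 - y1)"
proof (cases "y1 = y2")
  case False
  define L where "L = y2 - y1"
  have L: "L > 0" using False y by (simp add: L_def)
  define d where "d = (\<lambda>y. cmod (deriv H (Complex t y)))"
  have cd: "continuous_on {y1..y2} (\<lambda>y. deriv H (Complex t y))"
    unfolding Complex_eq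
    by (rule continuous_on_compose2[OF holomorphic_on_imp_continuous_on[OF holomorphic_deriv[OF H open_strip]]])
       (use y in \<open>auto intro!: continuous_intros simp: strip_def\<close>)
  then have cd: "continuous_on {y1..y2} d" "continuous_on {y1..y2} (\<lambda>y. (d y)\<^sup>2)"
    unfolding d_def by (auto intro!: continuous_intros)
  have int: "d integrable_on {y1..y2}" "(\<lambda>y. (d y)\<^sup>2) integrable_on {y1..y2}"
    using cd by (auto intro: integrable_continuous_interval)
  define I where "I = integral {y1..y2} d"
  define J where "J = integral {y1..y2} (\<lambda>y. (d y)\<^sup>2)"
  have "((\<lambda>y. \<i> * deriv H (Complex t y)) has_integral H (Complex t y2) - H (Complex t y1)) {y1..y2}"
    using y by (intro fundamental_theorem_of_calculus has_vector_derivative_vertical H) auto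
  then have "(\<lambda>y. \<i> * deriv H (Complex t y)) integrable_on {y1..y2}"
    and e: "H (Complex t y2) - H (Complex t y1) = integral {y1..y2} (\<lambda>y. \<i> * deriv H (Complex t y))"
    by (auto simp: has_integral_iff)
  then have "cmod (H (Complex t y2) - H (Complex t y1)) \<le> I"
    unfolding e I_def by (intro integral_norm_bound_integral int(1)) (auto simp: d_def norm_mult)
  moreover have "I\<^sup>2 \<le> J * L"
  proof -
    \<comment> \<open>Cauchy-Schwarz as nonnegativity of the variance of \<open>d\<close>;
      \<open>I / L\<close> is the mean of \<open>d\<close>.\<close>
    have "0 \<le> integral {y1..y2} (\<lambda>y. (d y - I / L)\<^sup>2)"
      by (rule integral_nonneg) (auto intro!: integrable_continuous_interval continuous_intros cd)
    also have "(\<lambda>y. (d y - I / L)\<^sup>2) = (\<lambda>y. (d y)\<^sup>2 - (2 * I / L) * d y + (I / L)\<^sup>2)"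
      by (auto simp: power2_diff algebra_simps)
    also have "integral {y1..y2} \<dots> = J - (2 * I / L) * I + L * (I / L)\<^sup>2"
    proof (rule integral_unique, intro has_integral_add has_integral_diff has_integral_mult_right)
      show "((\<lambda>y. (d y)\<^sup>2) has_integral J) {y1..y2}" "(d has_integral I) {y1..y2}"
        unfolding I_def J_def using int by (auto intro: integrable_integral)
      show "((\<lambda>y. (I / L)\<^sup>2) has_integral L * (I / L)\<^sup>2) {y1..y2}"
        using has_integral_const_real[of "(I / L)\<^sup>2" y1 y2] y by (simp add: L_def)
    qed
    also have "\<dots> = J - I\<^sup>2 / L"
      using L by (simp add: field_simps power2_eq_square)
    finally show ?thesis
      using L by (simp add: field_simps)
  qed
  moreover have "J \<le> E"
  proof -
    have "((\<lambda>y. if y \<in> {y1..y2} then (d y)\<^sup>2 else 0) has_integral J) UNIV"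
      unfolding J_def has_integral_restrict_UNIV using int(2) by (rule integrable_integral)
    moreover have "(\<lambda>y. if y \<in> {y1..y2} then (d y)\<^sup>2 else 0) \<in> borel_measurable borel"
    proof -
      have "(\<lambda>y. indicator {y1..y2} y *\<^sub>R (d y)\<^sup>2) \<in> borel_measurable borel"
        by (rule borel_measurable_continuous_on_indicator[OF _ cd(2)]) simp
      also have "(\<lambda>y. indicator {y1..y2} y *\<^sub>R (d y)\<^sup>2) = (\<lambda>y. if y \<in> {y1..y2} then (d y)\<^sup>2 else 0)"
        by (simp add: fun_eq_iff)
      finally show ?thesis .
    qed
    ultimately have "ennreal J = (\<integral>\<^sup>+y. ennreal (if y \<in> {y1..y2} then (d y)\<^sup>2 else 0) \<partial>lborel)"
      by (intro nn_integral_has_integral_lborel[symmetric]) auto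
    also have "\<dots> \<le> line_energy H t"
      unfolding line_energy_def
      by (intro nn_integral_mono ennreal_leI) (use y in \<open>auto simp: indicator_def d_def\<close>)
    finally show ?thesis
      using E by (meson ennreal_le_iff order_trans)
  qed
  moreover have "J * L \<le> E * L" if "J \<le> E"
    using that L by (intro mult_right_mono) auto
  moreover have "(cmod (H (Complex t y2) - H (Complex t y1)))\<^sup>2 \<le> I\<^sup>2"
    if "cmod (H (Complex t y2) - H (Complex t y1)) \<le> I"
    using that by (intro power_mono) auto
  ultimately show ?thesis
    unfolding L_def[symmetric] by linarith
qed simp

lemma line_energy_diameter:
  assumes "H holomorphic_on strip" "0 \<le> E" "line_energy H t \<le> ennreal E"
    and "-(pi/2) < y1" "y1 < pi/2" "-(pi/2) < y2" "y2 < pi/2"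
  shows "cmod (H (Complex t y2) - H (Complex t y1)) \<le> sqrt (E * pi)"
proof -
  have *: "cmod (H (Complex t y2) - H (Complex t y1)) \<le> sqrt (E * pi)"
    if "-(pi/2) < y1" "y1 \<le> y2" "y2 < pi/2" for y1 y2
  proof -
    have "(cmod (H (Complex t y2) - H (Complex t y1)))\<^sup>2 \<le> E * (y2 - y1)"
      using line_energy_Hoelder[OF assms(1-3)] that by blast
    also have "\<dots> \<le> E * pi"
      using that assms(2) by (intro mult_left_mono) auto
    finally show ?thesis
      by (rule real_le_rsqrt)
  qed
  show ?thesis
    using *[of y1 y2] *[of y2 y1] assms by (cases "y1 \<le> y2") (auto simp: norm_minus_commute)
qed

text \<open>Hoelder continuity of exponent 1/2 gives uniform continuity, so the image of the segment
  has two end points.\<close>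

lemma line_energy_extension:
  assumes H: "H holomorphic_on strip" and E: "line_energy H t < \<infinity>"
  obtains g where "continuous_on {-(pi/2)..pi/2} g"
    "\<And>y. -(pi/2) < y \<Longrightarrow> y < pi/2 \<Longrightarrow> g y = H (Complex t y)"
proof -
  obtain e where e: "0 \<le> e" "line_energy H t = ennreal e"
    using E by (cases "line_energy H t") auto
  have uc: "uniformly_continuous_on {-(pi/2)<..<pi/2} (\<lambda>y. H (Complex t y))"
    unfolding uniformly_continuous_on_def
  proof (intro allI impI)
    fix \<epsilon> :: real assume \<epsilon>: "\<epsilon> > 0"
    \<comment> \<open>The \<open>+ 1\<close> keeps the denominator positive when the energy
      \<open>e\<close> is 0.\<close>
    define \<delta> where "\<delta> = \<epsilon>\<^sup>2 / (e + 1)"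
    have \<delta>: "\<delta> > 0" using \<epsilon> e by (simp add: \<delta>_def add_nonneg_pos)
    have *: "dist (H (Complex t y2)) (H (Complex t y1)) < \<epsilon>"
      if "-(pi/2) < y1" "y1 \<le> y2" "y2 < pi/2" "y2 - y1 < \<delta>" for y1 y2
    proof -
      have "(cmod (H (Complex t y2) - H (Complex t y1)))\<^sup>2 \<le> e * (y2 - y1)"
        using line_energy_Hoelder[OF H e(1) eq_refl[OF e(2)] that(1-3)] .
      also have "\<dots> \<le> e * \<delta>"
        using that e by (intro mult_left_mono) auto
      also have "\<dots> < \<epsilon>\<^sup>2"
      proof -
        have "e * \<epsilon>\<^sup>2 < (e + 1) * \<epsilon>\<^sup>2"
          using \<epsilon> by (intro mult_strict_right_mono) auto
        then show ?thesis
          using e by (simp add: \<delta>_def pos_divide_less_eq mult.commute)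
      qed
      finally show ?thesis
        using \<epsilon> by (simp add: dist_norm power2_less_imp_less)
    qed
    show "\<exists>d>0. \<forall>x\<in>{-(pi/2)<..<pi/2}. \<forall>x'\<in>{-(pi/2)<..<pi/2}. dist x' x < d \<longrightarrow>
        dist (H (Complex t x')) (H (Complex t x)) < \<epsilon>"
    proof (rule exI[of _ \<delta>], intro conjI ballI impI)
      show "\<delta> > 0" by (rule \<delta>)
      fix x x' assume "x \<in> {-(pi/2)<..<pi/2}" "x' \<in> {-(pi/2)<..<pi/2}" "dist x' x < \<delta>"
      then show "dist (H (Complex t x')) (H (Complex t x)) < \<epsilon>"
        using *[of x x'] *[of x' x] by (cases "x \<le> x'") (simp_all add: dist_real_def dist_commute)
    qed
  qed
  show ?thesis
  proof (rule uniformly_continuous_on_extension_on_closure[OF uc])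
    fix g assume g: "uniformly_continuous_on (closure {-(pi/2)<..<pi/2}) g"
      "\<And>x. x \<in> {-(pi/2)<..<pi/2} \<Longrightarrow> H (Complex t x) = g x"
    show ?thesis
    proof (rule that)
      show "continuous_on {-(pi/2)..pi/2} g"
        using uniformly_continuous_imp_continuous[OF g(1)] by simp
      show "g y = H (Complex t y)" if "-(pi/2) < y" "y < pi/2" for y
        using g(2)[of y] that by simp
    qed
  qed
qed

text \<open>
  A point has capacity zero: composing \<open>h\<close> with a double logarithm gives a function of finite
  energy which blows up wherever \<open>h\<close> tends to \<open>v\<close>.
\<close>

lemma omitted_value_energy:
  assumes h: "h holomorphic_on strip" "inj_on h strip" and bd: "bounded (h ` strip)"
    and v: "v \<notin> h ` strip"
  obtains H where "H holomorphic_on strip" "strip_energy H UNIV < \<infinity>"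
    "\<And>t. line_energy H t < \<infinity> \<Longrightarrow>
       \<exists>\<delta>>0. \<forall>y. -(pi/2) < y \<and> y < pi/2 \<longrightarrow> \<delta> \<le> dist (h (Complex t y)) v"
proof -
  obtain M where M: "M > 0" "\<And>z. z \<in> strip \<Longrightarrow> cmod (h z) \<le> M"
    using bd by (auto simp: bounded_pos)
  \<comment> \<open>The factor \<open>exp 1\<close> makes \<open>cmod (h z - v) / K\<close> at most
    1/e. The logarithm \<open>l\<close> below then satisfies \<open>Re (l z) \<le> -1\<close>, so
    that \<open>- l\<close> avoids the cut of \<open>Ln\<close>.\<close>
  define K where "K = (M + cmod v) * exp 1"
  have K: "K > 0" using M by (simp add: K_def add_pos_nonneg)
  have hv: "h z - v \<noteq> 0" if "z \<in> strip" for z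
    using v that by auto
  have small: "cmod (h z - v) / K \<le> exp (-1)" if "z \<in> strip" for z
  proof -
    have "cmod (h z - v) \<le> M + cmod v"
      using M(2)[OF that] norm_triangle_ineq4[of "h z" v] by linarith
    also have "M + cmod v = exp (-1) * K"
    proof -
      have "exp (-1) * K = (M + cmod v) * (exp (-1) * exp 1)"
        unfolding K_def by (simp only: mult_ac)
      also have "exp (-1) * exp (1::real) = 1"
        unfolding exp_add[symmetric] by simp
      finally show ?thesis by simp
    qed
    finally show ?thesis
      using K by (simp add: pos_divide_le_eq)
  qed
  have nz: "(h z - v) / of_real K \<noteq> 0" if "z \<in> strip" for z
    using hv[OF that] K by simp
  have hol: "(\<lambda>z. (h z - v) / of_real K) holomorphic_on strip"
    by (rule holomorphic_on_divide[OF holomorphic_on_diff[OF h(1) holomorphic_on_const]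
          holomorphic_on_const]) (use K in simp)
  obtain l where l: "l holomorphic_on strip" "\<And>z. z \<in> strip \<Longrightarrow> (h z - v) / of_real K = exp (l z)"
    using simply_connected_imp_holomorphic_log[OF hol convex_imp_simply_connected[OF convex_strip]
        convex_imp_locally_path_connected[OF convex_strip] nz] by blast
  have normv: "cmod (h z - v) = K * exp (Re (l z))" if "z \<in> strip" for z
    using arg_cong[OF l(2)[OF that], of cmod] K by (simp add: norm_divide field_simps)
  have Rel: "Re (l z) \<le> -1" if "z \<in> strip" for z
    using small[OF that] normv[OF that] K by simp
  define H where "H = (\<lambda>z. Ln (- l z))"
  have nn: "- l z \<notin> \<real>\<^sub>\<le>\<^sub>0" if "z \<in> strip" for z
    using Rel[OF that] by (auto simp: complex_nonpos_Reals_iff)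
  have H: "H holomorphic_on strip"
    unfolding H_def using nn by (intro holomorphic_intros l) auto
  \<comment> \<open>Replacing \<open>cmod (l z)\<close> by the smaller \<open>- Re (l z)\<close>
    leaves a factor that depends on \<open>cmod (h z - v)\<close> only.\<close>
  have dH: "cmod (deriv H z) \<le> cmod (deriv h z) / (cmod (h z - v) * - Re (l z))" if z: "z \<in> strip" for z
  proof -
    have dl: "(l has_field_derivative deriv l z) (at z)" and dh: "(h has_field_derivative deriv h z) (at z)"
      using holomorphic_derivI[OF l(1) open_strip z] holomorphic_derivI[OF h(1) open_strip z] by blast+
    have "((\<lambda>z. exp (l z)) has_field_derivative exp (l z) * deriv l z) (at z)"
      by (rule derivative_eq_intros dl refl)+
    moreover have "((\<lambda>z. exp (l z)) has_field_derivative deriv h z / of_real K) (at z)"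
    proof (rule has_field_derivative_transform_within_open[OF _ open_strip z])
      show "((\<lambda>z. (h z - v) / of_real K) has_field_derivative deriv h z / of_real K) (at z)"
        using K by (auto intro!: derivative_eq_intros dh)
    qed (use l in auto)
    ultimately have "exp (l z) * deriv l z = deriv h z / of_real K"
      by (rule DERIV_unique)
    then have e: "deriv l z = deriv h z / (h z - v)"
      using l(2)[OF z, symmetric] K hv[OF z] by (simp add: field_simps)
    have "(H has_field_derivative inverse (- l z) * (- deriv l z)) (at z)"
      unfolding H_def
      by (rule DERIV_chain2[OF has_field_derivative_Ln[OF nn[OF z]] DERIV_minus[OF dl]])
    then have "deriv H z = deriv h z / ((h z - v) * l z)"
      unfolding e by (simp add: DERIV_imp_deriv divide_inverse inverse_mult_distrib)
    then have "cmod (deriv H z) = cmod (deriv h z) / (cmod (h z - v) * cmod (l z))"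
      by (simp add: norm_divide norm_mult)
    also have "\<dots> \<le> cmod (deriv h z) / (cmod (h z - v) * - Re (l z))"
      using hv[OF z] Rel[OF z] abs_Re_le_cmod[of "l z"]
      by (intro divide_left_mono mult_left_mono mult_pos_pos) auto
    finally show ?thesis .
  qed
  \<comment> \<open>\<open>A k\<close> is the annulus on which \<open>- Re (l z)\<close> lies in
    \<open>[k + 1, k + 2)\<close>, and \<open>c k\<close> bounds the squared ratio of
    \<open>deriv H\<close> to \<open>deriv h\<close> there. The product of \<open>c k\<close> with
    the area is of order \<open>1 / (k + 1)^2\<close>, hence summable; a single logarithm would give
    terms of constant order.\<close>
  define A where "A = (\<lambda>k::nat. {w. K * exp (- real k - 2) < cmod (w - v) \<and> cmod (w - v) \<le> K * exp (- real k - 1)})"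
  define c where "c = (\<lambda>k::nat. (exp (real k + 2) / (K * (real k + 1)))\<^sup>2)"
  have Ab: "A k \<in> sets borel" for k
    unfolding A_def by measurable
  have emA: "emeasure lborel (A k) \<le> ennreal ((2 * (K * exp (- real k - 1)))\<^sup>2)" for k
  proof -
    define r where "r = K * exp (- real k - 1)"
    have r: "r > 0" using K by (simp add: r_def)
    have "A k \<subseteq> cbox (v - Complex r r) (v + Complex r r)"
    proof
      fix w assume "w \<in> A k"
      then have "cmod (w - v) \<le> r" by (simp add: A_def r_def)
      then have "\<bar>Re (w - v)\<bar> \<le> r" "\<bar>Im (w - v)\<bar> \<le> r"
        using abs_Re_le_cmod abs_Im_le_cmod order_trans by blast+
      then show "w \<in> cbox (v - Complex r r) (v + Complex r r)"
        by (auto simp: cbox_def Basis_complex_def)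
    qed
    then have "emeasure lborel (A k) \<le> emeasure lborel (cbox (v - Complex r r) (v + Complex r r))"
      by (intro emeasure_mono) auto
    also have "\<dots> = ennreal ((2 * r)\<^sup>2)"
      using r by (subst emeasure_lborel_cbox) (auto simp: Basis_complex_def power2_eq_square)
    finally show ?thesis by (simp add: r_def)
  qed
  have hA: "ennreal (indicator (strip \<inter> UNIV) z * (cmod (deriv H z))\<^sup>2)
      \<le> (\<Sum>k. ennreal (c k) * ennreal (indicator {z\<in>strip. h z \<in> A k} z * (cmod (deriv h z))\<^sup>2))" for z
  proof (cases "z \<in> strip")
    case True
    define k where "k = nat \<lfloor>- Re (l z) - 1\<rfloor>"
    have k: "real k \<le> - Re (l z) - 1" "- Re (l z) - 1 < real k + 1"
      using Rel[OF True] by (auto simp: k_def)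
    have "h z \<in> A k"
      using k K by (auto simp: A_def normv[OF True])
    have "cmod (deriv H z) \<le> cmod (deriv h z) / (cmod (h z - v) * - Re (l z))"
      by (rule dH[OF True])
    also have "\<dots> \<le> cmod (deriv h z) / ((K * exp (- real k - 2)) * (real k + 1))"
      using k K hv[OF True] unfolding normv[OF True]
      by (intro divide_left_mono mult_mono mult_pos_pos) auto
    also have "\<dots> = exp (real k + 2) / (K * (real k + 1)) * cmod (deriv h z)"
    proof -
      have "exp (- real k - 2) = 1 / exp (real k + 2)"
        using exp_minus[of "real k + 2"] by (simp add: divide_inverse)
      then show ?thesis
        using K by simp
    qed
    finally have "(cmod (deriv H z))\<^sup>2 \<le> c k * (cmod (deriv h z))\<^sup>2"
      unfolding c_def power_mult_distrib[symmetric] by (intro power_mono) auto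
    then have "ennreal (indicator (strip \<inter> UNIV) z * (cmod (deriv H z))\<^sup>2)
        \<le> ennreal (c k) * ennreal (indicator {z\<in>strip. h z \<in> A k} z * (cmod (deriv h z))\<^sup>2)"
      using True \<open>h z \<in> A k\<close>
      by (auto simp: c_def ennreal_mult[symmetric] intro!: ennreal_leI)
    also have "\<dots> \<le> (\<Sum>k. ennreal (c k) * ennreal (indicator {z\<in>strip. h z \<in> A k} z * (cmod (deriv h z))\<^sup>2))"
      using sum_le_suminf[of "\<lambda>k. ennreal (c k) * ennreal (indicator {z\<in>strip. h z \<in> A k} z * (cmod (deriv h z))\<^sup>2)" "{k}"]
      by simp
    finally show ?thesis .
  qed simp
  have hpre: "{z\<in>strip. h z \<in> A k} \<in> sets borel" for k
  proof -
    have "h -` A k \<inter> space (restrict_space borel strip) \<in> sets (restrict_space borel strip)"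
      by (rule measurable_sets[OF borel_measurable_continuous_on_restrict[OF
            holomorphic_on_imp_continuous_on[OF h(1)]] Ab])
    moreover have "h -` A k \<inter> space (restrict_space borel strip) = {z\<in>strip. h z \<in> A k}"
      by (auto simp: space_restrict_space)
    ultimately show ?thesis
      using open_strip by (simp add: sets_restrict_space_iff borel_open)
  qed
  have meas: "(\<lambda>z. ennreal (indicator {z\<in>strip. h z \<in> A k} z * (cmod (deriv h z))\<^sup>2)) \<in> borel_measurable borel" for k
  proof -
    have "(\<lambda>z. indicator strip z * (cmod (deriv h z))\<^sup>2) \<in> borel_measurable borel"
      by (intro borel_measurable_indicator_open_times open_strip continuous_intros
          holomorphic_on_imp_continuous_on holomorphic_deriv h)
    then have "(\<lambda>z. indicator {z\<in>strip. h z \<in> A k} z * (indicator strip z * (cmod (deriv h z))\<^sup>2)) \<in> borel_measurable borel"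
      using hpre by measurable
    also have "(\<lambda>z. indicator {z\<in>strip. h z \<in> A k} z * (indicator strip z * (cmod (deriv h z))\<^sup>2))
        = (\<lambda>z. indicator {z\<in>strip. h z \<in> A k} z * (cmod (deriv h z))\<^sup>2)"
      by (auto simp: fun_eq_iff indicator_def)
    finally show ?thesis by simp
  qed
  have "strip_energy H UNIV \<le> (\<integral>\<^sup>+z. (\<Sum>k. ennreal (c k) *
      ennreal (indicator {z\<in>strip. h z \<in> A k} z * (cmod (deriv h z))\<^sup>2)) \<partial>lborel)"
    unfolding strip_energy_def by (intro nn_integral_mono hA)
  also have "\<dots> = (\<Sum>k. ennreal (c k) *
      (\<integral>\<^sup>+z. ennreal (indicator {z\<in>strip. h z \<in> A k} z * (cmod (deriv h z))\<^sup>2) \<partial>lborel))"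
    using meas by (simp add: nn_integral_suminf nn_integral_cmult)
  also have "\<dots> \<le> (\<Sum>k. ennreal (4 * (exp 1)\<^sup>2 * (1 / (real k + 1)\<^sup>2)))"
  proof (intro suminf_le summableI)
    fix k
    have lt: "emeasure lborel (h ` strip \<inter> A k) \<le> ennreal ((2 * (K * exp (- real k - 1)))\<^sup>2)"
      using emeasure_mono[of "h ` strip \<inter> A k" "A k" lborel] Ab emA[of k] by (auto intro: order_trans)
    then have "emeasure lborel (h ` strip \<inter> A k) < \<infinity>"
      using le_less_trans[OF lt ennreal_less_top] by simp
    from nn_integral_norm_deriv_squared[OF open_strip h Ab this] lt
    have "ennreal (c k) *
      (\<integral>\<^sup>+z. ennreal (indicator {z\<in>strip. h z \<in> A k} z * (cmod (deriv h z))\<^sup>2) \<partial>lborel)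
      \<le> ennreal (c k) * ennreal ((2 * (K * exp (- real k - 1)))\<^sup>2)"
      by (simp add: mult_left_mono)
    also have "\<dots> = ennreal (c k * (2 * (K * exp (- real k - 1)))\<^sup>2)"
      by (simp add: ennreal_mult c_def)
    also have "c k * (2 * (K * exp (- real k - 1)))\<^sup>2 =
        (2 * (exp (real k + 2) * exp (- real k - 1)) / (real k + 1))\<^sup>2"
      unfolding c_def power_mult_distrib[symmetric] using K by simp
    also have "exp (real k + 2) * exp (- real k - 1) = exp (1::real)"
      by (simp add: exp_add[symmetric])
    finally show "ennreal (c k) *
      (\<integral>\<^sup>+z. ennreal (indicator {z\<in>strip. h z \<in> A k} z * (cmod (deriv h z))\<^sup>2) \<partial>lborel)
      \<le> ennreal (4 * (exp 1)\<^sup>2 * (1 / (real k + 1)\<^sup>2))"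
      by (simp add: power_divide power_mult_distrib)
  qed
  also have "\<dots> < \<infinity>"
  proof -
    have "summable (\<lambda>k. 4 * (exp 1)\<^sup>2 * (1 / (real k + 1)\<^sup>2))"
      using sums_summable[OF inverse_squares_sums] by (intro summable_mult) (simp add: add.commute)
    then show ?thesis
      by (subst suminf_ennreal2) auto
  qed
  finally have fin: "strip_energy H UNIV < \<infinity>" .
  show ?thesis
  proof (rule that[OF H fin])
    fix t assume "line_energy H t < \<infinity>"
    then obtain E where E: "0 \<le> E" "line_energy H t \<le> ennreal E"
      by (cases "line_energy H t") auto
    \<comment> \<open>A bound \<open>B\<close> for \<open>Re H\<close> on the line bounds
      \<open>cmod l\<close> by \<open>exp B\<close>. Hence \<open>Re l\<close> is at least
      \<open>- exp B\<close>, and \<open>h\<close> keeps the distance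
      \<open>K * exp (- exp B)\<close> from \<open>v\<close>.\<close>
    define B where "B = cmod (H (Complex t 0)) + sqrt (E * pi)"
    show "\<exists>\<delta>>0. \<forall>y. -(pi/2) < y \<and> y < pi/2 \<longrightarrow> \<delta> \<le> dist (h (Complex t y)) v"
    proof (intro exI conjI allI impI)
      show "K * exp (- exp B) > 0" using K by simp
      fix y assume y: "-(pi/2) < y \<and> y < pi/2"
      let ?z = "Complex t y"
      have z: "?z \<in> strip" using y by simp
      have "cmod (H ?z - H (Complex t 0)) \<le> sqrt (E * pi)"
        using line_energy_diameter[OF H E, of 0 y] y by simp
      then have "Re (H ?z) \<le> B"
        using complex_Re_le_cmod[of "H ?z"] norm_triangle_ineq2[of "H ?z" "H (Complex t 0)"]
        by (simp add: B_def)
      moreover have "exp (H ?z) = - l ?z"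
        unfolding H_def using Rel[OF z] by (intro exp_Ln) auto
      ultimately have "cmod (l ?z) \<le> exp B"
        by (metis exp_le_cancel_iff norm_exp_eq_Re norm_minus_cancel)
      then have "- exp B \<le> Re (l ?z)"
        using abs_Re_le_cmod[of "l ?z"] by linarith
      then show "K * exp (- exp B) \<le> dist (h ?z) v"
        using K by (simp add: dist_norm normv[OF z])
    qed
  qed
qed

section \<open>Topology of the sphere and the square root trick\<close>

lemma continuous_on_stereo: "continuous_on UNIV stereo"
  unfolding continuous_on_iff dist_riemann_sphere_def by auto

lemma continuous_on_Fin: "continuous_on A Fin"
proof -
  have le: "dist (Fin z) (Fin w) \<le> 2 * dist z w" for z w
  proof -
    have "1 \<le> sqrt (1 + (cmod z)\<^sup>2) * sqrt (1 + (cmod w)\<^sup>2)"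
      by (intro mult_ge1_I) auto
    then have "2 * cmod (z - w) / (sqrt (1 + (cmod z)\<^sup>2) * sqrt (1 + (cmod w)\<^sup>2)) \<le> 2 * cmod (z - w) / 1"
      by (intro divide_left_mono) auto
    then show ?thesis
      unfolding dist_Fin_Fin dist_norm by simp
  qed
  show ?thesis
    unfolding continuous_on_iff
  proof (intro ballI allI impI)
    fix z :: complex and e :: real assume "e > 0"
    then show "\<exists>d>0. \<forall>w\<in>A. dist w z < d \<longrightarrow> dist (Fin w) (Fin z) < e"
      using le by (intro exI[of _ "e/2"]) (smt (verit, best) field_sum_of_halves)
  qed
qed

lemma tendsto_Fin: "(f \<longlongrightarrow> z) F \<Longrightarrow> ((\<lambda>x. Fin (f x)) \<longlongrightarrow> Fin z) F"
  using continuous_on_tendsto_compose[OF continuous_on_Fin[of UNIV]] by auto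

lemma tendsto_Infty:
  assumes "filterlim f at_infinity F"
  shows "((\<lambda>x. Fin (f x)) \<longlongrightarrow> Infty) F"
proof (rule metric_tendsto_imp_tendsto)
  show "((\<lambda>x. 2 * inverse (f x)) \<longlongrightarrow> 2 * 0) F"
    by (intro tendsto_intros filterlim_compose[OF tendsto_inverse_0 assms])
  have "eventually (\<lambda>x. f x \<noteq> 0) F"
    using filterlim_at_infinity_imp_eventually_ne[OF assms] .
  then show "eventually (\<lambda>x. dist (Fin (f x)) Infty \<le> dist (2 * inverse (f x)) (2 * 0)) F"
  proof eventually_elim
    case (elim x)
    have "cmod (f x) \<le> sqrt (1 + (cmod (f x))\<^sup>2)"
      by (intro real_le_rsqrt) simp
    then have "2 / sqrt (1 + (cmod (f x))\<^sup>2) \<le> 2 / cmod (f x)"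
      using elim by (intro divide_left_mono mult_pos_pos) (auto simp: add_pos_nonneg)
    then show ?case
      by (simp add: dist_Fin_Infty norm_mult norm_inverse divide_inverse)
  qed
qed

lemma bounded_riemann_sphere: "bounded (A :: riemann_sphere set)"
proof -
  have "dist Infty x \<le> 2" for x
  proof (cases x)
    case (Fin z)
    have "1 \<le> sqrt (1 + (cmod z)\<^sup>2)"
      by simp
    then have "2 / sqrt (1 + (cmod z)\<^sup>2) \<le> 2 / 1"
      by (intro divide_left_mono) (auto simp: add_pos_nonneg)
    then show ?thesis
      unfolding Fin dist_commute[of Infty] dist_Fin_Infty by simp
  qed simp
  then show ?thesis
    unfolding bounded_def by blast
qed

text \<open>Stereographic projection from the north pole, a left inverse of \<open>Fin\<close>. At
  \<open>Infty\<close> the division by zero yields 0, so continuity is claimed only off that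
  point.\<close>

definition sphere_coord :: "riemann_sphere \<Rightarrow> complex" where
  "sphere_coord x = (1 / (1 - snd (stereo x))) *\<^sub>R fst (stereo x)"

lemma snd_stereo_Fin: "1 - snd (stereo (Fin z)) = 2 / (1 + (cmod z)\<^sup>2)"
proof -
  have "1 + (cmod z)\<^sup>2 > 0" by (simp add: add_pos_nonneg)
  then show ?thesis
    by (simp add: field_simps)
qed

lemma sphere_coord_Fin [simp]: "sphere_coord (Fin z) = z"
proof -
  have "1 + (cmod z)\<^sup>2 > 0" by (simp add: add_pos_nonneg)
  then have "1 / (2 / (1 + (cmod z)\<^sup>2)) * (2 / (1 + (cmod z)\<^sup>2)) = 1"
    by simp
  then show ?thesis
    unfolding sphere_coord_def snd_stereo_Fin
    by (simp only: stereo.simps(1) fst_conv scaleR_scaleR scaleR_one)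
qed

lemma snd_stereo_eq_1_iff: "snd (stereo x) = 1 \<longleftrightarrow> x = Infty"
proof (cases x)
  case (Fin z)
  have "1 + (cmod z)\<^sup>2 > 0" by (simp add: add_pos_nonneg)
  then have "1 - snd (stereo (Fin z)) \<noteq> 0"
    unfolding snd_stereo_Fin by simp
  then show ?thesis
    using Fin by auto
qed simp

lemma continuous_on_sphere_coord: "continuous_on (- {Infty}) sphere_coord"
proof -
  have c: "continuous_on (- {Infty}) stereo"
    using continuous_on_stereo by (rule continuous_on_subset) simp
  show ?thesis
    unfolding sphere_coord_def
    by (intro continuous_intros c) (auto simp: snd_stereo_eq_1_iff)
qed

lemma open_Fin_image:
  assumes "open A" shows "open (Fin ` A)"
proof -
  have "Fin ` A = sphere_coord -` A \<inter> (- {Infty})"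
  proof (rule set_eqI)
    fix x show "x \<in> Fin ` A \<longleftrightarrow> x \<in> sphere_coord -` A \<inter> (- {Infty})"
      by (cases x) auto
  qed
  moreover have "open (sphere_coord -` A \<inter> (- {Infty}))"
    using continuous_open_preimage[OF continuous_on_sphere_coord _ assms]
    by (simp add: Int_commute open_Compl)
  ultimately show ?thesis by simp
qed

lemma tendsto_FinD:
  assumes "((\<lambda>x. Fin (f x)) \<longlongrightarrow> Fin z) F"
  shows "(f \<longlongrightarrow> z) F"
proof -
  have "((\<lambda>x. sphere_coord (Fin (f x))) \<longlongrightarrow> sphere_coord (Fin z)) F"
    by (rule continuous_on_tendsto_compose[OF continuous_on_sphere_coord assms]) auto
  then show ?thesis by simp
qed

text \<open>Solving \<open>h = 1 / (q - s)\<close> and \<open>q^2 = G - c\<close> for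
  \<open>G\<close> gives this rational map of degree 2. The value 0 of \<open>v\<close> corresponds
  to infinite \<open>q\<close>, hence to \<open>Infty\<close>.\<close>

definition quadratic_cover :: "complex \<Rightarrow> complex \<Rightarrow> complex \<Rightarrow> riemann_sphere" where
  "quadratic_cover c s v = (if v = 0 then Infty else Fin (c + (s + inverse v)\<^sup>2))"

lemma continuous_on_quadratic_cover: "continuous_on UNIV (quadratic_cover c s)"
proof -
  have "((\<lambda>v. quadratic_cover c s v) \<longlongrightarrow> quadratic_cover c s a) (at a)" for a
  proof (cases "a = 0")
    case False
    have "eventually (\<lambda>v. v \<noteq> 0) (at a)"
      by (rule tendsto_imp_eventually_ne[OF tendsto_ident_at False])
    then have "eventually (\<lambda>v. quadratic_cover c s v = Fin (c + (s + inverse v)\<^sup>2)) (at a)"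
      by eventually_elim (simp add: quadratic_cover_def)
    moreover have "((\<lambda>v. Fin (c + (s + inverse v)\<^sup>2)) \<longlongrightarrow> Fin (c + (s + inverse a)\<^sup>2)) (at a)"
      using False by (intro tendsto_Fin tendsto_intros)
    ultimately show ?thesis
      using False by (simp add: quadratic_cover_def tendsto_cong)
  next
    case True
    have "filterlim (\<lambda>v. c + (s + inverse v)\<^sup>2) at_infinity (at 0)"
      unfolding power2_eq_square
      by (intro tendsto_add_filterlim_at_infinity[OF tendsto_const] filterlim_at_infinity_times
          filterlim_inverse_at_infinity)
    then have "((\<lambda>v. Fin (c + (s + inverse v)\<^sup>2)) \<longlongrightarrow> Infty) (at 0)"
      by (rule tendsto_Infty)
    moreover have "eventually (\<lambda>v. quadratic_cover c s v = Fin (c + (s + inverse v)\<^sup>2)) (at 0)"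
      unfolding eventually_at_filter by (simp add: quadratic_cover_def)
    ultimately show ?thesis
      using True by (simp add: tendsto_cong quadratic_cover_def)
  qed
  then show ?thesis
    by (simp add: continuous_on_def)
qed

lemma finite_quadratic_cover_fibre: "finite {v. quadratic_cover c s v = x}"
proof (cases x)
  case Infty
  then have "{v. quadratic_cover c s v = x} \<subseteq> {0}"
    by (auto simp: quadratic_cover_def split: if_splits)
  then show ?thesis
    using finite_subset by blast
next
  case (Fin w)
  define u where "u = csqrt (w - c)"
  have "v \<in> {inverse (u - s), inverse (- u - s)}" if "quadratic_cover c s v = x" for v
  proof -
    have "v \<noteq> 0" "c + (s + inverse v)\<^sup>2 = w"
      using that Fin by (auto simp: quadratic_cover_def split: if_splits)
    then have "(s + inverse v)\<^sup>2 = u\<^sup>2"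
      by (auto simp: u_def)
    then have "inverse v = u - s \<or> inverse v = - u - s"
      by (auto simp: power2_eq_iff algebra_simps)
    then show ?thesis
      by (metis inverse_inverse_eq insertCI)
  qed
  then have "{v. quadratic_cover c s v = x} \<subseteq> {inverse (u - s), inverse (- u - s)}"
    by blast
  then show ?thesis
    using finite_subset by blast
qed

text \<open>A branch \<open>q\<close> of the square root of \<open>G - c\<close> never takes both values \<open>u\<close> and \<open>-u\<close>, so it omits a disc.\<close>

lemma bounded_univalent_factor:
  assumes G: "G holomorphic_on strip" "inj_on G strip" and c: "c \<notin> G ` strip"
  obtains h s where "h holomorphic_on strip" "inj_on h strip" "bounded (h ` strip)"
    "\<And>z. z \<in> strip \<Longrightarrow> quadratic_cover c s (h z) = Fin (G z)"
proof (rule simply_connected_imp_holomorphic_sqrt[of "\<lambda>z. G z - c" strip])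
  show "simply_connected strip" "locally path_connected strip"
    by (simp_all add: convex_strip convex_imp_simply_connected convex_imp_locally_path_connected)
  show "(\<lambda>z. G z - c) holomorphic_on strip"
    by (intro holomorphic_on_diff G holomorphic_on_const)
  show "G z - c \<noteq> 0" if "z \<in> strip" for z
    using c that by auto
  fix q assume q: "q holomorphic_on strip" and "\<And>z. z \<in> strip \<Longrightarrow> G z - c = (q z)\<^sup>2"
  then have Gq: "G z = c + (q z)\<^sup>2" if "z \<in> strip" for z
    using that by (metis add.commute diff_add_cancel)
  have inj: "inj_on q strip"
    using G(2) Gq by (metis inj_on_def)
  have sym: "q z \<noteq> - q w" if "z \<in> strip" "w \<in> strip" for z w
  proof
    assume "q z = - q w"
    then have "G z = G w"
      using Gq that by simp
    then have "z = w"
      using G(2) that by (auto dest: inj_onD)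
    then have "q z = 0"
      using \<open>q z = - q w\<close> by simp
    then show False
      using Gq[OF that(1)] c that(1) by force
  qed
  have "open (q ` strip)"
    by (rule open_mapping_thm3[OF q open_strip inj])
  moreover have "(0::complex) \<in> strip"
    by (simp add: strip_def)
  ultimately obtain d where d: "d > 0" "ball (q 0) d \<subseteq> q ` strip"
    by (meson image_eqI openE)
  \<comment> \<open>The image contains a disc around \<open>q 0\<close>, so it omits the reflected
    disc around \<open>s\<close>; inversion at \<open>s\<close> is therefore bounded.\<close>
  define s where "s = - q 0"
  have far: "d \<le> cmod (q z - s)" if z: "z \<in> strip" for z
  proof (rule ccontr)
    assume "\<not> ?thesis"
    then have "- q z \<in> ball (q 0) d"
      by (simp add: s_def dist_norm add.commute)
    then obtain w where "w \<in> strip" "- q z = q w"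
      using d(2) by blast
    then show False
      using sym[OF \<open>w \<in> strip\<close> z] by simp
  qed
  then have ne: "q z - s \<noteq> 0" if "z \<in> strip" for z
    using d(1) that by force
  define h where "h = (\<lambda>z. inverse (q z - s))"
  show ?thesis
  proof (rule that)
    show "h holomorphic_on strip"
      unfolding h_def using ne by (intro holomorphic_on_inverse holomorphic_on_diff q) auto
    show "inj_on h strip"
      using inj unfolding h_def inj_on_def by auto
    have "cmod (h z) \<le> inverse d" if "z \<in> strip" for z
      using far[OF that] d(1) by (simp add: h_def norm_inverse le_imp_inverse_le)
    then show "bounded (h ` strip)"
      by (auto intro!: boundedI)
    show "quadratic_cover c s (h z) = Fin (G z)" if "z \<in> strip" for z
      using ne[OF that] Gq[OF that] by (simp add: quadratic_cover_def h_def)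
  qed
qed

section \<open>Crosscuts and the angular limit\<close>

text \<open>
  The end \<open>Re z \<rightarrow> \<infinity>\<close> of the strip corresponds to a boundary point of the disc, and the segments
  \<open>Re z = t\<close> to crosscuts of the disc separating that point from the origin.
\<close>

locale strip_uniformization =
  fixes \<Omega> :: "complex set" and G h :: "complex \<Rightarrow> complex" and R :: "complex \<Rightarrow> riemann_sphere"
  assumes hol_G: "G holomorphic_on strip" and inj_G: "inj_on G strip" and G_strip: "G ` strip = \<Omega>"
    and hol_h: "h holomorphic_on strip" and inj_h: "inj_on h strip" and bounded_h: "bounded (h ` strip)"
    and cont_R: "continuous_on UNIV R" and finite_R: "\<And>x. finite {v. R v = x}"
    and R_h: "\<And>z. z \<in> strip \<Longrightarrow> R (h z) = Fin (G z)"
begin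

lemma open_Omega: "open \<Omega>"
  using open_mapping_thm3[OF hol_G open_strip inj_G] G_strip by simp

text \<open>A limit inside \<Omega> would be carried by the continuous inverse of \<open>G\<close>
  to a limit of \<open>z\<close> inside the strip.\<close>

lemma boundary_sphere_limit:
  assumes z: "\<And>n. z n \<in> strip" and lim: "(\<lambda>n. Fin (G (z n))) \<longlonglongrightarrow> x"
    and escape: "\<And>w. w \<in> strip \<Longrightarrow> \<not> z \<longlonglongrightarrow> w"
  shows "x \<in> boundary_sphere \<Omega>"
proof -
  have "x \<notin> Fin ` \<Omega>"
  proof
    assume "x \<in> Fin ` \<Omega>"
    then obtain w where w: "w \<in> strip" "x = Fin (G w)"
      using G_strip by auto
    have lim': "(\<lambda>n. G (z n)) \<longlonglongrightarrow> G w"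
      using lim w tendsto_FinD by auto
    obtain g where g: "g holomorphic_on (G ` strip)" "\<And>z. z \<in> strip \<Longrightarrow> g (G z) = z"
      using holomorphic_has_inverse[OF hol_G open_strip inj_G] by metis
    have "(\<lambda>n. g (G (z n))) \<longlonglongrightarrow> g (G w)"
      by (rule continuous_on_tendsto_compose[OF holomorphic_on_imp_continuous_on[OF g(1)] lim'])
         (use w z in auto)
    then have "z \<longlonglongrightarrow> w"
      using g(2) z w by simp
    then show False
      using escape w by blast
  qed
  moreover have "x \<in> closure (Fin ` \<Omega>)"
    unfolding closure_sequential using z G_strip lim by (intro exI[of _ "\<lambda>n. Fin (G (z n))"]) auto
  ultimately show ?thesis
    unfolding boundary_sphere_def frontier_def using interior_subset by blast
qed

lemma boundary_sphere_disjoint: "x \<in> boundary_sphere \<Omega> \<Longrightarrow> x \<notin> Fin ` \<Omega>"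
  unfolding boundary_sphere_def frontier_def by (simp add: interior_open open_Fin_image[OF open_Omega])

section \<open>Images of vertical segments as crosscuts\<close>

definition vline :: "real \<Rightarrow> complex set" where
  "vline t = G ` {z\<in>strip. Re z = t}"

definition left_part :: "real \<Rightarrow> complex set" where
  "left_part t = G ` {z\<in>strip. Re z < t}"

definition right_part :: "real \<Rightarrow> complex set" where
  "right_part t = G ` {z\<in>strip. t < Re z}"

lemma left_right_disjoint: "left_part t \<inter> right_part t = {}"
proof -
  have "left_part t \<inter> right_part t = G ` ({z\<in>strip. Re z < t} \<inter> {z\<in>strip. t < Re z})"
    unfolding left_part_def right_part_def by (rule inj_on_image_Int[OF inj_G, symmetric]) auto
  also have "{z\<in>strip. Re z < t} \<inter> {z\<in>strip. t < Re z} = {}"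
    by auto
  finally show ?thesis by simp
qed

lemma vline_disjoint:
  assumes "s \<noteq> t" shows "vline s \<inter> vline t = {}"
proof -
  have "vline s \<inter> vline t = G ` ({z\<in>strip. Re z = s} \<inter> {z\<in>strip. Re z = t})"
    unfolding vline_def by (rule inj_on_image_Int[OF inj_G, symmetric]) auto
  also have "{z\<in>strip. Re z = s} \<inter> {z\<in>strip. Re z = t} = {}"
    using assms by auto
  finally show ?thesis by simp
qed

lemma Omega_diff_vline: "\<Omega> - vline t = left_part t \<union> right_part t"
proof -
  have "\<Omega> - vline t = G ` (strip - {z\<in>strip. Re z = t})"
    unfolding vline_def G_strip[symmetric] by (rule inj_on_image_set_diff[OF inj_G, symmetric]) auto
  also have "strip - {z\<in>strip. Re z = t} = {z\<in>strip. Re z < t} \<union> {z\<in>strip. t < Re z}"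
    by auto
  finally show ?thesis
    unfolding left_part_def right_part_def by (simp add: image_Un)
qed

lemma vline_eq: "vline t = (\<lambda>y. G (Complex t y)) ` {-(pi/2)<..<pi/2}"
proof -
  have "{z\<in>strip. Re z = t} = Complex t ` {-(pi/2)<..<pi/2}"
  proof (intro set_eqI iffI)
    fix z assume "z \<in> {z\<in>strip. Re z = t}"
    then show "z \<in> Complex t ` {-(pi/2)<..<pi/2}"
      by (intro image_eqI[of _ _ "Im z"]) (auto simp: strip_def complex_eq_iff)
  qed auto
  then show ?thesis
    unfolding vline_def by (simp add: image_image)
qed

text \<open>Points approaching an end of the segment have no limit in the strip, so
  \<open>boundary_sphere_limit\<close> applies. The sign \<open>s\<close> treats both ends at once.
  The second claim is what contradicts a positive distance between the segment's image under
  \<open>h\<close> and an omitted value.\<close>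

lemma line_endpoint:
  assumes g: "continuous_on {-(pi/2)..pi/2} g"
      "\<And>y. -(pi/2) < y \<Longrightarrow> y < pi/2 \<Longrightarrow> g y = h (Complex t y)"
    and s: "s = 1 \<or> s = (-1::real)"
  shows "R (g (s * (pi/2))) \<in> boundary_sphere \<Omega>"
    and "\<forall>\<delta>>0. \<exists>y. -(pi/2) < y \<and> y < pi/2 \<and> dist (h (Complex t y)) (g (s * (pi/2))) < \<delta>"
proof -
  define y where "y = (\<lambda>n. s * (pi/2) * (real n / real (Suc n)))"
  have lim: "y \<longlonglongrightarrow> s * (pi/2) * 1"
    unfolding y_def by (intro tendsto_intros LIMSEQ_n_over_Suc_n)
  have y: "-(pi/2) < y n" "y n < pi/2" for n
  proof -
    have "0 \<le> real n / real (Suc n)" "real n / real (Suc n) < 1"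
      by auto
    then have "pi/2 * (real n / real (Suc n)) < pi/2 * 1"
      by (intro mult_strict_left_mono) auto
    moreover have "\<bar>y n\<bar> = pi/2 * (real n / real (Suc n))"
      using s unfolding y_def abs_mult by auto
    ultimately have "\<bar>y n\<bar> < pi/2"
      by linarith
    then show "-(pi/2) < y n" "y n < pi/2"
      by auto
  qed
  have limg: "(\<lambda>n. g (y n)) \<longlonglongrightarrow> g (s * (pi/2))"
  proof (rule continuous_on_tendsto_compose[OF g(1)])
    show "y \<longlonglongrightarrow> s * (pi/2)" "s * (pi/2) \<in> {-(pi/2)..pi/2}"
      using lim s by auto
    show "eventually (\<lambda>n. y n \<in> {-(pi/2)..pi/2}) sequentially"
      using y by (intro always_eventually allI) (simp add: less_imp_le)
  qed
  show "R (g (s * (pi/2))) \<in> boundary_sphere \<Omega>"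
  proof (rule boundary_sphere_limit)
    show "Complex t (y n) \<in> strip" for n
      using y by simp
    have "(\<lambda>n. R (g (y n))) \<longlonglongrightarrow> R (g (s * (pi/2)))"
      by (rule continuous_on_tendsto_compose[OF cont_R limg]) auto
    then show "(\<lambda>n. Fin (G (Complex t (y n)))) \<longlonglongrightarrow> R (g (s * (pi/2)))"
      using g(2) R_h y by simp
    fix w assume w: "w \<in> strip"
    show "\<not> (\<lambda>n. Complex t (y n)) \<longlonglongrightarrow> w"
    proof
      assume "(\<lambda>n. Complex t (y n)) \<longlonglongrightarrow> w"
      then have "(\<lambda>n. Im (Complex t (y n))) \<longlonglongrightarrow> Im w"
        by (rule tendsto_Im)
      then have "Im w = s * (pi/2) * 1"
        using LIMSEQ_unique[OF _ lim] by simp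
      then show False
        using w s by (auto simp: strip_def)
    qed
  qed
  show "\<forall>\<delta>>0. \<exists>y. -(pi/2) < y \<and> y < pi/2 \<and> dist (h (Complex t y)) (g (s * (pi/2))) < \<delta>"
  proof (intro allI impI)
    fix \<delta> :: real assume "\<delta> > 0"
    then obtain n where "dist (g (y n)) (g (s * (pi/2))) < \<delta>"
      using limg unfolding lim_sequentially by blast
    then show "\<exists>y. -(pi/2) < y \<and> y < pi/2 \<and> dist (h (Complex t y)) (g (s * (pi/2))) < \<delta>"
      using g(2) y by metis
  qed
qed

text \<open>The image of the closed interval is compact, hence closed, so taking the closure adds at
  most the two end points.\<close>

lemma line_extension:
  assumes "line_energy h t < \<infinity>"
  obtains g where "continuous_on {-(pi/2)..pi/2} g"
    "\<And>y. -(pi/2) < y \<Longrightarrow> y < pi/2 \<Longrightarrow> g y = h (Complex t y)"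
    "R (g (pi/2)) \<in> boundary_sphere \<Omega>" "R (g (-(pi/2))) \<in> boundary_sphere \<Omega>"
    "closure (Fin ` vline t) \<subseteq> Fin ` vline t \<union> {R (g (pi/2)), R (g (-(pi/2)))}"
proof (rule line_energy_extension[OF hol_h assms])
  fix g assume g: "continuous_on {-(pi/2)..pi/2} g"
      "\<And>y. -(pi/2) < y \<Longrightarrow> y < pi/2 \<Longrightarrow> g y = h (Complex t y)"
  have "compact ((\<lambda>y. R (g y)) ` {-(pi/2)..pi/2})"
    by (intro compact_continuous_image continuous_on_compose2[OF cont_R g(1)]) auto
  then have "closed ((\<lambda>y. R (g y)) ` {-(pi/2)..pi/2})"
    by (rule compact_imp_closed)
  moreover have eq: "R (g y) = Fin (G (Complex t y))" if "-(pi/2) < y" "y < pi/2" for y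
    using that g(2) R_h by simp
  then have "Fin ` vline t \<subseteq> (\<lambda>y. R (g y)) ` {-(pi/2)..pi/2}"
  proof (intro subsetI)
    fix x assume "x \<in> Fin ` vline t"
    then obtain y where y: "-(pi/2) < y" "y < pi/2" "x = Fin (G (Complex t y))"
      unfolding vline_eq by auto
    then show "x \<in> (\<lambda>y. R (g y)) ` {-(pi/2)..pi/2}"
      using eq[OF y(1,2)] by (intro image_eqI[of _ _ y]) auto
  qed
  ultimately have "closure (Fin ` vline t) \<subseteq> (\<lambda>y. R (g y)) ` {-(pi/2)..pi/2}"
    by (rule closure_minimal[rotated])
  also have "\<dots> \<subseteq> Fin ` vline t \<union> {R (g (pi/2)), R (g (-(pi/2)))}"
  proof
    fix x assume "x \<in> (\<lambda>y. R (g y)) ` {-(pi/2)..pi/2}"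
    then obtain y where y: "-(pi/2) \<le> y" "y \<le> pi/2" "x = R (g y)"
      by auto
    then consider "y = pi/2" | "y = -(pi/2)" | "-(pi/2) < y" "y < pi/2"
      by linarith
    then show "x \<in> Fin ` vline t \<union> {R (g (pi/2)), R (g (-(pi/2)))}"
    proof cases
      case 3
      then have "x \<in> Fin ` vline t"
        unfolding vline_eq y(3) eq[OF 3] by (intro imageI) auto
      then show ?thesis by blast
    next
      case 1
      show ?thesis unfolding y(3) 1 by blast
    next
      case 2
      show ?thesis unfolding y(3) 2 by blast
    qed
  qed
  finally show ?thesis
    using that[OF g] line_endpoint(1)[OF g, of 1] line_endpoint(1)[OF g, of "-1"] by simp
qed

text \<open>Inside, injectivity of \<open>G\<close> excludes double points, and the ends lie outside
  \<Omega>. The only possible coincidence is that of the two ends, which \<open>loop_free\<close>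
  permits.\<close>

lemma crosscut_vline:
  assumes "line_energy h t < \<infinity>"
  shows "crosscut \<Omega> (vline t)"
proof (rule line_extension[OF assms])
  fix g assume g: "continuous_on {-(pi/2)..pi/2} g"
    "\<And>y. -(pi/2) < y \<Longrightarrow> y < pi/2 \<Longrightarrow> g y = h (Complex t y)"
    and bd: "R (g (pi/2)) \<in> boundary_sphere \<Omega>" "R (g (-(pi/2))) \<in> boundary_sphere \<Omega>"
  define \<gamma> where "\<gamma> = (\<lambda>s. R (g (pi * s - pi/2)))"
  have ends: "\<gamma> 0 \<in> boundary_sphere \<Omega>" "\<gamma> 1 \<in> boundary_sphere \<Omega>"
    using bd by (simp_all add: \<gamma>_def)
  have int: "-(pi/2) < pi * s - pi/2" "pi * s - pi/2 < pi/2" if "0 < s" "s < 1" for s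
    using that by auto
  have \<gamma>_int: "\<gamma> s = Fin (G (Complex t (pi * s - pi/2)))" if "0 < s" "s < 1" for s
    unfolding \<gamma>_def using g(2)[OF int[OF that]] R_h int[OF that] by simp
  have \<gamma>_in: "\<gamma> s \<in> Fin ` \<Omega>" if "0 < s" "s < 1" for s
    unfolding \<gamma>_int[OF that] G_strip[symmetric] using int[OF that] by auto
  have "path \<gamma>"
  proof -
    have "pi * s - pi/2 \<in> {-(pi/2)..pi/2}" if "s \<in> {0..1}" for s
      using that by auto
    then show ?thesis
      unfolding path_def \<gamma>_def
      by (intro continuous_on_compose2[OF cont_R] continuous_on_compose2[OF g(1)] continuous_intros) auto
  qed
  moreover have "loop_free \<gamma>"
    unfolding loop_free_def
  proof (intro ballI impI)
    fix x y :: real assume xy: "x \<in> {0..1}" "y \<in> {0..1}" "\<gamma> x = \<gamma> y"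
    have nb: "\<gamma> s \<noteq> \<gamma> 0" "\<gamma> s \<noteq> \<gamma> 1" if "0 < s" "s < 1" for s
      using boundary_sphere_disjoint ends \<gamma>_in[OF that] by metis+
    consider "0 < x" "x < 1" "0 < y" "y < 1" | "x = 0 \<or> x = 1" "y = 0 \<or> y = 1"
      | "0 < x" "x < 1" "y = 0 \<or> y = 1" | "0 < y" "y < 1" "x = 0 \<or> x = 1"
      using xy(1,2) by fastforce
    then show "x = y \<or> x = 0 \<and> y = 1 \<or> x = 1 \<and> y = 0"
    proof cases
      case 1
      then have "G (Complex t (pi * x - pi/2)) = G (Complex t (pi * y - pi/2))"
        using xy(3) \<gamma>_int by simp
      then have "Complex t (pi * x - pi/2) = Complex t (pi * y - pi/2)"
        by (rule inj_onD[OF inj_G]) (use int 1 in simp_all)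
      then show ?thesis
        by simp
    next
      case 3
      then show ?thesis using nb[OF 3(1,2)] xy(3) by auto
    next
      case 4
      then show ?thesis using nb[OF 4(1,2)] xy(3) by metis
    qed auto
  qed
  moreover have "Fin ` vline t = \<gamma> ` {0<..<1}"
  proof -
    have "{-(pi/2)<..<pi/2} = (\<lambda>s. pi * s - pi/2) ` {0<..<1}"
    proof (intro set_eqI iffI)
      fix y assume "y \<in> {-(pi/2)<..<pi/2}"
      then show "y \<in> (\<lambda>s. pi * s - pi/2) ` {0<..<1}"
        by (intro image_eqI[of _ _ "(y + pi/2) / pi"]) (auto simp: field_simps)
    qed auto
    then have "Fin ` vline t = (\<lambda>s. Fin (G (Complex t (pi * s - pi/2)))) ` {0<..<1}"
      unfolding vline_eq by (simp add: image_image)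
    also have "\<dots> = \<gamma> ` {0<..<1}"
      by (intro image_cong) (auto simp: \<gamma>_int)
    finally show ?thesis .
  qed
  moreover have "vline t \<subseteq> \<Omega>"
    unfolding vline_def G_strip[symmetric] by auto
  ultimately show ?thesis
    unfolding crosscut_def simple_path_def pathstart_def pathfinish_def
    using ends by blast
qed

text \<open>
  Crosscuts may share end points. The functions in \<open>F\<close> blow up at the end points of the crosscut
  over \<open>t0\<close>, and their energies single out the exceptional \<open>t\<close>.
\<close>

lemma disjoint_closures:
  assumes t0: "line_energy h t0 < \<infinity>"
  obtains F where "finite F" "\<And>H. H \<in> F \<Longrightarrow> H holomorphic_on strip"
    "\<And>H. H \<in> F \<Longrightarrow> strip_energy H UNIV < \<infinity>"
    "\<And>t. line_energy h t < \<infinity> \<Longrightarrow> (\<And>H. H \<in> F \<Longrightarrow> line_energy H t < \<infinity>) \<Longrightarrow> t \<noteq> t0 \<Longrightarrow>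
       closure (Fin ` vline t0) \<inter> closure (Fin ` vline t) = {}"
proof (rule line_extension[OF t0])
  fix g0 assume bd0: "R (g0 (pi/2)) \<in> boundary_sphere \<Omega>" "R (g0 (-(pi/2))) \<in> boundary_sphere \<Omega>"
    and cl0: "closure (Fin ` vline t0) \<subseteq> Fin ` vline t0 \<union> {R (g0 (pi/2)), R (g0 (-(pi/2)))}"
  \<comment> \<open>The full fibres of \<open>R\<close> are taken, because another segment may reach
    the same point of the sphere through a different value of \<open>h\<close>. Finite fibres keep
    the family of functions finite.\<close>
  define V where "V = {v. R v = R (g0 (pi/2))} \<union> {v. R v = R (g0 (-(pi/2)))}"
  have finV: "finite V"
    unfolding V_def using finite_R by simp
  have Vbd: "R v \<in> boundary_sphere \<Omega>" if "v \<in> V" for v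
    using that bd0 by (auto simp: V_def)
  have Vh: "v \<notin> h ` strip" if "v \<in> V" for v
    using boundary_sphere_disjoint[OF Vbd[OF that]] R_h G_strip by force
  have "\<forall>v\<in>V. \<exists>H. H holomorphic_on strip \<and> strip_energy H UNIV < \<infinity> \<and> (\<forall>t. line_energy H t < \<infinity> \<longrightarrow>
       (\<exists>\<delta>>0. \<forall>y. -(pi/2) < y \<and> y < pi/2 \<longrightarrow> \<delta> \<le> dist (h (Complex t y)) v))"
    using omitted_value_energy[OF hol_h inj_h bounded_h Vh] by metis
  then obtain H where H: "\<And>v. v \<in> V \<Longrightarrow> H v holomorphic_on strip"
    "\<And>v. v \<in> V \<Longrightarrow> strip_energy (H v) UNIV < \<infinity>"
    "\<And>v t. v \<in> V \<Longrightarrow> line_energy (H v) t < \<infinity> \<Longrightarrow>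
       \<exists>\<delta>>0. \<forall>y. -(pi/2) < y \<and> y < pi/2 \<longrightarrow> \<delta> \<le> dist (h (Complex t y)) v"
    by metis
  show ?thesis
  proof (rule that[of "H ` V"])
    fix t assume t: "line_energy h t < \<infinity>" "\<And>K. K \<in> H ` V \<Longrightarrow> line_energy K t < \<infinity>" "t \<noteq> t0"
    show "closure (Fin ` vline t0) \<inter> closure (Fin ` vline t) = {}"
    proof (rule line_extension[OF t(1)])
      fix g assume g: "continuous_on {-(pi/2)..pi/2} g"
        "\<And>y. -(pi/2) < y \<Longrightarrow> y < pi/2 \<Longrightarrow> g y = h (Complex t y)"
        and bd: "R (g (pi/2)) \<in> boundary_sphere \<Omega>" "R (g (-(pi/2))) \<in> boundary_sphere \<Omega>"
        and cl: "closure (Fin ` vline t) \<subseteq> Fin ` vline t \<union> {R (g (pi/2)), R (g (-(pi/2)))}"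
      have "g (s * (pi/2)) \<notin> V" if s: "s = 1 \<or> s = -1" for s
      proof
        assume "g (s * (pi/2)) \<in> V"
        then show False
          using H(3)[of "g (s * (pi/2))" t] t(2) line_endpoint(2)[OF g s] by (meson imageI not_le)
      qed
      from this[of 1] this[of "-1"] have "{R (g (pi/2)), R (g (-(pi/2)))} \<inter> {R (g0 (pi/2)), R (g0 (-(pi/2)))} = {}"
        by (auto simp: V_def)
      moreover have "Fin ` vline t0 \<inter> Fin ` vline t = {}"
        using vline_disjoint[OF t(3)[symmetric]] by auto
      moreover have "Fin ` vline s \<inter> boundary_sphere \<Omega> = {}" for s
        using boundary_sphere_disjoint G_strip by (auto simp: vline_def)
      then have "Fin ` vline t0 \<inter> {R (g (pi/2)), R (g (-(pi/2)))} = {}"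
        "Fin ` vline t \<inter> {R (g0 (pi/2)), R (g0 (-(pi/2)))} = {}"
        using bd bd0 by auto
      ultimately have "(Fin ` vline t0 \<union> {R (g0 (pi/2)), R (g0 (-(pi/2)))}) \<inter>
          (Fin ` vline t \<union> {R (g (pi/2)), R (g (-(pi/2)))}) = {}"
        by (simp only: Int_Un_distrib Int_Un_distrib2 Un_empty Int_commute simp_thms)
      then show ?thesis
        using cl cl0 by (meson disjoint_iff subsetD)
    qed
  qed (use finV H in auto)
qed

text \<open>The two half-strips are convex and open, and \<open>G\<close> carries connectedness,
  openness and disjointness over to the two sides of the crosscut.\<close>

lemma components_vline: "components (\<Omega> - vline t) = {left_part t, right_part t}"
proof -
  have hs: "connected (G ` (strip \<inter> X))" if "convex X" for X
    using holomorphic_on_imp_continuous_on[OF hol_G] that convex_strip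
    by (intro connected_continuous_image convex_connected convex_Int) (auto intro: continuous_on_subset)
  have op: "open (G ` (strip \<inter> X))" if "open X" for X
    using that open_strip
    by (intro open_mapping_thm3[OF holomorphic_on_subset[OF hol_G] _ inj_on_subset[OF inj_G]]) auto
  have L: "left_part t = G ` (strip \<inter> {z. Re z < t})" "right_part t = G ` (strip \<inter> {z. Re z > t})"
    unfolding left_part_def right_part_def by (auto intro!: arg_cong[where f="image G"])
  have oc: "open (left_part t)" "open (right_part t)" "connected (left_part t)" "connected (right_part t)"
    unfolding L by (intro op hs open_halfspace_Re_lt open_halfspace_Re_gt
        convex_halfspace_Re_lt convex_halfspace_Re_gt)+
  have "of_real (t - 1) \<in> {z\<in>strip. Re z < t}" "of_real (t + 1) \<in> {z\<in>strip. t < Re z}"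
    by (auto simp: strip_def)
  then have ne: "left_part t \<noteq> {}" "right_part t \<noteq> {}"
    unfolding left_part_def right_part_def by blast+
  note dis = left_right_disjoint[of t] and un = Omega_diff_vline[of t]
  \<comment> \<open>A connected set that contains \<open>A\<close> and lies in the disjoint union of
    the open sets \<open>A\<close> and \<open>B\<close> cannot meet \<open>B\<close>.\<close>
  have comp: "A \<in> components (A \<union> B)" if "open A" "open B" "connected A" "A \<noteq> {}" "A \<inter> B = {}"
    for A B :: "complex set"
    unfolding in_components_maximal
  proof (intro conjI allI impI)
    fix D assume D: "D \<noteq> {} \<and> A \<subseteq> D \<and> D \<subseteq> A \<union> B \<and> connected D"
    have "A \<inter> D = {} \<or> B \<inter> D = {}"
      using D connectedD[of D A B] that by blast
    then show "D = A"
      using D that by blast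
  qed (use that in auto)
  have "left_part t \<in> components (\<Omega> - vline t)" "right_part t \<in> components (\<Omega> - vline t)"
    unfolding un using comp[OF oc(1,2,3) ne(1) dis] comp[OF oc(2,1,4) ne(2)] dis
    by (simp_all add: Int_commute Un_commute)
  moreover have "C = left_part t \<or> C = right_part t" if C: "C \<in> components (\<Omega> - vline t)" for C
  proof -
    have "C \<noteq> {}" "C \<subseteq> left_part t \<union> right_part t"
      using in_components_nonempty[OF C] in_components_subset[OF C] un by auto
    then have "C \<inter> left_part t \<noteq> {} \<or> C \<inter> right_part t \<noteq> {}"
      by blast
    then show ?thesis
      using components_nonoverlap[OF C] calculation by blast
  qed
  ultimately show ?thesis
    by blast
qed

lemma vline_subset_left_part: "s < t \<Longrightarrow> vline s \<subseteq> left_part t"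
  by (auto simp: vline_def left_part_def)

lemma vline_subset_right_part: "t < s \<Longrightarrow> vline s \<subseteq> right_part t"
  by (auto simp: vline_def right_part_def)

lemma vline_nonempty: "vline t \<noteq> {}"
  unfolding vline_eq using pi_gt_zero by (simp add: not_le)

lemma interior_part_vline:
  assumes "t 0 < t n"
  shows "interior_part \<Omega> (\<lambda>n. vline (t n)) n = right_part (t n)"
  unfolding interior_part_def components_vline
proof (rule the_equality)
  show "right_part (t n) \<in> {left_part (t n), right_part (t n)} \<and> \<not> vline (t 0) \<subseteq> right_part (t n)"
    using vline_subset_left_part[OF assms] left_right_disjoint vline_nonempty by blast
  show "V = right_part (t n)" if "V \<in> {left_part (t n), right_part (t n)} \<and> \<not> vline (t 0) \<subseteq> V" for V
    using that vline_subset_left_part[OF assms] by blast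
qed

text \<open>\<open>R\<close> is uniformly continuous on a compact disc containing the range of
  \<open>h\<close>, so small oscillation of \<open>h\<close> on a segment becomes small chordal
  diameter, uniformly in \<open>t\<close>.\<close>

lemma diameter_vline:
  assumes "\<epsilon> > 0"
  obtains E where "E > 0" "\<And>t. line_energy h t \<le> ennreal E \<Longrightarrow> diameter (Fin ` vline t) \<le> \<epsilon>"
proof -
  obtain M where M: "\<And>z. z \<in> strip \<Longrightarrow> cmod (h z) \<le> M"
    using bounded_h by (auto simp: bounded_iff)
  have "uniformly_continuous_on (cball 0 M) R"
    by (intro compact_uniformly_continuous continuous_on_subset[OF cont_R]) auto
  then obtain d where d: "d > 0" "\<And>x y. x \<in> cball 0 M \<Longrightarrow> y \<in> cball 0 M \<Longrightarrow> dist x y < d \<Longrightarrow> dist (R x) (R y) < \<epsilon>"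
    using assms unfolding uniformly_continuous_on_def by metis
  \<comment> \<open>Makes the oscillation bound \<open>sqrt (E * pi)\<close> on a segment of length
    \<open>pi\<close> equal to \<open>d / 2\<close>.\<close>
  define E where "E = (d/2)\<^sup>2 / pi"
  have E: "E > 0" "sqrt (E * pi) < d"
    using d(1) by (simp_all add: E_def)
  show ?thesis
  proof (rule that[OF E(1)])
    fix t assume t: "line_energy h t \<le> ennreal E"
    have "dist x y \<le> \<epsilon>" if xy: "x \<in> Fin ` vline t" "y \<in> Fin ` vline t" for x y
    proof -
      obtain a b where ab: "-(pi/2) < a" "a < pi/2" "-(pi/2) < b" "b < pi/2"
          "x = Fin (G (Complex t a))" "y = Fin (G (Complex t b))"
        using xy unfolding vline_eq by auto
      have "dist (h (Complex t a)) (h (Complex t b)) < d"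
        using line_energy_diameter[OF hol_h less_imp_le[OF E(1)] t ab(3,4,1,2)] E(2)
        by (simp add: dist_norm)
      then have "dist (R (h (Complex t a))) (R (h (Complex t b))) < \<epsilon>"
        using M ab by (intro d(2)) auto
      then show ?thesis
        using R_h ab by simp
    qed
    then show "diameter (Fin ` vline t) \<le> \<epsilon>"
      unfolding diameter_def using vline_nonempty by (auto intro!: cSUP_least)
  qed
qed

lemma null_chain_vline:
  assumes t: "strict_mono t" and e: "\<And>n. line_energy h (t n) \<le> ennreal (e n)" "e \<longlonglongrightarrow> 0"
    and dis: "\<And>n. closure (Fin ` vline (t n)) \<inter> closure (Fin ` vline (t (Suc n))) = {}"
  shows "null_chain \<Omega> (\<lambda>n. vline (t n))"
  unfolding null_chain_def
proof (intro conjI allI impI)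
  show "crosscut \<Omega> (vline (t n))" for n
    using e(1)[of n] ennreal_less_top le_less_trans by (intro crosscut_vline) (auto simp: less_top[symmetric] top_unique)
  show "separates \<Omega> (vline (t n)) (vline (t 0)) (vline (t (Suc n)))" if "1 \<le> n" for n
    unfolding separates_def components_vline
  proof (intro bexI conjI)
    show "vline (t 0) \<subseteq> left_part (t n)" "vline (t (Suc n)) \<subseteq> right_part (t n)"
      using strict_monoD[OF t] that by (auto intro!: vline_subset_left_part vline_subset_right_part)
    then show "left_part (t n) \<noteq> right_part (t n)"
      using left_right_disjoint vline_nonempty by blast
  qed auto
  show "(\<lambda>n. diameter (Fin ` vline (t n))) \<longlonglongrightarrow> 0"
  proof (rule LIMSEQ_I)
    fix r :: real assume "r > 0"
    then obtain E where E: "E > 0" "\<And>t. line_energy h t \<le> ennreal E \<Longrightarrow> diameter (Fin ` vline t) \<le> r/2"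
      using diameter_vline[of "r/2"] by auto
    obtain N where N: "\<And>n. n \<ge> N \<Longrightarrow> norm (e n - 0) < E"
      using LIMSEQ_D[OF e(2) E(1)] by auto
    have "norm (diameter (Fin ` vline (t n)) - 0) < r" if "n \<ge> N" for n
    proof -
      have "line_energy h (t n) \<le> ennreal E"
        using order_trans[OF e(1)[of n] ennreal_leI[of "e n" E]] N[OF that] by auto
      then have le: "diameter (Fin ` vline (t n)) \<le> r/2"
        by (rule E(2))
      have "bounded (Fin ` vline (t n))"
        by (rule bounded_riemann_sphere)
      then show ?thesis
        using le \<open>r > 0\<close> diameter_ge_0[of "Fin ` vline (t n)"] by simp
    qed
    then show "\<exists>no. \<forall>n\<ge>no. norm (diameter (Fin ` vline (t n)) - 0) < r"
      by blast
  qed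
qed (use dis in blast)

text \<open>The right parts shrink as the line moves to the right, so any two sequences of lines
  tending to infinity interlace. Hence the prime end does not depend on which lines were
  picked.\<close>

lemma null_chain_equiv_vline:
  assumes "null_chain \<Omega> (\<lambda>n. vline (s n))" "strict_mono s" "filterlim s at_top sequentially"
    and "null_chain \<Omega> (\<lambda>n. vline (t n))" "strict_mono t" "filterlim t at_top sequentially"
  shows "((\<lambda>n. vline (s n)), (\<lambda>n. vline (t n))) \<in> null_chain_equiv \<Omega>"
proof -
  have *: "\<exists>m\<ge>1. interior_part \<Omega> (\<lambda>n. vline (t n)) m \<subseteq> interior_part \<Omega> (\<lambda>n. vline (s n)) n"
    if n: "1 \<le> n" and st: "strict_mono s" "strict_mono t" and lim: "filterlim t at_top sequentially"
    for n s t
  proof -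
    obtain N where N: "\<And>m. m \<ge> N \<Longrightarrow> s n \<le> t m"
      using lim by (auto simp: filterlim_at_top eventually_sequentially)
    define m where "m = max N 1"
    have "right_part (t m) \<subseteq> right_part (s n)"
      using N[of m] by (auto simp: right_part_def m_def)
    moreover have "s 0 < s n" "t 0 < t m" "m \<ge> 1"
      using n strict_monoD[OF st(1)] strict_monoD[OF st(2)] by (auto simp: m_def)
    ultimately show ?thesis
      by (intro exI[of _ m]) (simp add: interior_part_vline)
  qed
  show ?thesis
    unfolding null_chain_equiv_def using assms * by auto
qed

section \<open>Area estimates near the end of the strip\<close>

lemma open_tail_image: "open (h ` {z\<in>strip. a < Re z})"
proof -
  have "{z\<in>strip. a < Re z} = strip \<inter> {z. Re z > a}"
    by auto
  then show ?thesis
    using open_strip open_halfspace_Re_gt[of a]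
    by (intro open_mapping_thm3[OF holomorphic_on_subset[OF hol_h] _ inj_on_subset[OF inj_h]]) auto
qed

text \<open>Continuity of measure from above: the tails have finite area since \<open>h\<close> is
  bounded, and their intersection is empty since \<open>h\<close> is injective.\<close>

lemma tail_area:
  assumes "\<epsilon> > 0"
  obtains X :: real where "\<And>a. a \<ge> X \<Longrightarrow> emeasure lborel (h ` {z\<in>strip. a < Re z}) < ennreal \<epsilon>"
proof -
  define A where "A = (\<lambda>n::nat. h ` {z\<in>strip. real n < Re z})"
  have "(\<lambda>n. emeasure lborel (A n)) \<longlonglongrightarrow> emeasure lborel (\<Inter>n. A n)"
  proof (rule Lim_emeasure_decseq)
    show "range A \<subseteq> sets lborel"
      using open_tail_image by (auto simp: A_def borel_open)
    show "decseq A"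
      unfolding A_def by (intro decseq_SucI image_mono) auto
    show "emeasure lborel (A n) \<noteq> \<infinity>" for n
    proof -
      have "bounded (A n)"
        unfolding A_def by (rule bounded_subset[OF bounded_h]) auto
      then show ?thesis
        using emeasure_bounded_finite by (auto simp: less_top)
    qed
  qed
  moreover have "(\<Inter>n. A n) = {}"
  proof (rule ccontr)
    assume "(\<Inter>n. A n) \<noteq> {}"
    then obtain w where w: "\<And>n. w \<in> A n"
      by blast
    obtain z where z: "z \<in> strip" "w = h z"
      using w[of 0] by (auto simp: A_def)
    obtain n :: nat where n: "Re z < real n"
      using reals_Archimedean2 by blast
    obtain z' where "z' \<in> strip" "w = h z'" "real n < Re z'"
      using w[of n] by (auto simp: A_def)
    then show False
      using inj_onD[OF inj_h, of z z'] z n by simp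
  qed
  ultimately have "(\<lambda>n. emeasure lborel (A n)) \<longlonglongrightarrow> 0"
    by simp
  then have "eventually (\<lambda>n. emeasure lborel (A n) < ennreal \<epsilon>) sequentially"
    using assms by (intro order_tendstoD) auto
  then obtain n where n: "emeasure lborel (A n) < ennreal \<epsilon>"
    by (auto simp: eventually_sequentially)
  show ?thesis
  proof (rule that)
    fix a assume "a \<ge> real n"
    then have "emeasure lborel (h ` {z\<in>strip. a < Re z}) \<le> emeasure lborel (A n)"
      unfolding A_def using open_tail_image by (intro emeasure_mono image_mono) (auto simp: borel_open)
    then show "emeasure lborel (h ` {z\<in>strip. a < Re z}) < ennreal \<epsilon>"
      using n by (rule le_less_trans)
  qed
qed

lemma strip_energy_le_tail_area:
  "strip_energy h {z. a < Re z \<and> Re z < b} \<le> emeasure lborel (h ` {z\<in>strip. a < Re z})"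
proof -
  define U where "U = strip \<inter> {z. a < Re z \<and> Re z < b}"
  have U: "open U" "h holomorphic_on U" "inj_on h U"
  proof -
    have "open {z. a < Re z \<and> Re z < b}"
      by (intro open_Collect_conj open_Collect_less continuous_intros)
    then show "open U" "h holomorphic_on U" "inj_on h U"
      unfolding U_def using open_strip
      by (auto intro: holomorphic_on_subset[OF hol_h] inj_on_subset[OF inj_h])
  qed
  have "bounded (h ` U)"
    by (rule bounded_subset[OF bounded_h]) (auto simp: U_def)
  then have fin: "emeasure lborel (h ` U \<inter> UNIV) < \<infinity>"
    using emeasure_bounded_finite by simp
  have "{z\<in>U. h z \<in> UNIV} = U"
    by simp
  with nn_integral_norm_deriv_squared[OF U _ fin]
  have "strip_energy h {z. a < Re z \<and> Re z < b} = emeasure lborel (h ` U)"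
    unfolding strip_energy_def U_def[symmetric] by simp
  also have "\<dots> \<le> emeasure lborel (h ` {z\<in>strip. a < Re z})"
    using open_tail_image by (intro emeasure_mono) (auto simp: U_def borel_open)
  finally show ?thesis .
qed

text \<open>By Bloch's theorem a large derivative at \<open>z\<close> would put a disc of radius
  \<open>\<rho>\<close> into the image of \<open>ball z r\<close>, more area than the tail
  has.\<close>

lemma deriv_small:
  assumes \<theta>: "\<theta> < pi/2" and \<eta>: "\<eta> > 0"
  obtains X where "\<And>z. \<bar>Im z\<bar> \<le> \<theta> \<Longrightarrow> X \<le> Re z \<Longrightarrow> cmod (deriv h z) \<le> \<eta>"
proof -
  \<comment> \<open>This radius keeps \<open>ball z r\<close> in the strip and its real parts within
    1 of \<open>Re z\<close>. In \<open>\<rho>\<close> below, 12 is the constant of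
    \<open>Bloch\<close>.\<close>
  define r where "r = min 1 (pi/2 - \<theta>)"
  have r: "r > 0" "r \<le> 1" "r \<le> pi/2 - \<theta>"
    using \<theta> by (auto simp: r_def)
  define \<rho> where "\<rho> = r * \<eta> / 12"
  have \<rho>: "\<rho> > 0"
    using r \<eta> by (simp add: \<rho>_def)
  then have "pi * \<rho>\<^sup>2 > 0"
    by simp
  then show ?thesis
  proof (rule tail_area)
    fix X assume X: "\<And>a. a \<ge> X \<Longrightarrow> emeasure lborel (h ` {z\<in>strip. a < Re z}) < ennreal (pi * \<rho>\<^sup>2)"
    show ?thesis
    proof (rule that[of "X + 1"], rule ccontr)
      fix z assume z: "\<bar>Im z\<bar> \<le> \<theta>" "X + 1 \<le> Re z" and n: "\<not> cmod (deriv h z) \<le> \<eta>"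
      have ball: "ball z r \<subseteq> {z\<in>strip. X < Re z}"
      proof
        fix w assume "w \<in> ball z r"
        then have "cmod (w - z) < r"
          by (simp add: dist_norm norm_minus_commute)
        then have "\<bar>Re (w - z)\<bar> < r" "\<bar>Im (w - z)\<bar> < r"
          using abs_Re_le_cmod abs_Im_le_cmod le_less_trans by blast+
        then show "w \<in> {z\<in>strip. X < Re z}"
          using z r by (auto simp: strip_def)
      qed
      have "h holomorphic_on ball z r"
        by (rule holomorphic_on_subset[OF hol_h]) (use ball in auto)
      moreover have "\<rho> \<le> r * cmod (deriv h z) / 12"
        using n r by (simp add: \<rho>_def)
      ultimately show False
      proof (rule Bloch[OF _ r(1)])
        fix b assume b: "ball b \<rho> \<subseteq> h ` ball z r"
        have "emeasure lborel (ball b \<rho>) \<le> emeasure lborel (h ` {z\<in>strip. X < Re z})"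
          using b ball open_tail_image by (intro emeasure_mono) (auto simp: borel_open)
        also have "\<dots> < ennreal (pi * \<rho>\<^sup>2)"
          by (rule X) simp
        finally show False
          using \<rho> by (simp add: emeasure_ball unit_ball_vol_2)
      qed
    qed
  qed
qed

text \<open>The threshold \<open>X\<close> is uniform in \<open>t0\<close>: the energy bound
  concerns \<open>h\<close> alone, and avoiding the end points over \<open>t0\<close> costs only a
  null set of lines. The first claim extends a chain, the second starts one. Tail area
  \<open>\<epsilon>/2\<close> compensates the factor 2 of \<open>exists_good_line\<close>.\<close>

lemma next_line:
  assumes "\<epsilon> > 0"
  obtains X where "\<And>a t0. X \<le> a \<Longrightarrow> line_energy h t0 < \<infinity> \<Longrightarrow> t0 < a \<Longrightarrow>
    \<exists>t. a < t \<and> t < a + 1 \<and> line_energy h t \<le> ennreal \<epsilon> \<and>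
        closure (Fin ` vline t0) \<inter> closure (Fin ` vline t) = {}"
    and "\<And>a. X \<le> a \<Longrightarrow> \<exists>t. a < t \<and> t < a + 1 \<and> line_energy h t \<le> ennreal \<epsilon>"
proof (rule tail_area[of "\<epsilon>/2"])
  fix X assume X: "\<And>a. a \<ge> X \<Longrightarrow> emeasure lborel (h ` {z\<in>strip. a < Re z}) < ennreal (\<epsilon>/2)"
  have en: "strip_energy h {z. a < Re z \<and> Re z < a + 1} \<le> ennreal (\<epsilon>/2)" if "X \<le> a" for a
    using strip_energy_le_tail_area X[OF that] by (meson less_imp_le order_trans)
  show ?thesis
  proof (rule that)
    show "\<exists>t. a < t \<and> t < a + 1 \<and> line_energy h t \<le> ennreal \<epsilon>" if "X \<le> a" for a
      by (rule exists_good_line[OF hol_h _ en[OF that], of "{}"]) (use assms in auto)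
    fix a t0 assume a: "X \<le> a" "line_energy h t0 < \<infinity>" "t0 < a"
    show "\<exists>t. a < t \<and> t < a + 1 \<and> line_energy h t \<le> ennreal \<epsilon> \<and>
        closure (Fin ` vline t0) \<inter> closure (Fin ` vline t) = {}"
    proof (rule disjoint_closures[OF a(2)])
      fix F assume F: "finite F" "\<And>H. H \<in> F \<Longrightarrow> H holomorphic_on strip"
        "\<And>H. H \<in> F \<Longrightarrow> strip_energy H UNIV < \<infinity>"
        "\<And>t. line_energy h t < \<infinity> \<Longrightarrow> (\<And>H. H \<in> F \<Longrightarrow> line_energy H t < \<infinity>) \<Longrightarrow> t \<noteq> t0 \<Longrightarrow>
         closure (Fin ` vline t0) \<inter> closure (Fin ` vline t) = {}"
      show ?thesis
      proof (rule exists_good_line[OF hol_h _ en[OF a(1)] F(1-3)])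
        fix t assume t: "a < t" "t < a + 1" "line_energy h t \<le> ennreal (2 * (\<epsilon>/2))"
          "\<And>H. H \<in> F \<Longrightarrow> line_energy H t < \<infinity>"
        then have "line_energy h t \<le> ennreal \<epsilon>"
          by simp
        moreover from this have "line_energy h t < \<infinity>"
          using ennreal_less_top le_less_trans by fastforce
        ultimately show ?thesis
          using t F(4)[of t] a(3) by (intro exI[of _ t]) auto
      qed (use assms in auto)
    qed
  qed
qed (use assms in simp)

text \<open>Disjointness from the previous crosscut depends on its end points, so the lines are
  found one after another by dependent choice. Each is taken just to the right of a term of
  \<open>x\<close>, so the chain follows a prescribed sequence up to distance 1.\<close>

lemma null_chain_along_sequence:
  assumes x: "filterlim x at_top sequentially"
  obtains t j where "strict_mono (t :: nat \<Rightarrow> real)" "filterlim t at_top sequentially"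
    "filterlim j at_top sequentially" "\<And>n. \<bar>t n - x (j n)\<bar> \<le> 1"
    "null_chain \<Omega> (\<lambda>n. vline (t n))"
proof -
  define e where "e = (\<lambda>n::nat. 1 / real (Suc n))"
  have e: "e n > 0" for n
    by (simp add: e_def)
  \<comment> \<open>The clause \<open>n \<le> j\<close> drives the indices to infinity, although
    they need not increase strictly.\<close>
  define P where "P = (\<lambda>n (t, j). line_energy h t \<le> ennreal (e n) \<and> \<bar>t - x j\<bar> \<le> 1 \<and> n \<le> j)"
  define Q where "Q = (\<lambda>(n::nat) (t, j::nat) (t', j'::nat). t < t' \<and>
      closure (Fin ` vline t) \<inter> closure (Fin ` vline t') = {})"
  have large: "\<exists>j\<ge>n. X \<le> x j" for n X
    using x unfolding filterlim_at_top eventually_sequentially by (meson nle_le order_trans)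
  have "\<exists>f. \<forall>n. P n (f n) \<and> Q n (f n) (f (Suc n))"
  proof (rule dependent_nat_choice)
    show "\<exists>p. P 0 p"
    proof (rule next_line[OF e[of 0]])
      fix X assume X: "\<And>a. X \<le> a \<Longrightarrow> \<exists>t. a < t \<and> t < a + 1 \<and> line_energy h t \<le> ennreal (e 0)"
      obtain j where "X \<le> x j"
        using large[of 0 X] by auto
      then obtain t where "x j < t" "t < x j + 1" "line_energy h t \<le> ennreal (e 0)"
        using X by blast
      then show ?thesis
        by (intro exI[of _ "(t, j)"]) (auto simp: P_def)
    qed
    fix p n assume p: "P n p"
    obtain t j where tj: "p = (t, j)"
      by (cases p)
    have fin: "line_energy h t < \<infinity>"
      using p ennreal_less_top le_less_trans by (fastforce simp: P_def tj)
    show "\<exists>q. P (Suc n) q \<and> Q n p q"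
    proof (rule next_line[OF e[of "Suc n"]])
      fix X assume X: "\<And>a t0. X \<le> a \<Longrightarrow> line_energy h t0 < \<infinity> \<Longrightarrow> t0 < a \<Longrightarrow>
        \<exists>t. a < t \<and> t < a + 1 \<and> line_energy h t \<le> ennreal (e (Suc n)) \<and>
        closure (Fin ` vline t0) \<inter> closure (Fin ` vline t) = {}"
      \<comment> \<open>The bound \<open>t + 1\<close> puts the new line strictly to the right of
        the previous one.\<close>
      obtain j' where j': "Suc n \<le> j'" "max X (t + 1) \<le> x j'"
        using large by blast
      then obtain t' where "x j' < t'" "t' < x j' + 1" "line_energy h t' \<le> ennreal (e (Suc n))"
          "closure (Fin ` vline t) \<inter> closure (Fin ` vline t') = {}"
        using X[of "x j'" t] fin by auto
      then show ?thesis
        using j' by (intro exI[of _ "(t', j')"]) (auto simp: P_def Q_def tj)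
    qed
  qed
  then obtain f where f: "\<And>n. P n (f n)" "\<And>n. Q n (f n) (f (Suc n))"
    by blast
  define t where "t = fst \<circ> f"
  define j where "j = snd \<circ> f"
  have P: "line_energy h (t n) \<le> ennreal (e n)" "\<bar>t n - x (j n)\<bar> \<le> 1" "n \<le> j n" for n
    using f(1)[of n] by (auto simp: P_def t_def j_def split: prod.splits)
  have Q: "t n < t (Suc n)" "closure (Fin ` vline (t n)) \<inter> closure (Fin ` vline (t (Suc n))) = {}" for n
    using f(2)[of n] by (auto simp: Q_def t_def j_def split: prod.splits)
  show ?thesis
  proof (rule that)
    show t: "strict_mono t"
      using Q(1) by (rule strict_mono_Suc_iff[THEN iffD2, rule_format])
    show j: "filterlim j at_top sequentially"
      using P(3) by (intro filterlim_at_top_mono[OF filterlim_ident]) auto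
    show "\<bar>t n - x (j n)\<bar> \<le> 1" for n
      by (rule P(2))
    have "filterlim (\<lambda>n. - 1 + x (j n)) at_top sequentially"
      by (intro filterlim_tendsto_add_at_top[OF tendsto_const] filterlim_compose[OF x j])
    then show "filterlim t at_top sequentially"
    proof (rule filterlim_at_top_mono)
      have "- 1 + x (j n) \<le> t n" for n
        using P(2)[of n] by linarith
      then show "eventually (\<lambda>n. - 1 + x (j n) \<le> t n) sequentially"
        by simp
    qed
    have "e \<longlonglongrightarrow> 0"
      unfolding e_def by (rule LIMSEQ_Suc[OF lim_1_over_n])
    then show "null_chain \<Omega> (\<lambda>n. vline (t n))"
      using t P(1) Q(2) by (intro null_chain_vline)
  qed
qed

text \<open>A chain along the integers determines the prime end and \<open>p\<close> before any
  \<open>\<theta>\<close> is chosen. A sequence in a substrip along which convergence to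
  \<open>p\<close> fails is shadowed by a second chain; as the chains are equivalent, the second
  leads to the same \<open>p\<close>.\<close>

lemma angular_limit:
  assumes pe: "\<forall>\<xi>\<in>prime_ends \<Omega>. \<exists>p. principal_part \<xi> = {p}"
  obtains p where "p \<in> boundary_sphere \<Omega>"
    "\<And>\<theta> \<epsilon>. \<theta> < pi/2 \<Longrightarrow> \<epsilon> > 0 \<Longrightarrow> \<exists>X. \<forall>z. \<bar>Im z\<bar> \<le> \<theta> \<and> X \<le> Re z \<longrightarrow> dist (Fin (G z)) p < \<epsilon>"
proof (rule null_chain_along_sequence[OF filterlim_real_sequentially])
  fix s :: "nat \<Rightarrow> real" and j0 :: "nat \<Rightarrow> nat"
  assume s: "strict_mono s" "filterlim s at_top sequentially" "null_chain \<Omega> (\<lambda>n. vline (s n))"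
  define \<xi> where "\<xi> = null_chain_equiv \<Omega> `` {\<lambda>n. vline (s n)}"
  have "\<xi> \<in> prime_ends \<Omega>"
    unfolding prime_ends_def \<xi>_def using s(3) by (intro quotientI) simp
  then obtain p where p: "principal_part \<xi> = {p}"
    using pe by blast
  have lim: "\<exists>X. \<forall>z. \<bar>Im z\<bar> \<le> \<theta> \<and> X \<le> Re z \<longrightarrow> dist (Fin (G z)) p < \<epsilon>"
    if \<theta>: "\<theta> < pi/2" and \<epsilon>: "\<epsilon> > 0" for \<theta> \<epsilon>
  proof (rule ccontr)
    assume "\<not> ?thesis"
    then have "\<forall>n::nat. \<exists>z. \<bar>Im z\<bar> \<le> \<theta> \<and> real n \<le> Re z \<and> \<epsilon> \<le> dist (Fin (G z)) p"
      by (meson not_less)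
    then obtain z where z: "\<And>n. \<bar>Im (z n)\<bar> \<le> \<theta>" "\<And>n::nat. real n \<le> Re (z n)"
        "\<And>n. \<epsilon> \<le> dist (Fin (G (z n))) p"
      by metis
    have zs: "z n \<in> strip" for n
      using z(1)[of n] \<theta> by (simp add: strip_def)
    \<comment> \<open>The subsequence makes \<open>h\<close> converge, which is possible because
      \<open>h\<close> is bounded; \<open>R b\<close> is then the limit on the sphere, possibly
      \<open>Infty\<close>.\<close>
    have "bounded (range (\<lambda>n. h (z n)))"
      by (rule bounded_subset[OF bounded_h]) (use zs in auto)
    then obtain b r where r: "strict_mono (r :: nat \<Rightarrow> nat)" and b: "((\<lambda>n. h (z n)) \<circ> r) \<longlonglongrightarrow> b"
      using bounded_imp_convergent_subsequence by blast
    have x: "filterlim (\<lambda>n. Re (z (r n))) at_top sequentially"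
    proof (rule filterlim_at_top_mono[OF filterlim_real_sequentially], intro always_eventually allI)
      fix n
      show "real n \<le> Re (z (r n))"
        using z(2)[of "r n"] seq_suble[OF r, of n] by linarith
    qed
    show False
    proof (rule null_chain_along_sequence[OF x])
      fix t :: "nat \<Rightarrow> real" and j :: "nat \<Rightarrow> nat"
      assume t: "strict_mono t" "filterlim t at_top sequentially"
        and j: "filterlim j at_top sequentially" and tj: "\<And>n. \<bar>t n - Re (z (r (j n)))\<bar> \<le> 1"
        and nc: "null_chain \<Omega> (\<lambda>n. vline (t n))"
      define u where "u = (\<lambda>n. z (r (j n)))"
      \<comment> \<open>\<open>v n\<close> lies on the crosscut at the height of \<open>u n\<close>.
        The segment between them has length at most 1 and stays in the substrip, where
        \<open>deriv h\<close> is small.\<close>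
      define v where "v = (\<lambda>n. Complex (t n) (Im (u n)))"
      have us: "u n \<in> strip" "\<bar>Im (u n)\<bar> \<le> \<theta>" for n
        using zs z(1) by (auto simp: u_def)
      then have vs: "v n \<in> strip" for n
        by (auto simp: v_def strip_def)
      have hu: "(\<lambda>n. h (u n)) \<longlonglongrightarrow> b"
        using filterlim_compose[OF b j] by (simp add: u_def o_def)
      have "(\<lambda>n. h (v n) - h (u n)) \<longlonglongrightarrow> 0"
      proof (rule LIMSEQ_I)
        fix \<eta> :: real assume "\<eta> > 0"
        then have \<eta>: "\<eta>/2 > 0" by simp
        show "\<exists>N. \<forall>n\<ge>N. norm (h (v n) - h (u n) - 0) < \<eta>"
        proof (rule deriv_small[OF \<theta> \<eta>])
          fix X assume X: "\<And>z. \<bar>Im z\<bar> \<le> \<theta> \<Longrightarrow> X \<le> Re z \<Longrightarrow> cmod (deriv h z) \<le> \<eta>/2"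
          obtain N where N: "\<And>n. n \<ge> N \<Longrightarrow> X + 1 \<le> t n"
            using t(2) by (auto simp: filterlim_at_top eventually_sequentially)
          have "cmod (h (v n) - h (u n)) < \<eta>" if "n \<ge> N" for n
          proof -
            have sub: "closed_segment (u n) (v n) \<subseteq> {z. \<bar>Im z\<bar> \<le> \<theta> \<and> X \<le> Re z}"
            proof (rule closed_segment_subset)
              show "u n \<in> {z. \<bar>Im z\<bar> \<le> \<theta> \<and> X \<le> Re z}" "v n \<in> {z. \<bar>Im z\<bar> \<le> \<theta> \<and> X \<le> Re z}"
                using us(2)[of n] N[OF that] tj[of n] by (auto simp: v_def u_def)
              have "{z. \<bar>Im z\<bar> \<le> \<theta> \<and> X \<le> Re z} = {z. Im z \<le> \<theta>} \<inter> {z. Im z \<ge> - \<theta>} \<inter> {z. Re z \<ge> X}"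
                by auto
              moreover have "convex ({z. Im z \<le> \<theta>} \<inter> {z. Im z \<ge> - \<theta>} \<inter> {z. Re z \<ge> X})"
                by (intro convex_Int convex_halfspace_Im_le convex_halfspace_Im_ge convex_halfspace_Re_ge)
              ultimately show "convex {z. \<bar>Im z\<bar> \<le> \<theta> \<and> X \<le> Re z}"
                by simp
            qed
            have "cmod (h (v n) - h (u n)) \<le> \<eta>/2 * cmod (v n - u n)"
            proof (rule field_differentiable_bound[where S = "closed_segment (u n) (v n)"])
              fix w assume w: "w \<in> closed_segment (u n) (v n)"
              then have "\<bar>Im w\<bar> \<le> \<theta>" "X \<le> Re w"
                using sub by auto
              then show "cmod (deriv h w) \<le> \<eta>/2"
                by (rule X)
              have "w \<in> strip"
                using \<open>\<bar>Im w\<bar> \<le> \<theta>\<close> \<theta> by (simp add: strip_def)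
              then show "(h has_field_derivative deriv h w) (at w within closed_segment (u n) (v n))"
                using holomorphic_derivI[OF hol_h open_strip] has_field_derivative_at_within by blast
            qed auto
            also have "cmod (v n - u n) = \<bar>t n - Re (u n)\<bar>"
              by (simp add: v_def cmod_def)
            also have "\<eta>/2 * \<bar>t n - Re (u n)\<bar> \<le> \<eta>/2 * 1"
              using tj[of n] \<eta> by (intro mult_left_mono) (auto simp: u_def)
            finally show ?thesis
              using \<eta> by linarith
          qed
          then show ?thesis
            by auto
        qed
      qed
      from tendsto_add[OF this hu] have hv: "(\<lambda>n. h (v n)) \<longlonglongrightarrow> b"
        by simp
      have Rlim: "(\<lambda>n. Fin (G (w n))) \<longlonglongrightarrow> R b" if "\<And>n. w n \<in> strip" "(\<lambda>n. h (w n)) \<longlonglongrightarrow> b" for w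
      proof -
        have "(\<lambda>n. R (h (w n))) \<longlonglongrightarrow> R b"
          by (rule continuous_on_tendsto_compose[OF cont_R that(2)]) auto
        then show ?thesis
          using R_h that(1) by simp
      qed
      have "(\<lambda>n. vline (t n)) \<in> \<xi>"
        unfolding \<xi>_def using null_chain_equiv_vline[OF s(3,1,2) nc t] by simp
      moreover have "G (v n) \<in> vline (t n)" for n
        unfolding vline_def using vs by (auto simp: v_def)
      ultimately have "R b \<in> principal_part \<xi>"
        unfolding principal_part_def mem_Collect_eq using Rlim[OF vs hv]
        by (intro bexI[of _ "\<lambda>n. vline (t n)"] exI[of _ "\<lambda>n. G (v n)"] conjI allI)
      then have "(\<lambda>n. Fin (G (u n))) \<longlonglongrightarrow> p"
        using Rlim[OF us(1) hu] p by simp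
      then obtain n where "dist (Fin (G (u n))) p < \<epsilon>"
        using \<epsilon> unfolding lim_sequentially by blast
      then show False
        using z(3)[of "r (j n)"] by (simp add: u_def)
    qed
  qed
  \<comment> \<open>The integers suffice here: they stay on the axis of the strip and
    diverge.\<close>
  have "p \<in> boundary_sphere \<Omega>"
  proof (rule boundary_sphere_limit)
    show "of_nat n \<in> strip" for n
      by (simp add: strip_def)
    show "(\<lambda>n. Fin (G (of_nat n))) \<longlonglongrightarrow> p"
      unfolding lim_sequentially
    proof (intro allI impI)
      fix \<epsilon> :: real assume "\<epsilon> > 0"
      then obtain X where X: "\<And>z. \<bar>Im z\<bar> \<le> 0 \<Longrightarrow> X \<le> Re z \<Longrightarrow> dist (Fin (G z)) p < \<epsilon>"
        using lim[of 0 \<epsilon>] by auto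
      obtain N :: nat where "X \<le> real N"
        using real_arch_simple by blast
      then show "\<exists>no. \<forall>n\<ge>no. dist (Fin (G (of_nat n))) p < \<epsilon>"
        using X by (intro exI[of _ N]) (auto intro!: X)
    qed
    show "\<not> (\<lambda>n. of_nat n) \<longlonglongrightarrow> w" for w :: complex
      using tendsto_of_nat[where 'a=complex] not_tendsto_and_filterlim_at_infinity[OF sequentially_bot] by blast
  qed
  then show ?thesis
    using that lim by blast
qed

end

section \<open>Iteration in the half-plane\<close>

definition halfplane :: "complex set" where
  "halfplane = {w. 0 < Re w}"

text \<open>The quotient \<open>cmod (u - v) / cmod (u + cnj v)\<close> is the pseudohyperbolic
  distance of the half-plane, and this identity measures how far it stays below 1.\<close>

lemma cmod_add_cnj_squared: "(cmod (u + cnj v))\<^sup>2 = (cmod (u - v))\<^sup>2 + 4 * (Re u * Re v)"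
  unfolding cmod_power2 by (simp add: power2_eq_square algebra_simps)

lemma add_cnj_nonzero: "u \<in> halfplane \<Longrightarrow> v \<in> halfplane \<Longrightarrow> u + cnj v \<noteq> 0"
  by (auto simp: halfplane_def complex_eq_iff)

lemma cmod_diff_less_add_cnj:
  assumes "u \<in> halfplane" "v \<in> halfplane"
  shows "cmod (u - v) < cmod (u + cnj v)"
proof (rule power2_less_imp_less)
  show "(cmod (u - v))\<^sup>2 < (cmod (u + cnj v))\<^sup>2"
    using assms unfolding cmod_add_cnj_squared by (simp add: halfplane_def)
qed simp

text \<open>Maps the half-plane to the disc with infinity going to 1, the position to which Wolff's
  boundary point will be rotated.\<close>

definition cayley :: "complex \<Rightarrow> complex" where
  "cayley w = (w - 1) / (w + 1)"

definition cayley_inv :: "complex \<Rightarrow> complex" where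
  "cayley_inv z = (1 + z) / (1 - z)"

lemma halfplane_plus_1: "w \<in> halfplane \<Longrightarrow> w + 1 \<noteq> 0"
  by (auto simp: halfplane_def complex_eq_iff)

lemma cayley_in_ball: "w \<in> halfplane \<Longrightarrow> cayley w \<in> ball 0 1"
  using cmod_diff_less_add_cnj[of w 1] halfplane_plus_1[of w]
  by (simp add: cayley_def halfplane_def norm_divide divide_less_eq)

text \<open>The right-hand side is the Poisson kernel with pole 1. Its level sets bound the
  horodiscs at 1, so invariance of horodiscs turns into monotonicity of the real part.\<close>

lemma Re_cayley_inv: "Re (cayley_inv z) = (1 - (cmod z)\<^sup>2) / (cmod (1 - z))\<^sup>2"
  unfolding cayley_inv_def Re_divide cmod_power2 by (simp add: power2_eq_square algebra_simps)

lemma cayley_inv_in_halfplane: "z \<in> ball 0 1 \<Longrightarrow> cayley_inv z \<in> halfplane"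
proof -
  assume z: "z \<in> ball 0 1"
  then have "z \<noteq> 1" by auto
  moreover have "(cmod z)\<^sup>2 < 1"
    using z by (simp add: power_less_one_iff abs_square_less_1)
  ultimately show ?thesis
    by (simp add: halfplane_def Re_cayley_inv)
qed

lemma cayley_inv_cayley:
  assumes "w \<in> halfplane" shows "cayley_inv (cayley w) = w"
proof -
  have "w + 1 \<noteq> 0"
    by (rule halfplane_plus_1[OF assms])
  then have "1 + cayley w = 2 * w / (w + 1)" "1 - cayley w = 2 / (w + 1)"
    by (simp_all add: cayley_def field_simps)
  with \<open>w + 1 \<noteq> 0\<close> show ?thesis
    by (simp add: cayley_inv_def)
qed

lemma cayley_cayley_inv:
  assumes "z \<in> ball 0 1" shows "cayley (cayley_inv z) = z"
proof -
  have "1 - z \<noteq> 0"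
    using assms by auto
  then have "cayley_inv z - 1 = 2 * z / (1 - z)" "cayley_inv z + 1 = 2 / (1 - z)"
    by (simp_all add: cayley_inv_def field_simps)
  with \<open>1 - z \<noteq> 0\<close> show ?thesis
    by (simp add: cayley_def)
qed

lemma holomorphic_cayley: "cayley holomorphic_on halfplane"
  unfolding cayley_def using halfplane_plus_1 by (intro holomorphic_intros) auto

lemma holomorphic_cayley_inv: "cayley_inv holomorphic_on ball 0 1"
  unfolding cayley_inv_def by (intro holomorphic_intros) auto

lemma cmod_Moebius_cayley:
  assumes u: "u \<in> halfplane" and v: "v \<in> halfplane"
  shows "cmod (Moebius_function 0 (cayley v) (cayley u)) = cmod (u - v) / cmod (u + cnj v)"
proof -
  have n: "u + 1 \<noteq> 0" "v + 1 \<noteq> 0" "cnj v + 1 \<noteq> 0" "u + cnj v \<noteq> 0"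
    using halfplane_plus_1[OF u] halfplane_plus_1[OF v] add_cnj_nonzero[OF u v]
    by (auto simp: complex_eq_iff)
  have "cayley u - cayley v = 2 * (u - v) / ((u + 1) * (v + 1))"
    using n by (simp add: cayley_def field_simps)
  moreover have "1 - cnj (cayley v) * cayley u = 2 * (u + cnj v) / ((u + 1) * (cnj v + 1))"
  proof -
    have D: "(u + 1) * (cnj v + 1) \<noteq> 0"
      using n by simp
    have "1 - cnj (cayley v) * cayley u = 1 - (cnj v - 1) * (u - 1) / ((u + 1) * (cnj v + 1))"
      by (simp add: cayley_def mult.commute)
    also have "\<dots> = ((u + 1) * (cnj v + 1) - (cnj v - 1) * (u - 1)) / ((u + 1) * (cnj v + 1))"
      by (simp only: diff_divide_distrib divide_self[OF D])
    also have "(u + 1) * (cnj v + 1) - (cnj v - 1) * (u - 1) = 2 * (u + cnj v)"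
      by (simp add: algebra_simps)
    finally show ?thesis .
  qed
  ultimately have "Moebius_function 0 (cayley v) (cayley u)
      = (u - v) / (u + cnj v) * ((cnj v + 1) / (v + 1))"
    using n by (simp add: Moebius_function_simple del: distrib_left_numeral right_diff_distrib_numeral)
  moreover have "cmod (cnj v + 1) = cmod (v + 1)"
    by (metis complex_cnj_add complex_cnj_one complex_mod_cnj)
  ultimately show ?thesis
    using n by (simp add: norm_mult norm_divide)
qed

lemma Schwarz_Pick_halfplane:
  assumes F: "F holomorphic_on halfplane" "F ` halfplane \<subseteq> halfplane"
    and u: "u \<in> halfplane" and v: "v \<in> halfplane"
  shows "cmod (F u - F v) * cmod (u + cnj v) \<le> cmod (u - v) * cmod (F u + cnj (F v))"
proof -
  define f where "f = cayley \<circ> (F \<circ> cayley_inv)"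
  have i1: "cayley_inv ` ball 0 1 \<subseteq> halfplane" "cayley ` halfplane \<subseteq> ball 0 1"
    using cayley_inv_in_halfplane cayley_in_ball by auto
  have "F \<circ> cayley_inv holomorphic_on ball 0 1"
    by (rule holomorphic_on_compose_gen[OF holomorphic_cayley_inv F(1) i1(1)])
  moreover have "(F \<circ> cayley_inv) ` ball 0 1 \<subseteq> halfplane"
    using i1 F(2) by fastforce
  ultimately have "f holomorphic_on ball 0 1"
    unfolding f_def using holomorphic_on_compose_gen holomorphic_cayley by blast
  moreover have "f ` ball 0 1 \<subseteq> ball 0 1"
    unfolding f_def using i1 \<open>(F \<circ> cayley_inv) ` ball 0 1 \<subseteq> halfplane\<close> by fastforce
  ultimately have "cmod (Moebius_function 0 (f (cayley v)) (f (cayley u)))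
      \<le> cmod (Moebius_function 0 (cayley v) (cayley u))"
    using cayley_in_ball u v by (intro Schwarz_Pick) auto
  moreover have "f (cayley w) = cayley (F w)" if "w \<in> halfplane" for w
    using that by (simp add: f_def cayley_inv_cayley)
  moreover have Fuv: "F u \<in> halfplane" "F v \<in> halfplane"
    using F(2) u v by auto
  ultimately have "cmod (F u - F v) / cmod (F u + cnj (F v)) \<le> cmod (u - v) / cmod (u + cnj v)"
    using u v by (simp add: cmod_Moebius_cayley)
  then show ?thesis
    using add_cnj_nonzero[OF u v] add_cnj_nonzero[OF Fuv] by (simp add: field_simps)
qed

text \<open>The real part of \<open>q\<close> may vanish, so the estimate is applied to
  \<open>q + \<eta>\<close> and \<open>\<eta>\<close> tends to 0. After squaring,
  \<open>cmod_add_cnj_squared\<close> cancels the common product of squared distances and leaves a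
  bound in real parts.\<close>

lemma Schwarz_Pick_halfplane_closed:
  assumes q: "q holomorphic_on halfplane" "\<And>w. w \<in> halfplane \<Longrightarrow> 0 \<le> Re (q w)"
    and u: "u \<in> halfplane" and v: "v \<in> halfplane"
  shows "(cmod (q u - q v))\<^sup>2 * (Re u * Re v) \<le> (cmod (u - v))\<^sup>2 * (Re (q u) * Re (q v))"
proof -
  have *: "(cmod (q u - q v))\<^sup>2 * (Re u * Re v)
      \<le> (cmod (u - v))\<^sup>2 * ((Re (q u) + \<eta>) * (Re (q v) + \<eta>))" if \<eta>: "\<eta> > 0" for \<eta>
  proof -
    define p where "p = (\<lambda>w. q w + of_real \<eta>)"
    have "p holomorphic_on halfplane"
      unfolding p_def by (intro holomorphic_intros q)
    moreover have "p ` halfplane \<subseteq> halfplane"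
      using q(2) \<eta> by (auto simp: p_def halfplane_def add_nonneg_pos)
    ultimately have "cmod (p u - p v) * cmod (u + cnj v) \<le> cmod (u - v) * cmod (p u + cnj (p v))"
      using u v by (rule Schwarz_Pick_halfplane)
    then have "(cmod (p u - p v) * cmod (u + cnj v))\<^sup>2 \<le> (cmod (u - v) * cmod (p u + cnj (p v)))\<^sup>2"
      by (intro power_mono) auto
    then have "(cmod (p u - p v))\<^sup>2 * (Re u * Re v) \<le> (cmod (u - v))\<^sup>2 * (Re (p u) * Re (p v))"
      unfolding power_mult_distrib cmod_add_cnj_squared by (simp add: algebra_simps)
    then show ?thesis
      by (simp add: p_def)
  qed
  have "((\<lambda>\<eta>. (cmod (u - v))\<^sup>2 * ((Re (q u) + \<eta>) * (Re (q v) + \<eta>))) \<longlongrightarrow>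
      (cmod (u - v))\<^sup>2 * ((Re (q u) + 0) * (Re (q v) + 0))) (at_right 0)"
    by (intro tendsto_intros)
  then have "(cmod (q u - q v))\<^sup>2 * (Re u * Re v) \<le> (cmod (u - v))\<^sup>2 * ((Re (q u) + 0) * (Re (q v) + 0))"
    by (rule tendsto_lowerbound) (use * in \<open>auto simp: eventually_at_right_less intro: eventually_at_rightI[of 0 1]\<close>)
  then show ?thesis
    by simp
qed

section \<open>Wolff's lemma and the growth of orbits\<close>

lemma funpow_halfplane:
  assumes F: "F holomorphic_on halfplane" "F ` halfplane \<subseteq> halfplane"
  shows "(F ^^ n) holomorphic_on halfplane \<and> (F ^^ n) ` halfplane \<subseteq> halfplane"
proof (induction n)
  case (Suc n)
  then have "F \<circ> (F ^^ n) holomorphic_on halfplane"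
    using holomorphic_on_compose_gen F(1) by blast
  moreover have "(F \<circ> (F ^^ n)) ` halfplane \<subseteq> halfplane"
    using Suc F(2) by fastforce
  ultimately show ?case
    unfolding funpow.simps(2) by blast
qed (simp add: holomorphic_on_ident id_def)

text \<open>Horodiscs at \<open>\<sigma>\<close> are invariant; \<open>\<sigma>\<close> is a limit of fixed points of the contractions \<open>r F\<close> with \<open>r < 1\<close>.\<close>

lemma Wolff_lemma:
  assumes F: "F holomorphic_on ball 0 1" "F ` ball 0 1 \<subseteq> ball 0 1"
    and nofix: "\<And>z. z \<in> ball 0 1 \<Longrightarrow> F z \<noteq> z"
  obtains \<sigma> where "cmod \<sigma> = 1"
    "\<And>z. z \<in> ball 0 1 \<Longrightarrow>
       (1 - (cmod z)\<^sup>2) * (cmod (1 - cnj \<sigma> * F z))\<^sup>2 \<le> (1 - (cmod (F z))\<^sup>2) * (cmod (1 - cnj \<sigma> * z))\<^sup>2"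
proof -
  define r where "r = (\<lambda>n. real (Suc n) / real (Suc (Suc n)))"
  have r: "0 < r n" "r n < 1" for n
    by (auto simp: r_def)
  have r1: "r \<longlonglongrightarrow> 1"
    unfolding r_def by (rule LIMSEQ_Suc[OF LIMSEQ_n_over_Suc_n])
  have contF: "continuous_on (ball 0 1) F"
    by (rule holomorphic_on_imp_continuous_on[OF F(1)])
  have "\<exists>p. p \<in> cball 0 (r n) \<and> of_real (r n) * F p = p" for n
  proof -
    have sub: "cball 0 (r n) \<subseteq> ball (0::complex) 1"
      using r(2)[of n] by auto
    have cont: "continuous_on (cball 0 (r n)) (\<lambda>z. of_real (r n) * F z)"
      by (intro continuous_intros continuous_on_subset[OF contF sub])
    have im: "(\<lambda>z. of_real (r n) * F z) \<in> cball 0 (r n) \<rightarrow> cball 0 (r n)"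
    proof
      fix z :: complex assume "z \<in> cball 0 (r n)"
      then have "cmod (F z) \<le> 1"
        using F(2) sub by (force intro: less_imp_le)
      then show "of_real (r n) * F z \<in> cball 0 (r n)"
        using r[of n] by (simp add: norm_mult mult_left_le)
    qed
    show ?thesis
      using brouwer_ball[OF r(1) cont im] by metis
  qed
  then obtain p where p: "\<And>n. p n \<in> cball 0 (r n)" "\<And>n. of_real (r n) * F (p n) = p n"
    by metis
  have p1: "p n \<in> ball 0 1" for n
    using p(1)[of n] r(2)[of n] by auto
  have pick: "(1 - (cmod z)\<^sup>2) * (cmod (1 - cnj (p n) * (of_real (r n) * F z)))\<^sup>2
      \<le> (1 - (cmod (of_real (r n) * F z))\<^sup>2) * (cmod (1 - cnj (p n) * z))\<^sup>2"
    if z: "z \<in> ball 0 1" for z n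
  proof -
    define f where "f = (\<lambda>z. of_real (r n) * F z)"
    have f: "f holomorphic_on ball 0 1"
      unfolding f_def by (intro holomorphic_intros F)
    have fb: "f ` ball 0 1 \<subseteq> ball 0 1"
    proof
      fix y assume "y \<in> f ` ball 0 1"
      then obtain x where "x \<in> ball 0 1" "y = of_real (r n) * F x"
        by (auto simp: f_def)
      moreover from this have "F x \<in> ball 0 1"
        using F(2) by blast
      ultimately show "y \<in> ball 0 1"
        using r[of n] mult_strict_mono[of "r n" 1 "cmod (F x)" 1] by (simp add: norm_mult)
    qed
    have id: "(cmod (1 - cnj a * b))\<^sup>2 = (cmod (b - a))\<^sup>2 + (1 - (cmod a)\<^sup>2) * (1 - (cmod b)\<^sup>2)"
      for a b :: complex
      unfolding cmod_power2 by (simp add: power2_eq_square algebra_simps)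
    have pos: "1 - (cmod a)\<^sup>2 > 0" if "a \<in> ball 0 1" for a :: complex
      using that by (simp add: abs_square_less_1)
    have ne: "cmod (1 - cnj a * b) > 0" if "a \<in> ball 0 1" "b \<in> ball 0 1" for a b :: complex
    proof -
      have "(cmod (1 - cnj a * b))\<^sup>2 > 0"
        unfolding id using mult_pos_pos[OF pos[OF that(1)] pos[OF that(2)]]
        by (simp add: add_nonneg_pos)
      then show ?thesis
        by (simp only: zero_less_power2 norm_eq_zero zero_less_norm_iff) simp
    qed
    have fz: "f z \<in> ball 0 1" and fp: "f (p n) = p n"
      using fb imageI[OF z, of f] p(2) by (auto simp only: f_def)
    have "cmod (Moebius_function 0 (f (p n)) (f z)) \<le> cmod (Moebius_function 0 (p n) z)"
      by (rule Schwarz_Pick[OF f fb z p1])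
    then have "cmod (f z - p n) * cmod (1 - cnj (p n) * z) \<le> cmod (z - p n) * cmod (1 - cnj (p n) * f z)"
      using ne[OF p1[of n] z] ne[OF p1[of n] fz]
      by (simp add: fp Moebius_function_simple norm_divide field_simps)
    then have "(cmod (f z - p n) * cmod (1 - cnj (p n) * z))\<^sup>2 \<le> (cmod (z - p n) * cmod (1 - cnj (p n) * f z))\<^sup>2"
      by (intro power_mono) auto
    \<comment> \<open>Rewriting with \<open>id\<close>, the common product of squared distances
      cancels; the factor \<open>1 - (cmod (p n))\<^sup>2\<close> is positive and is divided out
      next.\<close>
    then have "(1 - (cmod (p n))\<^sup>2) * ((1 - (cmod z)\<^sup>2) * (cmod (1 - cnj (p n) * f z))\<^sup>2)
        \<le> (1 - (cmod (p n))\<^sup>2) * ((1 - (cmod (f z))\<^sup>2) * (cmod (1 - cnj (p n) * z))\<^sup>2)"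
      unfolding power_mult_distrib id by (simp add: algebra_simps)
    then show ?thesis
      unfolding f_def using pos[OF p1[of n]] by simp
  qed
  have "bounded (range p)"
    using p1 by (intro boundedI[of _ 1]) (auto intro: less_imp_le)
  then obtain \<sigma> s where s: "strict_mono (s :: nat \<Rightarrow> nat)" and \<sigma>: "(p \<circ> s) \<longlonglongrightarrow> \<sigma>"
    using bounded_imp_convergent_subsequence by blast
  have rs: "(\<lambda>n. r (s n)) \<longlonglongrightarrow> 1"
    using LIMSEQ_subseq_LIMSEQ[OF r1 s] by (simp add: o_def)
  have ps: "(\<lambda>n. p (s n)) \<longlonglongrightarrow> \<sigma>"
    using \<sigma> by (simp add: o_def)
  have "cmod \<sigma> \<le> 1"
    using p1 by (intro LIMSEQ_le_const2[OF tendsto_norm[OF ps]]) (auto intro: less_imp_le)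
  \<comment> \<open>Since \<open>r n\<close> tends to 1, a limit of the points \<open>p n\<close>
    inside the disc would be a fixed point of \<open>F\<close>.\<close>
  moreover have "\<not> cmod \<sigma> < 1"
  proof
    assume "cmod \<sigma> < 1"
    then have sb: "\<sigma> \<in> ball 0 1" by simp
    have "(\<lambda>n. F (p (s n))) \<longlonglongrightarrow> F \<sigma>"
      by (rule continuous_on_tendsto_compose[OF contF ps sb]) (use p1 in auto)
    then have "(\<lambda>n. of_real (r (s n)) * F (p (s n))) \<longlonglongrightarrow> of_real 1 * F \<sigma>"
      by (intro tendsto_intros rs)
    then have "(\<lambda>n. p (s n)) \<longlonglongrightarrow> F \<sigma>"
      by (simp add: p(2))
    then have "F \<sigma> = \<sigma>"
      using LIMSEQ_unique ps by blast
    then show False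
      using nofix[OF sb] by simp
  qed
  ultimately have "cmod \<sigma> = 1" by simp
  then show ?thesis
  proof (rule that)
    fix z :: complex assume z: "z \<in> ball 0 1"
    have l: "(\<lambda>n. (1 - (cmod z)\<^sup>2) * (cmod (1 - cnj (p (s n)) * (of_real (r (s n)) * F z)))\<^sup>2)
      \<longlonglongrightarrow> (1 - (cmod z)\<^sup>2) * (cmod (1 - cnj \<sigma> * (of_real 1 * F z)))\<^sup>2"
      by (intro tendsto_intros ps rs)
    have u: "(\<lambda>n. (1 - (cmod (of_real (r (s n)) * F z))\<^sup>2) * (cmod (1 - cnj (p (s n)) * z))\<^sup>2)
      \<longlonglongrightarrow> (1 - (cmod (of_real 1 * F z))\<^sup>2) * (cmod (1 - cnj \<sigma> * z))\<^sup>2"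
      by (intro tendsto_intros ps rs)
    have "(1 - (cmod z)\<^sup>2) * (cmod (1 - cnj \<sigma> * (of_real 1 * F z)))\<^sup>2
        \<le> (1 - (cmod (of_real 1 * F z))\<^sup>2) * (cmod (1 - cnj \<sigma> * z))\<^sup>2"
      by (rule LIMSEQ_le[OF l u]) (use pick[OF z] in blast)
    then show "(1 - (cmod z)\<^sup>2) * (cmod (1 - cnj \<sigma> * F z))\<^sup>2 \<le> (1 - (cmod (F z))\<^sup>2) * (cmod (1 - cnj \<sigma> * z))\<^sup>2"
      by simp
  qed
qed

text \<open>Two triangle inequalities. The constant is the exponential of twice the hyperbolic
  distance \<open>artanh \<rho>\<close>.\<close>

lemma norm_le_of_pseudo_dist:
  fixes a b :: complex
  assumes "cmod (a - b) \<le> \<rho> * cmod (a + cnj b)" "0 \<le> \<rho>" "\<rho> < 1"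
  shows "cmod a \<le> (1 + \<rho>) / (1 - \<rho>) * cmod b"
proof -
  have "cmod a \<le> cmod (a - b) + cmod b"
    using norm_triangle_sub[of a b] by linarith
  also have "\<dots> \<le> \<rho> * (cmod a + cmod b) + cmod b"
    using assms(1) mult_left_mono[OF norm_triangle_ineq[of a "cnj b"] assms(2)] by simp
  finally have "cmod a * (1 - \<rho>) \<le> (1 + \<rho>) * cmod b"
    by (simp add: algebra_simps)
  then show ?thesis
    using assms(3) by (simp add: pos_le_divide_eq)
qed

text \<open>
  If no dilation factor \<open>\<mu> > 1\<close> exists at infinity, then \<open>F t - t = o(t)\<close> along the positive
  axis by a quantitative form of the Julia--Wolff--Caratheodory theorem, so that points far out on
  the axis are hardly moved in the hyperbolic metric.
\<close>

lemma subexponential_growth: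
  assumes F: "F holomorphic_on halfplane" and Re_F: "\<And>w. w \<in> halfplane \<Longrightarrow> Re w \<le> Re (F w)"
    and inf: "\<And>\<epsilon>. \<epsilon> > 0 \<Longrightarrow> \<exists>w\<in>halfplane. Re (F w) < (1 + \<epsilon>) * Re w"
    and \<kappa>: "\<kappa> > 1" and w: "w \<in> halfplane"
  obtains C where "C > 0" "\<And>n. cmod ((F ^^ n) w) \<le> C * \<kappa> ^ n"
proof -
  have Fh: "F ` halfplane \<subseteq> halfplane"
    using Re_F by (force simp: halfplane_def)
  \<comment> \<open>Pseudohyperbolic steps of length at most \<open>\<rho>\<close> multiply norms by
    at most \<open>\<kappa>\<close>. The choice \<open>\<epsilon> = \<rho> / 8\<close> below turns
    the displacement bound \<open>16 * \<epsilon> * t\<close>, divided by \<open>2 * t\<close>, into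
    \<open>\<rho>\<close>.\<close>
  define \<rho> where "\<rho> = (\<kappa> - 1) / (\<kappa> + 1)"
  have \<rho>: "0 < \<rho>" "\<rho> < 1"
    using \<kappa> by (simp_all add: \<rho>_def)
  have \<kappa>_eq: "(1 + \<rho>) / (1 - \<rho>) = \<kappa>"
    using \<kappa> by (simp add: \<rho>_def field_simps)
  define \<epsilon> where "\<epsilon> = \<rho> / 8"
  have \<epsilon>: "\<epsilon> > 0"
    using \<rho> by (simp add: \<epsilon>_def)
  obtain w1 where w1: "w1 \<in> halfplane" "Re (F w1) < (1 + \<epsilon>) * Re w1"
    using inf[OF \<epsilon>] by blast
  define q where "q = (\<lambda>w. F w - w)"
  have q: "q holomorphic_on halfplane" "\<And>w. w \<in> halfplane \<Longrightarrow> 0 \<le> Re (q w)"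
    unfolding q_def using F Re_F by (auto intro!: holomorphic_intros)
  \<comment> \<open>So far out on the axis that \<open>w1\<close> has norm at most \<open>t\<close>
    and \<open>q w1\<close> has norm at most \<open>\<epsilon> * t\<close>.\<close>
  define t where "t = Max {1, cmod w1, cmod (q w1) / \<epsilon>}"
  have t: "1 \<le> t" "cmod w1 \<le> t" "cmod (q w1) / \<epsilon> \<le> t"
    unfolding t_def by (auto intro: Max_ge)
  define T where "T = complex_of_real t"
  have T: "T \<in> halfplane" "Re T = t" "cmod T = t"
    using t by (auto simp: T_def halfplane_def)
  have qT: "cmod (q T) \<le> 16 * \<epsilon> * t"
  proof (cases "cmod (q T) \<le> 2 * cmod (q w1)")
    case True
    have "cmod (q w1) \<le> t * \<epsilon>"
      using t(3) \<epsilon> by (simp add: pos_divide_le_eq)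
    moreover have "0 \<le> t * \<epsilon>"
      using t(1) \<epsilon> by simp
    ultimately have "cmod (q T) \<le> 16 * (t * \<epsilon>)"
      using True by linarith
    then show ?thesis
      by (simp add: mult_ac)
  next
    \<comment> \<open>Here \<open>q T - q w1\<close> has at least half the size of
      \<open>q T\<close>. Schwarz-Pick for \<open>q\<close> is then quadratic in
      \<open>cmod (q T)\<close> on the left and linear on the right, which bounds
      \<open>q T\<close>.\<close>
    case False
    have Rew1: "0 < Re w1"
      using w1(1) by (simp add: halfplane_def)
    have "cmod (q T) / 2 \<le> cmod (q T - q w1)"
      using False norm_triangle_ineq2[of "q T" "q w1"] by linarith
    then have "(cmod (q T) / 2)\<^sup>2 * (t * Re w1) \<le> (cmod (q T - q w1))\<^sup>2 * (t * Re w1)"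
      using t(1) Rew1 by (intro mult_right_mono power_mono) auto
    also have "\<dots> \<le> (cmod (T - w1))\<^sup>2 * (Re (q T) * Re (q w1))"
      using Schwarz_Pick_halfplane_closed[OF q T(1) w1(1)] T(2) by simp
    also have "\<dots> \<le> (2 * t)\<^sup>2 * (cmod (q T) * (\<epsilon> * Re w1))"
    proof (intro mult_mono power_mono)
      show "cmod (T - w1) \<le> 2 * t"
        using norm_triangle_ineq4[of T w1] T(3) t(2) by linarith
      show "Re (q T) \<le> cmod (q T)"
        by (rule complex_Re_le_cmod)
      show "Re (q w1) \<le> \<epsilon> * Re w1"
        using w1(2) by (simp add: q_def algebra_simps)
    qed (use q(2) T(1) w1(1) t(1) in auto)
    finally have "(cmod (q T) * (t * Re w1)) * cmod (q T) \<le> (cmod (q T) * (t * Re w1)) * (16 * \<epsilon> * t)"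
      by (simp add: power2_eq_square algebra_simps)
    moreover have "0 < cmod (q T) * (t * Re w1)"
      using False t(1) Rew1 norm_ge_zero[of "q w1"] by (intro mult_pos_pos) linarith+
    ultimately show ?thesis
      by (simp only: mult_le_cancel_left_pos)
  qed
  note it = funpow_halfplane[OF F Fh]
  define a where "a = (\<lambda>n. (F ^^ n) T)"
  \<comment> \<open>By Schwarz-Pick no later step of the orbit of \<open>T\<close> is hyperbolically
    longer than the first, whose pseudohyperbolic length is at most \<open>\<rho>\<close>.\<close>
  have step: "cmod (a (Suc n)) \<le> \<kappa> * cmod (a n)" for n
  proof -
    have FT: "F T \<in> halfplane"
      using Fh T(1) by auto
    have "cmod ((F ^^ n) (F T) - (F ^^ n) T) * cmod (F T + cnj T)
        \<le> cmod (F T - T) * cmod ((F ^^ n) (F T) + cnj ((F ^^ n) T))"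
      using it by (intro Schwarz_Pick_halfplane FT T(1)) auto
    also have "(F ^^ n) (F T) = a (Suc n)"
      by (simp add: a_def funpow_swap1)
    finally have "cmod (a (Suc n) - a n) * cmod (F T + cnj T) \<le> cmod (q T) * cmod (a (Suc n) + cnj (a n))"
      by (simp add: a_def q_def)
    also have "\<dots> \<le> 16 * \<epsilon> * t * cmod (a (Suc n) + cnj (a n))"
      by (intro mult_right_mono qT) simp
    finally have "cmod (a (Suc n) - a n) * cmod (F T + cnj T) \<le> 16 * \<epsilon> * t * cmod (a (Suc n) + cnj (a n))" .
    moreover have "2 * t \<le> cmod (F T + cnj T)"
      using Re_F[OF T(1)] T(2) complex_Re_le_cmod[of "F T + cnj T"] by simp
    then have "cmod (a (Suc n) - a n) * (2 * t) \<le> cmod (a (Suc n) - a n) * cmod (F T + cnj T)"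
      by (intro mult_left_mono) auto
    ultimately have "(2 * t) * cmod (a (Suc n) - a n) \<le> (2 * t) * (\<rho> * cmod (a (Suc n) + cnj (a n)))"
      by (simp add: \<epsilon>_def algebra_simps)
    then have "cmod (a (Suc n) - a n) \<le> \<rho> * cmod (a (Suc n) + cnj (a n))"
      using t(1) by (simp only: mult_le_cancel_left_pos)
    then show ?thesis
      using norm_le_of_pseudo_dist \<rho> \<kappa>_eq by (metis less_imp_le)
  qed
  have an: "cmod (a n) \<le> t * \<kappa> ^ n" for n
  proof (induction n)
    case (Suc n)
    have "cmod (a (Suc n)) \<le> \<kappa> * (t * \<kappa> ^ n)"
      using step[of n] mult_left_mono[OF Suc, of \<kappa>] \<kappa> by linarith
    then show ?case
      by (simp add: mult_ac)
  qed (use T in \<open>simp add: a_def\<close>)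
  \<comment> \<open>The orbit of \<open>w\<close> stays within a fixed hyperbolic distance of that
    of \<open>T\<close>, so its norms are larger by at most a constant factor.\<close>
  define \<rho>' where "\<rho>' = cmod (w - T) / cmod (w + cnj T)"
  have \<rho>': "0 \<le> \<rho>'" "\<rho>' < 1"
    using cmod_diff_less_add_cnj[OF w T(1)] by (auto simp: \<rho>'_def divide_less_eq)
  have wn: "cmod ((F ^^ n) w) \<le> (1 + \<rho>') / (1 - \<rho>') * cmod (a n)" for n
  proof (rule norm_le_of_pseudo_dist[OF _ \<rho>'])
    have "cmod ((F ^^ n) w - a n) * cmod (w + cnj T) \<le> cmod (w - T) * cmod ((F ^^ n) w + cnj (a n))"
      unfolding a_def using it by (intro Schwarz_Pick_halfplane w T(1)) auto
    then show "cmod ((F ^^ n) w - a n) \<le> \<rho>' * cmod ((F ^^ n) w + cnj (a n))"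
      using add_cnj_nonzero[OF w T(1)] by (simp add: \<rho>'_def field_simps)
  qed
  define C where "C = (1 + \<rho>') / (1 - \<rho>') * t"
  have c: "(1 + \<rho>') / (1 - \<rho>') > 0"
    using \<rho>' by simp
  show ?thesis
  proof (rule that[of C])
    show "C > 0"
      unfolding C_def using c t(1) by (intro mult_pos_pos) auto
    show "cmod ((F ^^ n) w) \<le> C * \<kappa> ^ n" for n
      using wn[of n] mult_left_mono[OF an[of n] less_imp_le[OF c]] by (simp add: C_def mult.assoc)
  qed
qed

text \<open>In one step the imaginary part changes by at most \<open>L\<close> times the current
  real part, while the real part grows by the factor \<open>\<mu>\<close>. The cone condition thus
  persists once \<open>B + L \<le> \<mu> * B\<close>. Extrema over \<open>K\<close> make all
  constants uniform.\<close>

lemma orbits_nontangential: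
  assumes F: "F holomorphic_on halfplane" and \<mu>: "\<mu> > 1"
    and Re_F: "\<And>w. w \<in> halfplane \<Longrightarrow> \<mu> * Re w \<le> Re (F w)"
    and K: "compact K" "K \<subseteq> halfplane" "K \<noteq> {}"
  obtains B c where "0 \<le> B" "c > 0"
    "\<And>w n. w \<in> K \<Longrightarrow> \<bar>Im ((F ^^ n) w)\<bar> \<le> B * Re ((F ^^ n) w)"
    "\<And>w n. w \<in> K \<Longrightarrow> c * \<mu> ^ n \<le> Re ((F ^^ n) w)"
proof -
  have Fh: "F ` halfplane \<subseteq> halfplane"
  proof
    fix y assume "y \<in> F ` halfplane"
    then obtain x where x: "x \<in> halfplane" "y = F x"
      by auto
    have "0 < \<mu> * Re x"
      using x(1) \<mu> by (simp add: halfplane_def)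
    then show "y \<in> halfplane"
      using Re_F[OF x(1)] x(2) by (simp add: halfplane_def)
  qed
  note it = funpow_halfplane[OF F Fh]
  have contF: "continuous_on K F"
    using holomorphic_on_imp_continuous_on[OF F] K(2) by (rule continuous_on_subset)
  have ReK: "0 < Re w" if "w \<in> K" for w
    using K(2) that by (auto simp: halfplane_def)
  obtain wm where wm: "wm \<in> K" "\<And>w. w \<in> K \<Longrightarrow> Re wm \<le> Re w"
  proof -
    have "continuous_on K Re"
      using continuous_on_Re[OF continuous_on_id] by simp
    then show ?thesis
      using continuous_attains_inf[OF K(1,3)] that by blast
  qed
  have cont1: "continuous_on K (\<lambda>w. \<bar>Im w\<bar> / Re w)"
    using ReK by (intro continuous_intros) (auto simp: less_le)
  obtain wy where wy: "wy \<in> K" "\<And>w. w \<in> K \<Longrightarrow> \<bar>Im w\<bar> / Re w \<le> \<bar>Im wy\<bar> / Re wy"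
    using continuous_attains_sup[OF K(1,3) cont1] by auto
  have "F w + cnj w \<noteq> 0" if "w \<in> K" for w
    using that K(2) Fh by (intro add_cnj_nonzero) auto
  then have cont2: "continuous_on K (\<lambda>w. cmod (F w - w) / cmod (F w + cnj w))"
    by (intro continuous_intros contF) auto
  obtain wr where wr: "wr \<in> K" "\<And>w. w \<in> K \<Longrightarrow>
      cmod (F w - w) / cmod (F w + cnj w) \<le> cmod (F wr - wr) / cmod (F wr + cnj wr)"
    using continuous_attains_sup[OF K(1,3) cont2] by auto
  define \<rho> where "\<rho> = cmod (F wr - wr) / cmod (F wr + cnj wr)"
  have \<rho>: "0 \<le> \<rho>" "\<rho> < 1"
    using cmod_diff_less_add_cnj[of "F wr" wr] wr(1) K(2) Fh by (auto simp: \<rho>_def divide_less_eq)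
  \<comment> \<open>Comes from solving \<open>x \<le> \<rho> * (x + 2 * a)\<close> for the step
    length \<open>x\<close> in terms of the real part \<open>a\<close>.\<close>
  define L where "L = 2 * \<rho> / (1 - \<rho>)"
  \<comment> \<open>The first entry starts the induction; the second gives
    \<open>B + L \<le> \<mu> * B\<close>.\<close>
  define B where "B = max (\<bar>Im wy\<bar> / Re wy) (L / (\<mu> - 1))"
  have L: "0 \<le> L"
    using \<rho> by (simp add: L_def)
  have B: "0 \<le> B" "\<bar>Im wy\<bar> / Re wy \<le> B" "L / (\<mu> - 1) \<le> B"
    using ReK[OF wy(1)] by (auto simp: B_def le_max_iff_disj)
  have BL: "B + L \<le> \<mu> * B"
    using B(3) \<mu> by (simp add: pos_divide_le_eq algebra_simps)
  have inh: "(F ^^ n) w \<in> halfplane" if "w \<in> K" for w n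
    using it that K(2) by blast
  have step: "cmod ((F ^^ Suc n) w - (F ^^ n) w) \<le> L * Re ((F ^^ n) w)" if w: "w \<in> K" for w n
  proof -
    let ?a = "(F ^^ n) w" and ?b = "(F ^^ Suc n) w"
    have wh: "w \<in> halfplane" "F w \<in> halfplane"
      using w K(2) Fh by auto
    have "cmod ((F ^^ n) (F w) - (F ^^ n) w) * cmod (F w + cnj w)
        \<le> cmod (F w - w) * cmod ((F ^^ n) (F w) + cnj ((F ^^ n) w))"
      using it by (intro Schwarz_Pick_halfplane wh) auto
    then have "cmod (?b - ?a) \<le> cmod (F w - w) / cmod (F w + cnj w) * cmod (?b + cnj ?a)"
      using add_cnj_nonzero[OF wh(2,1)] by (simp add: field_simps funpow_swap1)
    also have "\<dots> \<le> \<rho> * cmod (?b + cnj ?a)"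
      unfolding \<rho>_def by (intro mult_right_mono wr(2) w) simp
    also have "\<dots> \<le> \<rho> * (cmod (?b - ?a) + 2 * Re ?a)"
    proof (intro mult_left_mono \<rho>)
      have "?b + cnj ?a = (?b - ?a) + of_real (2 * Re ?a)"
        by (simp add: complex_eq_iff)
      then show "cmod (?b + cnj ?a) \<le> cmod (?b - ?a) + 2 * Re ?a"
        using norm_triangle_ineq[of "?b - ?a" "of_real (2 * Re ?a)"] inh[OF w, of n]
        by (simp only: norm_of_real) (simp add: halfplane_def)
    qed
    finally have "cmod (?b - ?a) * (1 - \<rho>) \<le> 2 * \<rho> * Re ?a"
      by (simp add: algebra_simps)
    then show ?thesis
      using \<rho> by (simp add: L_def pos_le_divide_eq)
  qed
  show ?thesis
  proof (rule that[OF B(1) ReK[OF wm(1)]])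
    fix w n assume w: "w \<in> K"
    show "Re wm * \<mu> ^ n \<le> Re ((F ^^ n) w)"
    proof (induction n)
      case (Suc n)
      have "Re wm * \<mu> ^ Suc n = \<mu> * (Re wm * \<mu> ^ n)"
        by simp
      also have "\<dots> \<le> \<mu> * Re ((F ^^ n) w)"
        using Suc \<mu> by (intro mult_left_mono) auto
      also have "\<dots> \<le> Re ((F ^^ Suc n) w)"
        using Re_F[OF inh[OF w]] by simp
      finally show ?case .
    qed (use wm w in simp)
    show "\<bar>Im ((F ^^ n) w)\<bar> \<le> B * Re ((F ^^ n) w)"
    proof (induction n)
      case 0
      have "\<bar>Im w\<bar> / Re w \<le> B"
        using wy(2)[OF w] B(2) by linarith
      then show ?case
        using ReK[OF w] by (simp add: pos_divide_le_eq)
    next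
      case (Suc n)
      let ?a = "(F ^^ n) w" and ?b = "(F ^^ Suc n) w"
      have "\<bar>Im ?b\<bar> \<le> \<bar>Im ?a\<bar> + cmod (?b - ?a)"
        using abs_Im_le_cmod[of "?b - ?a"] unfolding minus_complex.sel by linarith
      also have "\<dots> \<le> B * Re ?a + L * Re ?a"
        using Suc step[OF w, of n] by linarith
      also have "\<dots> = (B + L) * Re ?a"
        by (simp add: algebra_simps)
      also have "\<dots> \<le> (\<mu> * B) * Re ?a"
        using inh[OF w, of n] by (intro mult_right_mono BL) (simp add: halfplane_def)
      also have "\<dots> = B * (\<mu> * Re ?a)"
        by simp
      also have "\<dots> \<le> B * Re ?b"
        using Re_F[OF inh[OF w, of n]] by (intro mult_left_mono B) simp
      finally show ?case .
    qed
  qed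
qed

section \<open>Hyperbolic distance and divergence rate in half-plane coordinates\<close>

lemma hyperbolic_dist_halfplane:
  assumes \<phi>: "riemann_map \<Omega> \<phi>" and \<Omega>: "open \<Omega>" and z: "z \<in> \<Omega>" and w: "w \<in> \<Omega>"
  shows "hyperbolic_dist \<Omega> z w =
    artanh (cmod (cayley_inv (\<phi> z) - cayley_inv (\<phi> w)) / cmod (cayley_inv (\<phi> z) + cnj (cayley_inv (\<phi> w))))"
proof -
  have b: "\<phi> z \<in> ball 0 1" "\<phi> w \<in> ball 0 1"
    using \<phi> z w by (auto simp: riemann_map_def bij_betw_def)
  then show ?thesis
    using cmod_Moebius_cayley[OF b[THEN cayley_inv_in_halfplane]]
    unfolding hyperbolic_dist_eq[OF \<phi> \<Omega> z w] poincare_dist_def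
    by (simp only: cayley_cayley_inv)
qed

text \<open>Since \<open>(1 + \<rho>) / (1 - \<rho>)\<close> equals
  \<open>(1 + \<rho>)^2 / (1 - \<rho>^2)\<close>, the identity for \<open>cmod (u + cnj v)\<close>
  bounds it by a square, whose exponent the 1/2 in \<open>artanh\<close> removes. Thus norm growth
  controls hyperbolic distance through a logarithm.\<close>

lemma artanh_pseudo_dist_le:
  assumes u: "u \<in> halfplane" and v: "v \<in> halfplane" and le: "Re v \<le> Re u"
  shows "0 \<le> artanh (cmod (u - v) / cmod (u + cnj v))"
    and "artanh (cmod (u - v) / cmod (u + cnj v)) \<le> ln ((cmod u + cmod v) / Re v)"
proof -
  define \<rho> where "\<rho> = cmod (u - v) / cmod (u + cnj v)"
  have ne: "cmod (u + cnj v) > 0"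
    using add_cnj_nonzero[OF u v] by simp
  have pos: "0 < Re u" "0 < Re v"
    using u v by (auto simp: halfplane_def)
  have \<rho>: "0 \<le> \<rho>" "\<rho> < 1"
    using cmod_diff_less_add_cnj[OF u v] ne by (auto simp: \<rho>_def divide_less_eq)
  have a: "artanh \<rho> = ln ((1 + \<rho>) / (1 - \<rho>)) / 2"
    by (simp add: artanh_def)
  have "1 \<le> (1 + \<rho>) / (1 - \<rho>)"
    using \<rho> by (simp add: le_divide_eq)
  then show "0 \<le> artanh (cmod (u - v) / cmod (u + cnj v))"
    unfolding \<rho>_def[symmetric] a by simp
  have q: "1 - \<rho>\<^sup>2 = 4 * (Re u * Re v) / (cmod (u + cnj v))\<^sup>2"
  proof -
    have "1 - \<rho>\<^sup>2 = ((cmod (u + cnj v))\<^sup>2 - (cmod (u - v))\<^sup>2) / (cmod (u + cnj v))\<^sup>2"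
      using ne by (simp add: \<rho>_def power_divide diff_divide_distrib)
    then show ?thesis
      by (simp add: cmod_add_cnj_squared)
  qed
  define S where "S = (cmod u + cmod v) / Re v"
  have S: "S > 0"
    unfolding S_def using pos complex_Re_le_cmod[of u] norm_ge_zero[of v]
    by (intro divide_pos_pos) linarith+
  have uv: "cmod (u + cnj v) \<le> cmod u + cmod v"
    using norm_triangle_ineq[of u "cnj v"] by simp
  have "(1 + \<rho>) / (1 - \<rho>) = (1 + \<rho>)\<^sup>2 / (1 - \<rho>\<^sup>2)"
  proof -
    have "1 - \<rho>\<^sup>2 = (1 - \<rho>) * (1 + \<rho>)"
      by (simp add: power2_eq_square algebra_simps)
    then show ?thesis
      using \<rho> by (simp add: power2_eq_square)
  qed
  also have "\<dots> \<le> 4 / (1 - \<rho>\<^sup>2)"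
    using \<rho> power_mono[of "1 + \<rho>" 2 2] by (intro divide_right_mono) (auto simp: abs_square_le_1)
  also have "\<dots> = (cmod (u + cnj v))\<^sup>2 / (Re u * Re v)"
    using ne pos by (simp add: q)
  also have "\<dots> \<le> (cmod u + cmod v)\<^sup>2 / (Re v * Re v)"
    using pos uv le by (intro frac_le power_mono mult_mono) auto
  also have "\<dots> = S\<^sup>2"
    by (simp add: S_def power_divide power2_eq_square)
  finally have "ln ((1 + \<rho>) / (1 - \<rho>)) \<le> ln (S\<^sup>2)"
    using \<rho> by (intro ln_mono) auto
  also have "ln (S\<^sup>2) = 2 * ln S"
    using S by (simp add: ln_realpow)
  finally show "artanh (cmod (u - v) / cmod (u + cnj v)) \<le> ln ((cmod u + cmod v) / Re v)"
    unfolding \<rho>_def[symmetric] a S_def by simp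
qed

text \<open>Norm growth at rate \<open>exp (e/2)\<close> bounds the distance by a constant plus
  \<open>n * e / 2\<close>. Since \<open>e\<close> is arbitrary, the quotients tend to 0.\<close>

lemma divergence_rate_zero:
  assumes \<Omega>: "open \<Omega>" "\<Omega> \<noteq> {}" and \<phi>: "riemann_map \<Omega> \<phi>" and f: "f ` \<Omega> \<subseteq> \<Omega>"
    and F: "F holomorphic_on halfplane" and Re_F: "\<And>w. w \<in> halfplane \<Longrightarrow> Re w \<le> Re (F w)"
    and inf: "\<And>\<epsilon>. \<epsilon> > 0 \<Longrightarrow> \<exists>w\<in>halfplane. Re (F w) < (1 + \<epsilon>) * Re w"
    and conj: "\<And>n z. z \<in> \<Omega> \<Longrightarrow> cayley_inv (\<phi> ((f ^^ n) z)) = (F ^^ n) (cayley_inv (\<phi> z))"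
  shows "divergence_rate \<Omega> f = 0"
proof -
  have \<phi>h: "cayley_inv (\<phi> z) \<in> halfplane" if "z \<in> \<Omega>" for z
    using \<phi> that by (intro cayley_inv_in_halfplane) (auto simp: riemann_map_def bij_betw_def)
  have fn: "(f ^^ n) z \<in> \<Omega>" if "z \<in> \<Omega>" for n z
    using f that by (induction n) auto
  have lim: "(\<lambda>n. hyperbolic_dist \<Omega> ((f ^^ n) z0) z0 / real n) \<longlonglongrightarrow> 0" if z0: "z0 \<in> \<Omega>" for z0
  proof (rule LIMSEQ_I)
    fix e :: real assume e: "e > 0"
    define \<kappa> where "\<kappa> = exp (e/2)"
    have \<kappa>: "\<kappa> > 1"
      using e by (simp add: \<kappa>_def)
    define w where "w = cayley_inv (\<phi> z0)"
    have w: "w \<in> halfplane"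
      unfolding w_def by (rule \<phi>h[OF z0])
    have pos: "0 < Re w"
      using w by (simp add: halfplane_def)
    show "\<exists>N. \<forall>n\<ge>N. norm (hyperbolic_dist \<Omega> ((f ^^ n) z0) z0 / real n - 0) < e"
    proof (rule subexponential_growth[OF F Re_F inf \<kappa> w])
      fix C assume C: "C > 0" "\<And>n. cmod ((F ^^ n) w) \<le> C * \<kappa> ^ n"
      define A where "A = ln ((C + cmod w) / Re w)"
      have b: "0 \<le> hyperbolic_dist \<Omega> ((f ^^ n) z0) z0 \<and>
          hyperbolic_dist \<Omega> ((f ^^ n) z0) z0 \<le> A + real n * (e/2)" for n
      proof -
        let ?u = "(F ^^ n) w"
        have u: "?u \<in> halfplane"
          using \<phi>h[OF fn[OF z0, of n]] conj[OF z0, of n] by (simp add: w_def)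
        have le: "Re w \<le> Re ?u"
        proof (induction n)
          case (Suc n)
          have "(F ^^ n) w \<in> halfplane"
            using \<phi>h[OF fn[OF z0, of n]] conj[OF z0, of n] by (simp add: w_def)
          then show ?case
            using Suc Re_F[of "(F ^^ n) w"] by simp
        qed simp
        have d: "hyperbolic_dist \<Omega> ((f ^^ n) z0) z0 = artanh (cmod (?u - w) / cmod (?u + cnj w))"
          using hyperbolic_dist_halfplane[OF \<phi> \<Omega>(1) fn[OF z0] z0, of n] conj[OF z0, of n]
          by (simp add: w_def)
        have "cmod ?u + cmod w \<le> (C + cmod w) * \<kappa> ^ n"
          using C(2)[of n] mult_left_mono[OF one_le_power[of \<kappa> n] norm_ge_zero[of w]] \<kappa>
          by (simp add: algebra_simps)
        then have "ln ((cmod ?u + cmod w) / Re w) \<le> ln ((C + cmod w) / Re w * \<kappa> ^ n)"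
          using pos complex_Re_le_cmod[of w]
          by (intro ln_mono) (auto simp: divide_right_mono intro!: divide_pos_pos add_nonneg_pos)
        also have "\<dots> = A + ln (\<kappa> ^ n)"
          unfolding A_def using pos C(1) \<kappa>
          by (intro ln_mult_pos divide_pos_pos add_pos_nonneg zero_less_power) auto
        also have "ln (\<kappa> ^ n) = real n * (e/2)"
          using \<kappa> by (simp add: ln_realpow) (simp add: \<kappa>_def)
        finally show ?thesis
          unfolding d using artanh_pseudo_dist_le[OF u w le] by linarith
      qed
      obtain N :: nat where N: "2 * \<bar>A\<bar> / e < real N"
        using reals_Archimedean2 by blast
      have "norm (hyperbolic_dist \<Omega> ((f ^^ n) z0) z0 / real n - 0) < e" if n: "n \<ge> Suc N" for n
      proof -
        have "2 * \<bar>A\<bar> < e * real n"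
          using N n e by (simp add: divide_less_eq) (smt (verit, best) mult_less_cancel_left_pos
              of_nat_Suc of_nat_le_iff mult.commute)
        then have "A + real n * (e/2) < e * real n"
          by (simp add: field_simps)
        then have "hyperbolic_dist \<Omega> ((f ^^ n) z0) z0 < e * real n"
          using b[of n] by linarith
        then show ?thesis
          using b[of n] n by (simp add: divide_less_eq)
      qed
      then show ?thesis
        by blast
    qed
  qed
  \<comment> \<open>Uniqueness of the described limit rests on the existence of a base
    point.\<close>
  obtain z1 where z1: "z1 \<in> \<Omega>"
    using \<Omega>(2) by blast
  show ?thesis
    unfolding divergence_rate_def
  proof (rule the_equality)
    show "\<forall>z0\<in>\<Omega>. (\<lambda>n. hyperbolic_dist \<Omega> ((f ^^ n) z0) z0 / real n) \<longlonglongrightarrow> 0"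
      using lim by blast
    fix c assume "\<forall>z0\<in>\<Omega>. (\<lambda>n. hyperbolic_dist \<Omega> ((f ^^ n) z0) z0 / real n) \<longlonglongrightarrow> c"
    then show "c = 0"
      using LIMSEQ_unique lim z1 by blast
  qed
qed

section \<open>The exponential map between strip and half-plane\<close>

lemma exp_strip: "exp ` strip = halfplane" and inj_on_exp_strip: "inj_on exp strip"
  and Ln_strip: "w \<in> halfplane \<Longrightarrow> Ln w \<in> strip \<and> exp (Ln w) = w"
proof -
  have Ln: "Ln w \<in> strip \<and> exp (Ln w) = w" if "w \<in> halfplane" for w
  proof -
    have "w \<noteq> 0" "0 < Re w"
      using that by (auto simp: halfplane_def)
    then show ?thesis
      using Re_Ln_pos_lt[of w] by (simp add: strip_def)
  qed
  then show "w \<in> halfplane \<Longrightarrow> Ln w \<in> strip \<and> exp (Ln w) = w" .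
  have "exp z \<in> halfplane" if "z \<in> strip" for z
  proof -
    have "0 < cos (Im z)"
      using that by (intro cos_gt_zero_pi) (auto simp: strip_def)
    then show ?thesis
      by (simp add: halfplane_def Re_exp)
  qed
  then show "exp ` strip = halfplane"
    using Ln by (force intro: image_eqI)
  have "Ln (exp z) = z" if "z \<in> strip" for z
    using that by (intro Ln_exp) (auto simp: strip_def)
  then show "inj_on exp strip"
    by (rule inj_on_inverseI)
qed

text \<open>\<open>Im (Ln w)\<close> is the argument of \<open>w\<close>. The cone condition gives
  \<open>cmod w \<le> (1 + B) * Re w\<close>, so the cosine of the argument is at least
  \<open>1 / (1 + B)\<close>, whose arccosine is \<open>\<theta>\<close>.\<close>

lemma Stolz_angle_Ln:
  assumes "0 \<le> B"
  obtains \<theta> where "\<theta> < pi/2" "\<And>w. w \<in> halfplane \<Longrightarrow> \<bar>Im w\<bar> \<le> B * Re w \<Longrightarrow> \<bar>Im (Ln w)\<bar> \<le> \<theta>"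
proof -
  define \<theta> where "\<theta> = arccos (1 / (1 + B))"
  have B: "0 < 1 / (1 + B)" "1 / (1 + B) \<le> 1" "-1 \<le> 1 / (1 + B)"
    using assms by (auto simp: divide_simps)
  have cos: "cos \<theta> = 1 / (1 + B)" and \<theta>: "0 \<le> \<theta>" "\<theta> \<le> pi"
    unfolding \<theta>_def using B by (auto intro: cos_arccos arccos_lbound arccos_ubound)
  show ?thesis
  proof (rule that)
    have "cos (pi/2) < cos \<theta>"
      using B(1) by (simp add: cos)
    then show "\<theta> < pi/2"
      using \<theta> cos_mono_less_eq[of "pi/2" \<theta>] by simp
    fix w assume w: "w \<in> halfplane" "\<bar>Im w\<bar> \<le> B * Re w"
    have e: "exp (Ln w) = w" and s: "\<bar>Im (Ln w)\<bar> < pi/2"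
      using Ln_strip[OF w(1)] by (auto simp: strip_def)
    have "Re w = cmod w * cos \<bar>Im (Ln w)\<bar>"
      using arg_cong[OF e, of Re] arg_cong[OF e, of cmod] by (simp add: Re_exp)
    moreover have "cmod w \<le> (1 + B) * Re w"
      using cmod_le[of w] w by (simp add: halfplane_def algebra_simps)
    ultimately have "cmod w * 1 \<le> cmod w * ((1 + B) * cos \<bar>Im (Ln w)\<bar>)"
      by (simp add: mult_ac)
    moreover have "0 < cmod w"
      using w(1) by (auto simp: halfplane_def)
    ultimately have "1 \<le> (1 + B) * cos \<bar>Im (Ln w)\<bar>"
      by (simp only: mult_le_cancel_left_pos)
    then have "cos \<theta> \<le> cos \<bar>Im (Ln w)\<bar>"
      using assms by (simp add: cos divide_le_eq mult.commute)
    then show "\<bar>Im (Ln w)\<bar> \<le> \<theta>"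
      using \<theta> s by (subst (asm) cos_mono_le_eq) auto
  qed
qed

section \<open>Passage from \<Omega> to the half-plane and the strip, and back\<close>

theorem corollary5p7:
  fixes \<Omega> :: "complex set"
  assumes "open \<Omega>" and "\<Omega> \<noteq> {}" and "simply_connected \<Omega>" and "\<Omega> \<noteq> UNIV"
    and "\<forall>\<xi>\<in>prime_ends \<Omega>. \<exists>p. principal_part \<xi> = {p}"
  shows "\<forall>f\<in>Hol_d \<Omega>. hyperbolic \<Omega> f \<longrightarrow> has_Denjoy_Wolff_point \<Omega> f"
proof (intro ballI impI)
  fix f assume fd: "f \<in> Hol_d \<Omega>" and hyp: "hyperbolic \<Omega> f"
  have f: "f holomorphic_on \<Omega>" "f ` \<Omega> \<subseteq> \<Omega>" "\<And>z. z \<in> \<Omega> \<Longrightarrow> f z \<noteq> z"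
    using fd by (auto simp: Hol_d_def)
  obtain \<phi>0 where \<phi>0: "riemann_map \<Omega> \<phi>0"
    using riemann_map_exists[OF assms(1,3,2,4)] by blast
  have \<phi>0': "\<phi>0 holomorphic_on \<Omega>" "inj_on \<phi>0 \<Omega>" "\<phi>0 ` \<Omega> = ball 0 1"
    using \<phi>0 by (auto simp: riemann_map_def bij_betw_def)
  obtain g0 where g0: "g0 holomorphic_on ball 0 1" "\<And>z. z \<in> \<Omega> \<Longrightarrow> g0 (\<phi>0 z) = z"
    using holomorphic_has_inverse[OF \<phi>0'(1) assms(1) \<phi>0'(2)] \<phi>0'(3) by metis
  have g0\<Omega>: "g0 ` ball 0 1 = \<Omega>"
    unfolding \<phi>0'(3)[symmetric] using g0(2) by force
  have \<phi>0g0: "\<phi>0 (g0 x) = x" if "x \<in> ball 0 1" for x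
    using that g0(2) unfolding \<phi>0'(3)[symmetric] by auto
  define F0 where "F0 = \<phi>0 \<circ> (f \<circ> g0)"
  have F0: "F0 holomorphic_on ball 0 1"
    unfolding F0_def using g0\<Omega> f(2)
    by (intro holomorphic_on_compose_gen[OF _ \<phi>0'(1)] holomorphic_on_compose_gen[OF g0(1) f(1)]) auto
  have F0b: "F0 ` ball 0 1 \<subseteq> ball 0 1"
    using g0\<Omega> f(2) \<phi>0'(3) by (fastforce simp: F0_def)
  have F0fix: "F0 x \<noteq> x" if "x \<in> ball 0 1" for x
  proof
    assume eq: "F0 x = x"
    have gx: "g0 x \<in> \<Omega>" "f (g0 x) \<in> \<Omega>"
      using that g0\<Omega> f(2) by auto
    have "f (g0 x) = g0 (\<phi>0 (f (g0 x)))"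
      using g0(2)[OF gx(2)] by simp
    also have "\<dots> = g0 x"
      using eq by (simp add: F0_def)
    finally show False
      using f(3)[OF gx(1)] by simp
  qed
  obtain \<sigma> where \<sigma>: "cmod \<sigma> = 1"
    and wolff: "\<And>x. x \<in> ball 0 1 \<Longrightarrow> (1 - (cmod x)\<^sup>2) * (cmod (1 - cnj \<sigma> * F0 x))\<^sup>2
        \<le> (1 - (cmod (F0 x))\<^sup>2) * (cmod (1 - cnj \<sigma> * x))\<^sup>2"
    using Wolff_lemma[OF F0 F0b F0fix] by blast
  have \<sigma>\<sigma>: "\<sigma> * cnj \<sigma> = 1" "cnj \<sigma> * \<sigma> = 1"
    using \<sigma> complex_norm_square[of \<sigma>] by (simp_all add: mult.commute)
  \<comment> \<open>The rotation moves Wolff's point \<open>\<sigma>\<close> to 1, which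
    \<open>cayley_inv\<close> places at infinity.\<close>
  define \<phi> where "\<phi> = (\<lambda>z. cnj \<sigma> * \<phi>0 z)"
  have \<phi>b: "\<phi> z \<in> ball 0 1" if "z \<in> \<Omega>" for z
    using that \<phi>0'(3) \<sigma> by (auto simp: \<phi>_def norm_mult)
  have rb: "\<sigma> * x \<in> ball 0 1" if "x \<in> ball 0 1" for x
    using that \<sigma> by (simp add: norm_mult)
  have \<phi>: "riemann_map \<Omega> \<phi>"
    unfolding riemann_map_def
  proof
    show "\<phi> holomorphic_on \<Omega>"
      unfolding \<phi>_def by (intro holomorphic_intros \<phi>0')
    show "bij_betw \<phi> \<Omega> (ball 0 1)"
    proof (rule bij_betw_byWitness[where f' = "\<lambda>x. g0 (\<sigma> * x)"])
      show "\<forall>z\<in>\<Omega>. g0 (\<sigma> * \<phi> z) = z"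
        using g0(2) \<sigma>\<sigma> by (simp add: \<phi>_def mult.assoc[symmetric])
      show "\<forall>x\<in>ball 0 1. \<phi> (g0 (\<sigma> * x)) = x"
        using \<phi>0g0 rb \<sigma>\<sigma> by (simp add: \<phi>_def mult.assoc[symmetric])
      show "\<phi> ` \<Omega> \<subseteq> ball 0 1"
        using \<phi>b by blast
      show "(\<lambda>x. g0 (\<sigma> * x)) ` ball 0 1 \<subseteq> \<Omega>"
        using g0\<Omega> rb by blast
    qed
  qed
  define \<psi> where "\<psi> = (\<lambda>z. cayley_inv (\<phi> z))"
  \<comment> \<open>\<open>P\<close> inverts \<open>\<psi>\<close>, so \<open>F\<close> below is
    \<open>f\<close> in half-plane coordinates.\<close>
  define P where "P = (\<lambda>w. g0 (\<sigma> * cayley w))"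
  define F where "F = \<psi> \<circ> (f \<circ> P)"
  have \<psi>h: "\<psi> z \<in> halfplane" if "z \<in> \<Omega>" for z
    unfolding \<psi>_def by (rule cayley_inv_in_halfplane[OF \<phi>b[OF that]])
  have P\<Omega>: "P w \<in> \<Omega>" if "w \<in> halfplane" for w
    unfolding P_def using g0\<Omega> rb[OF cayley_in_ball[OF that]] by blast
  have P\<psi>: "P (\<psi> z) = z" if "z \<in> \<Omega>" for z
    using g0(2)[OF that] cayley_cayley_inv[OF \<phi>b[OF that]] \<sigma>\<sigma>
    by (simp add: P_def \<psi>_def \<phi>_def mult.assoc[symmetric])
  have \<psi>P: "\<psi> (P w) = w" if "w \<in> halfplane" for w
    using \<phi>0g0[OF rb[OF cayley_in_ball[OF that]]] cayley_inv_cayley[OF that] \<sigma>\<sigma>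
    by (simp add: P_def \<psi>_def \<phi>_def mult.assoc[symmetric])
  have hol\<psi>: "\<psi> holomorphic_on \<Omega>"
  proof -
    have "cayley_inv \<circ> \<phi> holomorphic_on \<Omega>"
      using \<phi> \<phi>b by (intro holomorphic_on_compose_gen[OF _ holomorphic_cayley_inv]) (auto simp: riemann_map_def)
    then show ?thesis
      by (simp add: \<psi>_def o_def)
  qed
  have holP: "P holomorphic_on halfplane"
  proof -
    have "(\<lambda>w. \<sigma> * cayley w) holomorphic_on halfplane"
      by (intro holomorphic_intros holomorphic_cayley)
    then have "g0 \<circ> (\<lambda>w. \<sigma> * cayley w) holomorphic_on halfplane"
      using rb cayley_in_ball by (intro holomorphic_on_compose_gen[OF _ g0(1)]) auto
    then show ?thesis
      by (simp add: P_def o_def)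
  qed
  have holF: "F holomorphic_on halfplane"
    unfolding F_def using P\<Omega> f(2)
    by (intro holomorphic_on_compose_gen[OF _ hol\<psi>] holomorphic_on_compose_gen[OF holP f(1)]) auto
  have Re_F: "Re w \<le> Re (F w)" if w: "w \<in> halfplane" for w
  proof -
    define x where "x = \<sigma> * cayley w"
    have x: "x \<in> ball 0 1" "F0 x \<in> ball 0 1"
      using rb[OF cayley_in_ball[OF w]] F0b unfolding x_def by blast+
    have ne: "cmod (1 - cnj \<sigma> * y) > 0" if "y \<in> ball 0 1" for y
    proof -
      have "cmod (cnj \<sigma> * y) < 1"
        using that \<sigma> by (simp add: norm_mult)
      then show ?thesis by auto
    qed
    have Reh: "Re (cayley_inv (cnj \<sigma> * y)) = (1 - (cmod y)\<^sup>2) / (cmod (1 - cnj \<sigma> * y))\<^sup>2" for y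
      using \<sigma> by (simp add: Re_cayley_inv norm_mult)
    \<comment> \<open>In these coordinates Wolff's inequality, divided by the two squared moduli,
      compares exactly \<open>Re w\<close> with \<open>Re (F w)\<close>.\<close>
    have "w = cayley_inv (cnj \<sigma> * x)"
      using cayley_inv_cayley[OF w] \<sigma>\<sigma> by (simp add: x_def mult.assoc[symmetric])
    then have "Re w = (1 - (cmod x)\<^sup>2) / (cmod (1 - cnj \<sigma> * x))\<^sup>2"
      using Reh by metis
    also have "\<dots> \<le> (1 - (cmod (F0 x))\<^sup>2) / (cmod (1 - cnj \<sigma> * F0 x))\<^sup>2"
      unfolding pos_divide_le_eq[OF zero_less_power[OF ne[OF x(1)]]] times_divide_eq_left
        pos_le_divide_eq[OF zero_less_power[OF ne[OF x(2)]]]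
      by (rule wolff[OF x(1)])
    also have "\<dots> = Re (F w)"
      using Reh by (simp add: F_def \<psi>_def \<phi>_def P_def F0_def x_def)
    finally show ?thesis .
  qed
  have fn: "(f ^^ n) z \<in> \<Omega>" if "z \<in> \<Omega>" for n z
    using f(2) that by (induction n) auto
  have conj: "\<psi> ((f ^^ n) z) = (F ^^ n) (\<psi> z)" if "z \<in> \<Omega>" for n z
  proof (induction n)
    case (Suc n)
    then show ?case
      using P\<psi>[OF fn[OF that, of n]] by (simp add: F_def flip: Suc)
  qed simp
  have "\<exists>\<epsilon>>0. \<forall>w\<in>halfplane. (1 + \<epsilon>) * Re w \<le> Re (F w)"
  proof (rule ccontr)
    assume "\<not> ?thesis"
    then have "\<And>\<epsilon>. \<epsilon> > 0 \<Longrightarrow> \<exists>w\<in>halfplane. Re (F w) < (1 + \<epsilon>) * Re w"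
      by (meson not_le)
    then have "divergence_rate \<Omega> f = 0"
      using conj unfolding \<psi>_def by (intro divergence_rate_zero[OF assms(1,2) \<phi> f(2) holF Re_F])
    then show False
      using hyp by (simp add: hyperbolic_def)
  qed
  then obtain \<epsilon>0 where \<epsilon>0: "\<epsilon>0 > 0" "\<And>w. w \<in> halfplane \<Longrightarrow> (1 + \<epsilon>0) * Re w \<le> Re (F w)"
    by blast
  define \<mu> where "\<mu> = 1 + \<epsilon>0"
  have \<mu>: "\<mu> > 1" and Re_F\<mu>: "\<And>w. w \<in> halfplane \<Longrightarrow> \<mu> * Re w \<le> Re (F w)"
    using \<epsilon>0 by (auto simp: \<mu>_def)
  define G where "G = P \<circ> exp"
  have holG: "G holomorphic_on strip"
    unfolding G_def using exp_strip
    by (intro holomorphic_on_compose_gen[OF _ holP]) (auto intro: holomorphic_intros)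
  have "inj_on P halfplane"
    using \<psi>P by (rule inj_on_inverseI)
  then have injG: "inj_on G strip"
    unfolding G_def by (intro comp_inj_on inj_on_exp_strip) (simp add: exp_strip)
  have "P ` halfplane = \<Omega>"
    using P\<Omega> P\<psi> \<psi>h by force
  then have Gs: "G ` strip = \<Omega>"
    unfolding G_def image_comp[symmetric] exp_strip .
  \<comment> \<open>A point outside \<Omega> makes \<open>G - c\<close> free of zeros, so that it
    has a holomorphic square root.\<close>
  obtain c where c: "c \<notin> \<Omega>"
    using assms(4) by blast
  then have "c \<notin> G ` strip"
    by (simp add: Gs)
  from bounded_univalent_factor[OF holG injG this]
  obtain h s where h: "h holomorphic_on strip" "inj_on h strip" "bounded (h ` strip)"
    "\<And>z. z \<in> strip \<Longrightarrow> quadratic_cover c s (h z) = Fin (G z)"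
    by blast
  interpret strip_uniformization \<Omega> G h "quadratic_cover c s"
    by unfold_locales (use holG injG Gs h continuous_on_quadratic_cover finite_quadratic_cover_fibre in blast)+
  from angular_limit[OF assms(5)]
  obtain p where p: "p \<in> boundary_sphere \<Omega>"
    "\<And>\<theta> \<epsilon>. \<theta> < pi/2 \<Longrightarrow> \<epsilon> > 0 \<Longrightarrow> \<exists>X. \<forall>z. \<bar>Im z\<bar> \<le> \<theta> \<and> X \<le> Re z \<longrightarrow> dist (Fin (G z)) p < \<epsilon>"
    by blast
  show "has_Denjoy_Wolff_point \<Omega> f"
    unfolding has_Denjoy_Wolff_point_def
  proof (intro bexI[OF _ p(1)] allI impI)
    fix K assume K: "compact K \<and> K \<subseteq> \<Omega>"
    show "uniform_limit K (\<lambda>n z. Fin ((f ^^ n) z)) (\<lambda>_. p) sequentially"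
    \<comment> \<open>The extrema behind the uniform cone condition exist only for nonempty
      \<open>K\<close>.\<close>
    proof (cases "K = {}")
      case False
      have K': "compact (\<psi> ` K)" "\<psi> ` K \<subseteq> halfplane" "\<psi> ` K \<noteq> {}"
        using K False \<psi>h
        by (auto intro!: compact_continuous_image continuous_on_subset[OF holomorphic_on_imp_continuous_on[OF hol\<psi>]])
      from orbits_nontangential[OF holF \<mu> Re_F\<mu> K']
      obtain B b where B: "0 \<le> B" "b > 0"
        "\<And>w n. w \<in> \<psi> ` K \<Longrightarrow> \<bar>Im ((F ^^ n) w)\<bar> \<le> B * Re ((F ^^ n) w)"
        "\<And>w n. w \<in> \<psi> ` K \<Longrightarrow> b * \<mu> ^ n \<le> Re ((F ^^ n) w)"
        by blast
      from Stolz_angle_Ln[OF B(1)]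
      obtain \<theta> where \<theta>: "\<theta> < pi/2"
        "\<And>w. w \<in> halfplane \<Longrightarrow> \<bar>Im w\<bar> \<le> B * Re w \<Longrightarrow> \<bar>Im (Ln w)\<bar> \<le> \<theta>"
        by blast
      show ?thesis
      proof (rule uniform_limitI)
        fix \<epsilon> :: real assume "\<epsilon> > 0"
        then obtain X where X: "\<And>z. \<bar>Im z\<bar> \<le> \<theta> \<Longrightarrow> X \<le> Re z \<Longrightarrow> dist (Fin (G z)) p < \<epsilon>"
          using p(2)[OF \<theta>(1)] by blast
        \<comment> \<open>From this index on, all orbits starting in \<open>K\<close> have real part
          at least \<open>exp X\<close>, so their logarithms have real part at least
          \<open>X\<close>.\<close>
        obtain N where N: "exp X / b < \<mu> ^ N"
          using real_arch_pow[OF \<mu>] by blast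
        have "dist (Fin ((f ^^ n) z)) p < \<epsilon>" if n: "n \<ge> N" and z: "z \<in> K" for n z
        proof -
          define w where "w = (F ^^ n) (\<psi> z)"
          have zO: "z \<in> \<Omega>"
            using K z by blast
          have w: "w \<in> halfplane"
            using \<psi>h[OF fn[OF zO]] conj[OF zO] by (simp add: w_def)
          have "exp X \<le> b * \<mu> ^ N"
            using N B(2) by (simp add: pos_divide_less_eq mult.commute)
          also have "\<dots> \<le> b * \<mu> ^ n"
            using n \<mu> B(2) by (intro mult_left_mono power_increasing) auto
          also have "\<dots> \<le> cmod w"
            using B(4)[of "\<psi> z" n] z complex_Re_le_cmod[of w] by (simp add: w_def)
          finally have "X \<le> ln (cmod w)"
            using w by (subst ln_ge_iff) (auto simp: halfplane_def)
          moreover have "Re (Ln w) = ln (cmod w)"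
            using w by (intro Re_Ln) (auto simp: halfplane_def)
          moreover have "\<bar>Im (Ln w)\<bar> \<le> \<theta>"
            using B(3)[of "\<psi> z" n] z by (intro \<theta>(2) w) (simp add: w_def)
          ultimately have "dist (Fin (G (Ln w))) p < \<epsilon>"
            using X by simp
          moreover have "G (Ln w) = (f ^^ n) z"
            using Ln_strip[OF w] conj[OF zO, of n, symmetric] P\<psi>[OF fn[OF zO]]
            by (simp add: G_def w_def)
          ultimately show ?thesis
            by simp
        qed
        then show "\<forall>\<^sub>F n in sequentially. \<forall>z\<in>K. dist (Fin ((f ^^ n) z)) p < \<epsilon>"
          unfolding eventually_sequentially by blast
      qed
    qed simp
  qed
qed

end
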